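(* Let $\Gamma$ and $\Lambda$ be two finitely generated groups, with finite symmetric generating sets $S_\Gamma$ and $S_\Lambda$, such that $\Gamma$ is $\delta$-hyperbolic (with respect to $S_\Gamma$). Let $L\geq 1$ and let $\varphi,\psi,r:\mathbb{R}_{\ge0}\to\mathbb{R}_{\ge0}$ be non-decreasing unbounded functions. Assume that $$\lim_{n\to \infty}\frac{n^2\,r(n)\operatorname{Vol}_{S_\Gamma}(r(n))}{\varphi(n/r(n))}= 0,$$ and that for all large enough $n$, $$\frac{r(n)}{18}\ge 4(\delta+1)\log_2 n+3\psi^{-1}(3Ln).$$ Assume that $(\Omega,\mu,X_\Gamma,X_\Lambda)$ is a cobounded measure equivalence coupling from $\Gamma$ to $\Lambda$, normalized so that $\mu(X_\Gamma)=1$, and such that the associated cocycles $\alpha\colon \Gamma\times X_\Lambda\to \Lambda$ and $\beta\colon \Lambda\times X_\Gamma \to \Gamma$ satisfy: (i) for all $s\in S_\Gamma$, $\displaystyle\int_{X_\Lambda} \varphi(|\alpha(s,x)|_{S_\Lambda})\, d\mu(x)< \infty$; (ii) for all $t\in S_\Lambda$, $\displaystyle\int_{X_\Gamma} \psi(|\beta(t,x)|_{S_\Gamma})\,d\mu(x)\leq L$. Then $\Lambda$ is hyperbolic.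
   Context: A geodesic metric space $(X,d)$ is $\delta$-hyperbolic ($\delta\ge 0$) if each side of every geodesic triangle is contained in the $\delta$-neighbourhood of the union of the other two sides; it is hyperbolic if it is $\delta$-hyperbolic for some $\delta$. A finitely generated group is ($\delta$-)hyperbolic if its Cayley graph with respect to its given finite generating set, with edges identified with unit intervals and endowed with the path metric, is ($\delta$-)hyperbolic. Word lengths are denoted $|\cdot|_{S_\Gamma}$, $|\cdot|_{S_\Lambda}$, and $\operatorname{Vol}_{S_\Gamma}(R)$ is the growth function $\operatorname{Vol}_{S_\Gamma}(n)=|S_\Gamma^n|$, i.e. the number of elements of the ball of radius $R$ around $e_\Gamma$ for the word metric. $\psi^{-1}$ denotes the (generalized) inverse $\psi^{-1}(t)=\inf\{s\ge0:\psi(s)\ge t\}$. A measure equivalence coupling from a countable group $\Gamma$ to a countable group $\Lambda$ is a tuple $(\Omega,\mu,X_\Gamma,X_\Lambda)$ where $(\Omega,\mu)$ is a $\sigma$-finite standard measured space endowed with commuting free measure-preserving actions of $\Gamma$ and $\Lambda$ (both denoted $*$), and $X_\Gamma$, $X_\Lambda\subseteq\Omega$ are finite measure fundamental domains for the $\Gamma$-action and the $\Lambda$-action respectively. Here a fundamental domain for the $\Gamma$-action is a measurable subset $X_\Gamma\subseteq\Omega$ such that $\Gamma\times X_\Gamma\to\Omega$, $(\gamma,x)\mapsto\gamma*x$, is a measure-preserving bijection for the product of counting measure and $\mu|_{X_\Gamma}$ (similarly for $\Lambda$). The associated cocycles $\alpha$ and $\beta$ are uniquely defined by $\alpha(\gamma,x)*(\gamma*x)\in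 X_\Lambda$ for $\gamma\in\Gamma$, $x\in X_\Lambda$, and $\beta(\lambda,x)*(\lambda*x)\in X_\Gamma$ for $\lambda\in\Lambda$, $x\in X_\Gamma$. The coupling is cobounded if $X_\Gamma$ is contained in the union of finitely many $\Lambda$-translates of $X_\Lambda$. *)

theory Defs
  imports "HOL-Analysis.Analysis" "HOL-Algebra.Generated_Groups" "HOL-Algebra.Group_Action"
begin

section \<open>Hyperbolic metric spaces\<close>

definition geodesic :: "'a set \<Rightarrow> ('a \<Rightarrow> 'a \<Rightarrow> real) \<Rightarrow> 'a \<Rightarrow> 'a \<Rightarrow> (real \<Rightarrow> 'a) \<Rightarrow> bool" where
  "geodesic X d x y c \<longleftrightarrow>
     c ` {0..d x y} \<subseteq> X \<and> c 0 = x \<and> c (d x y) = y \<and>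
     (\<forall>s\<in>{0..d x y}. \<forall>t\<in>{0..d x y}. d (c s) (c t) = \<bar>s - t\<bar>)"

definition geodesic_segment :: "'a set \<Rightarrow> ('a \<Rightarrow> 'a \<Rightarrow> real) \<Rightarrow> 'a \<Rightarrow> 'a \<Rightarrow> 'a set \<Rightarrow> bool" where
  "geodesic_segment X d x y I \<longleftrightarrow> (\<exists>c. geodesic X d x y c \<and> I = c ` {0..d x y})"

definition geodesic_metric_space :: "'a set \<Rightarrow> ('a \<Rightarrow> 'a \<Rightarrow> real) \<Rightarrow> bool" where
  "geodesic_metric_space X d \<longleftrightarrow>
     Metric_space X d \<and> (\<forall>x\<in>X. \<forall>y\<in>X. \<exists>c. geodesic X d x y c)"

text \<open>Neighbourhoods are closed, so that \<open>\<delta> = 0\<close> is meaningful (trees are 0-hyperbolic).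
  The sides are compact, so "distance to the set at most \<open>\<delta>\<close>" is witnessed by a point of the set.\<close>

definition neighbourhood :: "'a set \<Rightarrow> ('a \<Rightarrow> 'a \<Rightarrow> real) \<Rightarrow> real \<Rightarrow> 'a set \<Rightarrow> 'a set" where
  "neighbourhood X d \<delta> A = {p \<in> X. \<exists>q\<in>A. d p q \<le> \<delta>}"

definition hyperbolic_with :: "real \<Rightarrow> 'a set \<Rightarrow> ('a \<Rightarrow> 'a \<Rightarrow> real) \<Rightarrow> bool" where
  "hyperbolic_with \<delta> X d \<longleftrightarrow>
     0 \<le> \<delta> \<and> geodesic_metric_space X d \<and>
     (\<forall>x\<in>X. \<forall>y\<in>X. \<forall>z\<in>X. \<forall>I J K.
        geodesic_segment X d x y I \<and> geodesic_segment X d y z J \<and> geodesic_segment X d z x K \<longrightarrow>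
        I \<subseteq> neighbourhood X d \<delta> (J \<union> K) \<and>
        J \<subseteq> neighbourhood X d \<delta> (K \<union> I) \<and>
        K \<subseteq> neighbourhood X d \<delta> (I \<union> J))"

section \<open>Geometric realization of a graph\<close>

text \<open>A point of the realization is given by its barycentric coordinates, a function on the
  vertices; \<open>edge_point u v t\<close> is the point at parameter \<open>t\<close> of the edge from \<open>u\<close> to \<open>v\<close>, so
  \<open>edge_point u v t = edge_point v u (1 - t)\<close> and \<open>edge_point v v 0\<close> is the vertex \<open>v\<close>.\<close>

definition edge_point :: "'v \<Rightarrow> 'v \<Rightarrow> real \<Rightarrow> 'v \<Rightarrow> real" where
  "edge_point u v t = (\<lambda>w. (1 - t) * of_bool (w = u) + t * of_bool (w = v))"

definition graph_realization :: "'v set \<Rightarrow> ('v \<Rightarrow> 'v \<Rightarrow> bool) \<Rightarrow> ('v \<Rightarrow> real) set" where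
  "graph_realization V E =
     {edge_point v v 0 |v. v \<in> V} \<union>
     {edge_point u v t |u v t. u \<in> V \<and> v \<in> V \<and> E u v \<and> 0 \<le> t \<and> t \<le> 1}"

text \<open>\<open>pl_path V E p l q\<close>: there is a piecewise linear path of length \<open>l\<close> from \<open>p\<close> to \<open>q\<close>, that is,
  a finite concatenation of linear paths, each inside one edge identified with the unit interval.\<close>

inductive pl_path :: "'v set \<Rightarrow> ('v \<Rightarrow> 'v \<Rightarrow> bool) \<Rightarrow> ('v \<Rightarrow> real) \<Rightarrow> real \<Rightarrow> ('v \<Rightarrow> real) \<Rightarrow> bool"
  for V :: "'v set" and E :: "'v \<Rightarrow> 'v \<Rightarrow> bool" where
  const: "p \<in> graph_realization V E \<Longrightarrow> pl_path V E p 0 p"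
| step: "pl_path V E p l (edge_point u v s) \<Longrightarrow> u \<in> V \<Longrightarrow> v \<in> V \<Longrightarrow> E u v \<Longrightarrow>
         0 \<le> s \<Longrightarrow> s \<le> 1 \<Longrightarrow> 0 \<le> t \<Longrightarrow> t \<le> 1 \<Longrightarrow>
         pl_path V E p (l + \<bar>s - t\<bar>) (edge_point u v t)"

text \<open>The value 0 when there is no path is a dummy value: it concerns only arguments outside the
  realization, as long as the graph is connected.\<close>

definition path_metric ::
    "'v set \<Rightarrow> ('v \<Rightarrow> 'v \<Rightarrow> bool) \<Rightarrow> ('v \<Rightarrow> real) \<Rightarrow> ('v \<Rightarrow> real) \<Rightarrow> real" where
  "path_metric V E p q =
     (if \<exists>l. pl_path V E p l q then Inf {l. pl_path V E p l q} else 0)"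

section \<open>Finitely generated groups\<close>

definition finite_symmetric_generating_set :: "('g, 'm) monoid_scheme \<Rightarrow> 'g set \<Rightarrow> bool" where
  "finite_symmetric_generating_set G S \<longleftrightarrow>
     finite S \<and> S \<subseteq> carrier G \<and> (\<forall>s\<in>S. inv\<^bsub>G\<^esub> s \<in> S) \<and> generate G S = carrier G"

definition word_length :: "('g, 'm) monoid_scheme \<Rightarrow> 'g set \<Rightarrow> 'g \<Rightarrow> nat" where
  "word_length G S g =
     (LEAST n. \<exists>ws. length ws = n \<and> set ws \<subseteq> S \<and> foldr (mult G) ws \<one>\<^bsub>G\<^esub> = g)"

definition Vol :: "('g, 'm) monoid_scheme \<Rightarrow> 'g set \<Rightarrow> real \<Rightarrow> nat" where
  "Vol G S R = card {g \<in> carrier G. real (word_length G S g) \<le> R}"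

text \<open>The Cayley graph is taken as a simple graph: no loop for \<open>\<one> \<in> S\<close>, one edge for
  \<open>s\<close> and \<open>inv s\<close>.\<close>

definition cayley_edge :: "('g, 'm) monoid_scheme \<Rightarrow> 'g set \<Rightarrow> 'g \<Rightarrow> 'g \<Rightarrow> bool" where
  "cayley_edge G S g h \<longleftrightarrow> g \<noteq> h \<and> (\<exists>s\<in>S. h = g \<otimes>\<^bsub>G\<^esub> s)"

definition hyperbolic_group_with :: "real \<Rightarrow> ('g, 'm) monoid_scheme \<Rightarrow> 'g set \<Rightarrow> bool" where
  "hyperbolic_group_with \<delta> G S \<longleftrightarrow>
     hyperbolic_with \<delta> (graph_realization (carrier G) (cayley_edge G S))
       (path_metric (carrier G) (cayley_edge G S))"

definition hyperbolic_group :: "('g, 'm) monoid_scheme \<Rightarrow> 'g set \<Rightarrow> bool" where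
  "hyperbolic_group G S \<longleftrightarrow> (\<exists>\<delta>\<ge>0. hyperbolic_group_with \<delta> G S)"

section \<open>Measure equivalence couplings\<close>

definition standard_borel :: "'w measure \<Rightarrow> bool" where
  "standard_borel M \<longleftrightarrow>
     (\<exists>T. completely_metrizable_space T \<and> second_countable T \<and>
          topspace T = space M \<and> sets M = sigma_sets (space M) {U. openin T U})"

text \<open>Recall that \<^const>\<open>group_action\<close> asks each \<open>act g\<close> to be an extensional function on
  \<open>space M\<close>, i.e. to take the value \<^const>\<open>undefined\<close> outside.\<close>

definition free_mp_action :: "('g, 'm) monoid_scheme \<Rightarrow> 'w measure \<Rightarrow> ('g \<Rightarrow> 'w \<Rightarrow> 'w) \<Rightarrow> bool" where
  "free_mp_action G M act \<longleftrightarrow>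
     group_action G (space M) act \<and>
     (\<forall>g\<in>carrier G. \<forall>x\<in>space M. act g x = x \<longrightarrow> g = \<one>\<^bsub>G\<^esub>) \<and>
     (\<forall>g\<in>carrier G. act g \<in> measurable M M \<and> distr M M (act g) = M)"

definition fundamental_domain ::
    "('g, 'm) monoid_scheme \<Rightarrow> 'w measure \<Rightarrow> ('g \<Rightarrow> 'w \<Rightarrow> 'w) \<Rightarrow> 'w set \<Rightarrow> bool" where
  "fundamental_domain G M act X \<longleftrightarrow>
     X \<in> sets M \<and>
     bij_betw (\<lambda>(g, x). act g x) (carrier G \<times> X) (space M) \<and>
     (\<lambda>(g, x). act g x) \<in> measurable (count_space (carrier G) \<Otimes>\<^sub>M restrict_space M X) M \<and>
     distr (count_space (carrier G) \<Otimes>\<^sub>M restrict_space M X) M (\<lambda>(g, x). act g x) = M"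

definition me_coupling ::
    "('g, 'm) monoid_scheme \<Rightarrow> ('h, 'n) monoid_scheme \<Rightarrow> 'w measure \<Rightarrow>
     ('g \<Rightarrow> 'w \<Rightarrow> 'w) \<Rightarrow> ('h \<Rightarrow> 'w \<Rightarrow> 'w) \<Rightarrow> 'w set \<Rightarrow> 'w set \<Rightarrow> bool" where
  "me_coupling G H M actG actH XG XH \<longleftrightarrow>
     group G \<and> countable (carrier G) \<and> group H \<and> countable (carrier H) \<and>
     standard_borel M \<and> sigma_finite_measure M \<and>
     free_mp_action G M actG \<and> free_mp_action H M actH \<and>
     (\<forall>g\<in>carrier G. \<forall>h\<in>carrier H. \<forall>x\<in>space M. actG g (actH h x) = actH h (actG g x)) \<and>
     fundamental_domain G M actG XG \<and> emeasure M XG < \<infinity> \<and>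
     fundamental_domain H M actH XH \<and> emeasure M XH < \<infinity>"

text \<open>For \<open>x \<in> XH\<close>, \<open>cocycle actG H actH XH g x\<close> is the unique \<open>h \<in> H\<close> moving \<open>actG g x\<close> back
  into the fundamental domain \<open>XH\<close> of \<open>H\<close>. This is \<open>\<alpha>\<close>; exchanging the groups gives \<open>\<beta>\<close>.\<close>

definition cocycle ::
    "('g \<Rightarrow> 'w \<Rightarrow> 'w) \<Rightarrow> ('h, 'n) monoid_scheme \<Rightarrow> ('h \<Rightarrow> 'w \<Rightarrow> 'w) \<Rightarrow> 'w set \<Rightarrow> 'g \<Rightarrow> 'w \<Rightarrow> 'h" where
  "cocycle actG H actH XH g x = (THE h. h \<in> carrier H \<and> actH h (actG g x) \<in> XH)"

definition cobounded :: "('h, 'n) monoid_scheme \<Rightarrow> ('h \<Rightarrow> 'w \<Rightarrow> 'w) \<Rightarrow> 'w set \<Rightarrow> 'w set \<Rightarrow> bool" where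
  "cobounded H actH XG XH \<longleftrightarrow>
     (\<exists>F. finite F \<and> F \<subseteq> carrier H \<and> XG \<subseteq> (\<Union>h\<in>F. actH h ` XH))"

section \<open>Rate functions\<close>

text \<open>A function \<open>\<real>\<^sub>\<ge>\<^sub>0 \<rightarrow> \<real>\<^sub>\<ge>\<^sub>0\<close> is a function on the reals of which only the values on
  \<open>{0..}\<close> matter.\<close>

definition rate_function :: "(real \<Rightarrow> real) \<Rightarrow> bool" where
  "rate_function f \<longleftrightarrow> f ` {0..} \<subseteq> {0..} \<and> mono_on {0..} f \<and> \<not> bdd_above (f ` {0..})"

definition gen_inverse :: "(real \<Rightarrow> real) \<Rightarrow> real \<Rightarrow> real" where
  "gen_inverse f t = Inf {s. 0 \<le> s \<and> t \<le> f s}"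

end

theory Submission
  imports Defs
begin

text \<open>
  The two groups are compared at one scale \<open>n\<close> at a time. A point \<open>x\<close> of \<open>X\<^sub>\<Gamma>\<close>, chosen at random
  with respect to \<open>\<mu>\<close>, gives a map \<open>f\<close> from \<open>\<Lambda>\<close> to \<open>\<Gamma>\<close>, namely \<open>f \<lambda> = (\<beta>(\<lambda>\<^sup>-\<^sup>1, x))\<^sup>-\<^sup>1\<close>. By the
  cocycle identity, one step in the Cayley graph of \<open>\<Lambda>\<close> moves \<open>f\<close> by the length of a value
  \<open>\<beta>(t, y)\<close> with \<open>t\<close> a generator and \<open>y\<close> again distributed like \<open>\<mu>\<close> on \<open>X\<^sub>\<Gamma>\<close>. Condition (ii) and Markov's
  inequality bound the probability of a jump longer than \<open>J = \<psi>\<^sup>-\<^sup>1(3Ln)\<close> by \<open>1/(3n)\<close>. So along a walk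
  of at most \<open>5n/2\<close> steps all jumps are at most \<open>J\<close> with probability at least \<open>1/6\<close>. In the
  other direction, \<open>\<lambda>\<^sup>-\<^sup>1\<lambda>'\<close> is, up to a bounded error due to the cobounded coupling, a value of
  \<open>\<alpha>\<close> at the element \<open>(f \<lambda>)\<^sup>-\<^sup>1 f \<lambda>'\<close> of \<open>\<Gamma>\<close>. Condition (i), the cocycle identity for \<open>\<alpha>\<close> and a
  union bound over the ball of radius \<open>r(n)\<close> show that, outside an event whose probability tends
  to 0, points of the walk whose images are at distance \<open>\<ell> \<le> r(n)/30\<close> are themselves at distance
  at most \<open>\<ell>n/r(n)\<close> plus a constant. One \<open>x\<close> therefore has both properties
  (\<open>coarse_embedding_exists\<close>, \<open>eventually_coarsely_embeds\<close>).

  In the hyperbolic space \<open>\<Gamma>\<close>, a closed chain of \<open>N\<close> jumps of size at most \<open>J\<close> looks like a loop in a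
  tree, up to an error \<open>J + 2\<delta> log\<^sub>2 N\<close> plus a constant (\<open>hyperbolic_bigon_coincidence\<close>). By the
  assumption on \<open>r\<close> this error is below \<open>r(n)/30\<close>, so it becomes \<open>n/30\<close> plus a constant in \<open>\<Lambda>\<close>
  (\<open>loop_coincidence\<close>). A loop in a tree traverses every edge it meets at least twice, so every point of a
  geodesic side of a loop in \<open>\<Lambda>\<close> is close, relative to the length of the loop, to the rest of the
  loop. With the constants at hand: in a geodesic hexagon of perimeter at most \<open>30h\<close>, each side
  is in the \<open>(9/10)h\<close>-neighbourhood of the others, for all large \<open>h\<close> (\<open>thin_hexagons_of_scale\<close>).

  This scale-invariant property forces hyperbolicity (\<open>hyperbolic_if_thin_hexagons\<close>). If all
  triangles up to some perimeter are \<open>h\<close>-thin, then around a point \<open>p\<close> of a side one can cut off a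
  hexagon of perimeter at most \<open>30h\<close> in which \<open>p\<close> is far from all sides that do not belong to the
  triangle. So the triangles are even \<open>(9/10)h\<close>-thin, and the thinness decreases geometrically down
  to a constant that does not depend on the perimeter.
\<close>

section \<open>Geodesic segments\<close>

lemma geodesic_segmentI:
  "geodesic X d x y c \<Longrightarrow> geodesic_segment X d x y (c ` {0..d x y})"
  by (auto simp: geodesic_segment_def)

context Metric_space
begin

lemma geodesic_segment_subset:
  assumes "geodesic_segment M d x y I" shows "I \<subseteq> M" "x \<in> I" "y \<in> I" "x \<in> M" "y \<in> M"
proof -
  from assms obtain c where c: "geodesic M d x y c" "I = c ` {0..d x y}"
    by (auto simp: geodesic_segment_def)
  have "c 0 \<in> I" "c (d x y) \<in> I" using c(2) by auto
  with c show "I \<subseteq> M" "x \<in> I" "y \<in> I" "x \<in> M" "y \<in> M" by (auto simp: geodesic_def)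
qed

lemma geodesic_segment_in: "geodesic_segment M d x y I \<Longrightarrow> p \<in> I \<Longrightarrow> p \<in> M"
  using geodesic_segment_subset(1) by (rule subsetD)

lemma geodesic_part:
  assumes c: "geodesic M d x y c" and st: "0 \<le> s" "s \<le> t" "t \<le> d x y"
  shows "geodesic_segment M d (c s) (c t) (c ` {s..t})"
proof -
  have dist: "d (c a) (c b) = \<bar>a - b\<bar>" if "a \<in> {0..d x y}" "b \<in> {0..d x y}" for a b
    using c that by (auto simp: geodesic_def)
  have D: "d (c s) (c t) = t - s" using dist[of s t] st by auto
  have "geodesic M d (c s) (c t) (\<lambda>u. c (s + u))"
    unfolding geodesic_def D
  proof (intro conjI ballI)
    show "(\<lambda>u. c (s + u)) ` {0..t - s} \<subseteq> M" using c st by (fastforce simp: geodesic_def)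
  qed (use st in \<open>auto simp: dist\<close>)
  moreover have "(\<lambda>u. c (s + u)) ` {0..t - s} = c ` {s..t}"
  proof -
    have "(\<lambda>u. c (s + u)) ` {0..t - s} = c ` ((+) s ` {0..t - s})" by (simp only: image_image)
    then show ?thesis by (simp add: image_add_atLeastAtMost)
  qed
  ultimately show ?thesis
    using geodesic_segmentI[of M d "c s" "c t" "\<lambda>u. c (s + u)"] D by simp
qed

lemma geodesic_segment_sym:
  assumes "geodesic_segment M d x y I" shows "geodesic_segment M d y x I"
proof -
  from assms obtain c where c: "geodesic M d x y c" "I = c ` {0..d x y}"
    by (auto simp: geodesic_segment_def)
  let ?D = "d x y"
  have "geodesic M d y x (\<lambda>u. c (?D - u))"
    using c(1) by (auto simp: geodesic_def commute[of y x])
  moreover have "(\<lambda>u. c (?D - u)) ` {0..?D} = c ` ((-) ?D ` {0..?D})" by (simp only: image_image)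
  then have "(\<lambda>u. c (?D - u)) ` {0..?D} = c ` {0..?D}"
    by simp
  ultimately show ?thesis
    using geodesic_segmentI[of M d y x "\<lambda>u. c (?D - u)"] c(2) by (simp add: commute[of y x])
qed

lemma geodesic_segment_split:
  assumes "geodesic_segment M d x y I" "p \<in> I"
  obtains I1 I2 where "geodesic_segment M d x p I1" "I1 \<subseteq> I"
    "geodesic_segment M d p y I2" "I2 \<subseteq> I" "d x p + d p y = d x y"
proof -
  from assms(1) obtain c where c: "geodesic M d x y c" "I = c ` {0..d x y}"
    by (auto simp: geodesic_segment_def)
  from assms(2) c obtain t where t: "t \<in> {0..d x y}" "p = c t" by auto
  have e: "c 0 = x" "c (d x y) = y" using c by (auto simp: geodesic_def)
  have "geodesic_segment M d x p (c ` {0..t})" "geodesic_segment M d p y (c ` {t..d x y})"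
    using geodesic_part[OF c(1), of 0 t] geodesic_part[OF c(1), of t "d x y"] t e by auto
  moreover have "d x p + d p y = d x y"
  proof -
    have D: "d (c s) (c u) = \<bar>s - u\<bar>" if "s \<in> {0..d x y}" "u \<in> {0..d x y}" for s u
      using c(1) that unfolding geodesic_def by blast
    show ?thesis using D[of 0 t] D[of t "d x y"] t unfolding e by auto
  qed
  moreover have "c ` {0..t} \<subseteq> I" "c ` {t..d x y} \<subseteq> I" using c(2) t by auto
  ultimately show ?thesis using that by blast
qed

lemma geodesic_segment_point_at:
  assumes "geodesic_segment M d x y I" "0 \<le> s" "s \<le> d x y"
  obtains p where "p \<in> I" "d x p = s"
proof -
  from assms(1) obtain c where c: "geodesic M d x y c" "I = c ` {0..d x y}"
    by (auto simp: geodesic_segment_def)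
  have "d (c 0) (c s) = \<bar>0 - s\<bar>" "c 0 = x" using c(1) assms unfolding geodesic_def by auto
  then show ?thesis using that[of "c s"] c(2) assms by auto
qed

lemma geodesic_segment_refl: "x \<in> M \<Longrightarrow> geodesic_segment M d x x {x}"
  unfolding geodesic_segment_def geodesic_def by (intro exI[of _ "\<lambda>_. x"]) auto

section \<open>Chains in a hyperbolic space\<close>

lemma hyperbolic_with_side:
  assumes h: "hyperbolic_with \<delta> M d"
    and seg: "geodesic_segment M d x y I" "geodesic_segment M d x z J" "geodesic_segment M d z y K"
    and p: "p \<in> I"
  shows "\<exists>q\<in>J \<union> K. d p q \<le> \<delta>"
proof -
  have "x \<in> M" "y \<in> M" "z \<in> M"
    using geodesic_segment_subset(4,5)[OF seg(1)] geodesic_segment_subset(5)[OF seg(2)] by auto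
  moreover have "geodesic_segment M d y z K" "geodesic_segment M d z x J"
    using geodesic_segment_sym[OF seg(3)] geodesic_segment_sym[OF seg(2)] by auto
  ultimately have "I \<subseteq> neighbourhood M d \<delta> (K \<union> J)"
    using h[unfolded hyperbolic_with_def, THEN conjunct2, THEN conjunct2, rule_format, of x y z I K J] seg(1)
    by blast
  then have "p \<in> neighbourhood M d \<delta> (K \<union> J)" using p by (rule subsetD)
  then show ?thesis unfolding neighbourhood_def by blast
qed

lemma geodesic_segment_exists:
  assumes "geodesic_metric_space M d" "x \<in> M" "y \<in> M"
  shows "\<exists>I. geodesic_segment M d x y I"
proof -
  have "\<exists>c. geodesic M d x y c"
    using assms unfolding geodesic_metric_space_def by (elim conjE) (drule (1) bspec)+
  then show ?thesis using geodesic_segmentI by (elim exE) (rule exI)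
qed

text \<open>Halving the chain replaces one geodesic by two sides of a triangle and costs \<open>\<delta>\<close>. After
  \<open>k\<close> halvings only a single jump is left, and each of its points is within \<open>J / 2\<close> of an end. So the
  error grows only logarithmically with the number of jumps.\<close>

lemma geodesic_near_chain:
  assumes h: "hyperbolic_with \<delta> M d" and J: "0 \<le> J"
    and "a \<le> b" "b - a \<le> 2 ^ k"
    and "\<And>i. a \<le> i \<Longrightarrow> i \<le> b \<Longrightarrow> v i \<in> M"
    and "\<And>i. a \<le> i \<Longrightarrow> i < b \<Longrightarrow> d (v i) (v (Suc i)) \<le> J"
    and "geodesic_segment M d (v a) (v b) I" "p \<in> I"
  shows "\<exists>i. a \<le> i \<and> i \<le> b \<and> d p (v i) \<le> real k * \<delta> + J / 2"
proof -
  have gX: "geodesic_metric_space M d" using h by (simp add: hyperbolic_with_def)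
  show ?thesis using assms(3-)
  proof (induction k arbitrary: a b I p)
    case 0
    then have "b = a \<or> b = Suc a" by auto
    then have le: "d (v a) (v b) \<le> J"
    proof
      assume "b = a" with 0 J zero[of "v a" "v a"] show ?thesis by auto
    qed (use 0 in auto)
    have "d (v a) p + d p (v b) = d (v a) (v b)"
      by (rule geodesic_segment_split[OF 0(5,6)])
    then have "d p (v a) \<le> J / 2 \<or> d p (v b) \<le> J / 2" using le commute[of p "v a"] by linarith
    then show ?case using \<open>a \<le> b\<close> by auto
  next
    case (Suc k)
    define j where "j = (a + b) div 2"
    have j: "a \<le> j" "j \<le> b" "j - a \<le> 2 ^ k" "b - j \<le> 2 ^ k"
      using Suc.prems(1,2) unfolding j_def by auto
    have "v a \<in> M" "v j \<in> M" "v b \<in> M" using Suc.prems j by auto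
    then obtain I1 I2 where I: "geodesic_segment M d (v a) (v j) I1"
        "geodesic_segment M d (v j) (v b) I2"
      using geodesic_segment_exists[OF gX, of "v a" "v j"] geodesic_segment_exists[OF gX, of "v j" "v b"]
      by auto
    obtain q where q: "q \<in> I1 \<union> I2" "d p q \<le> \<delta>"
      using hyperbolic_with_side[OF h Suc.prems(5) I Suc.prems(6)] by blast
    have "\<exists>i. a \<le> i \<and> i \<le> b \<and> d q (v i) \<le> real k * \<delta> + J / 2"
    proof (cases "q \<in> I1")
      case True
      have "\<exists>i. a \<le> i \<and> i \<le> j \<and> d q (v i) \<le> real k * \<delta> + J / 2"
        by (rule Suc.IH[OF j(1,3) _ _ I(1) True]) (use Suc.prems j in auto)
      then show ?thesis using j le_trans by blast
    next
      case False
      then have "q \<in> I2" using q by blast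
      then have "\<exists>i. j \<le> i \<and> i \<le> b \<and> d q (v i) \<le> real k * \<delta> + J / 2"
        by (rule Suc.IH[OF j(2,4) _ _ I(2), rotated 2]) (use Suc.prems j in auto)
      then show ?thesis using j le_trans by blast
    qed
    then obtain i where i: "a \<le> i" "i \<le> b" "d q (v i) \<le> real k * \<delta> + J / 2" by blast
    have "p \<in> M" by (rule geodesic_segment_in[OF Suc.prems(5,6)])
    moreover have "q \<in> M" using q(1) geodesic_segment_in[OF I(1)] geodesic_segment_in[OF I(2)] by blast
    moreover have "v i \<in> M" using Suc.prems(3) i by simp
    ultimately have "d p (v i) \<le> \<delta> + (real k * \<delta> + J / 2)" using triangle[of p q "v i"] q i by linarith
    also have "\<dots> = real (Suc k) * \<delta> + J / 2" by (simp add: algebra_simps)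
    finally show ?case using i(1,2) by (intro exI[of _ i]) simp
  qed
qed

text \<open>Along \<open>I\<close>, every point is close to \<open>J\<close> or to \<open>K\<close>, the first point to \<open>J\<close> and the last one to \<open>K\<close>; the
  centre is where the change happens. The extra 1 pays for taking a point just before the
  supremum of the parameters close to \<open>J\<close>, in place of a limit argument.\<close>

lemma triangle_centre:
  assumes h: "hyperbolic_with \<delta> M d"
    and seg: "geodesic_segment M d x y I" "geodesic_segment M d x z J" "geodesic_segment M d z y K"
  shows "\<exists>g\<in>I. \<exists>p\<in>J. \<exists>q\<in>K. d g p \<le> \<delta> \<and> d g q \<le> \<delta> + 1"
proof -
  from seg(1) obtain c where c: "geodesic M d x y c" "I = c ` {0..d x y}"
    by (auto simp: geodesic_segment_def)
  have e: "c 0 = x" "c (d x y) = y" using c by (auto simp: geodesic_def)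
  have \<delta>: "0 \<le> \<delta>" using h by (simp add: hyperbolic_with_def)
  define A where "A = {t \<in> {0..d x y}. \<exists>p\<in>J. d (c t) p \<le> \<delta>}"
  have A0: "0 \<in> A" unfolding A_def using e \<delta> geodesic_segment_subset[OF seg(2)]
    by (auto intro!: bexI[of _ x])
  have bdd: "bdd_above A" unfolding A_def by (auto intro: bdd_aboveI)
  obtain t where t: "t \<in> A" "Sup A - 1 < t"
    using less_cSup_iff[of A "Sup A - 1"] A0 bdd by auto
  define t' where "t' = min (d x y) (t + 1)"
  have tr: "0 \<le> t" "t \<le> d x y" "t \<le> t'" "t' \<le> t + 1" "t' \<le> d x y"
    using t by (auto simp: A_def t'_def)
  have "\<exists>q\<in>K. d (c t') q \<le> \<delta>"
  proof (cases "t' = d x y")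
    case True
    then show ?thesis using e \<delta> geodesic_segment_subset[OF seg(3)] by (auto intro!: bexI[of _ y])
  next
    case False
    then have "Sup A < t'" using t by (auto simp: t'_def min_def split: if_splits)
    then have "t' \<notin> A" using cSup_upper[OF _ bdd] by force
    moreover have "c t' \<in> I" using c tr by auto
    ultimately show ?thesis using hyperbolic_with_side[OF h seg, of "c t'"] tr by (auto simp: A_def)
  qed
  then obtain q where q: "q \<in> K" "d (c t') q \<le> \<delta>" by blast
  have "d (c t) (c t') = \<bar>t - t'\<bar>" using c(1) tr unfolding geodesic_def by auto
  then have "d (c t) (c t') \<le> 1" using tr by auto
  moreover have "c t \<in> M" "c t' \<in> M" "q \<in> M"
    using c tr q geodesic_segment_subset(1)[OF seg(3)] by (auto simp: geodesic_def)
  ultimately have "d (c t) q \<le> \<delta> + 1" using triangle[of "c t" "c t'" q] q by linarith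
  moreover obtain p where "p \<in> J" "d (c t) p \<le> \<delta>" using t by (auto simp: A_def)
  moreover have "c t \<in> I" using c tr by auto
  ultimately show ?thesis using q by blast
qed

text \<open>In a tree, the projection of \<open>v i\<close> to the geodesic between the common ends of the two chains would
  be visited by \<open>v\<close> before and after time \<open>i\<close>, and also by \<open>u\<close>. Here the projection is the centre
  of the triangle spanned by the ends and \<open>v i\<close>, and each visit is approximate.\<close>

lemma hyperbolic_bigon_coincidence:
  assumes h: "hyperbolic_with \<delta> M d" and J: "0 \<le> J"
    and km: "k \<le> 2 ^ e" "m \<le> 2 ^ e"
    and v: "\<And>i. i \<le> k \<Longrightarrow> v i \<in> M" "\<And>i. i < k \<Longrightarrow> d (v i) (v (Suc i)) \<le> J"
    and u: "\<And>i. i \<le> m \<Longrightarrow> u i \<in> M" "\<And>i. i < m \<Longrightarrow> d (u i) (u (Suc i)) \<le> J"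
    and ends: "u 0 = v 0" "u m = v k" and i: "i \<le> k"
  defines "R \<equiv> J + (2 * real e + 2) * \<delta> + 1"
  shows "\<exists>i1 i2 j. i1 \<le> i \<and> i \<le> i2 \<and> i2 \<le> k \<and> j \<le> m \<and> d (v i1) (v i2) \<le> R \<and> d (v i1) (u j) \<le> R"
proof -
  have \<delta>: "0 \<le> \<delta>" using h by (simp add: hyperbolic_with_def)
  have gX: "geodesic_metric_space M d" using h by (simp add: hyperbolic_with_def)
  have M: "v 0 \<in> M" "v i \<in> M" "v k \<in> M" using v i by auto
  obtain I I1 I2 where I: "geodesic_segment M d (v 0) (v k) I"
     "geodesic_segment M d (v 0) (v i) I1" "geodesic_segment M d (v i) (v k) I2"
    using geodesic_segment_exists[OF gX M(1,3)] geodesic_segment_exists[OF gX M(1,2)]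
      geodesic_segment_exists[OF gX M(2,3)] by auto
  obtain g p q where g: "g \<in> I" "p \<in> I1" "q \<in> I2" "d g p \<le> \<delta>" "d g q \<le> \<delta> + 1"
    using triangle_centre[OF h I] by blast
  have i1: "\<exists>i1. 0 \<le> i1 \<and> i1 \<le> i \<and> d p (v i1) \<le> real e * \<delta> + J / 2"
    by (rule geodesic_near_chain[OF h J _ _ _ _ I(2) g(2)]) (use km v i in auto)
  have i2: "\<exists>i2. i \<le> i2 \<and> i2 \<le> k \<and> d q (v i2) \<le> real e * \<delta> + J / 2"
    by (rule geodesic_near_chain[OF h J _ _ _ _ I(3) g(3)]) (use km v i in auto)
  have I': "geodesic_segment M d (u 0) (u m) I" using I ends by simp
  have j: "\<exists>j. 0 \<le> j \<and> j \<le> m \<and> d g (u j) \<le> real e * \<delta> + J / 2"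
    by (rule geodesic_near_chain[OF h J _ _ _ _ I' g(1)]) (use km u in auto)
  obtain i1 i2 j where n: "i1 \<le> i" "d p (v i1) \<le> real e * \<delta> + J / 2"
    "i \<le> i2" "i2 \<le> k" "d q (v i2) \<le> real e * \<delta> + J / 2"
    "j \<le> m" "d g (u j) \<le> real e * \<delta> + J / 2" using i1 i2 j by blast
  have M': "g \<in> M" "p \<in> M" "q \<in> M" "v i1 \<in> M" "v i2 \<in> M" "u j \<in> M"
    using geodesic_segment_in[OF I(1) g(1)] geodesic_segment_in[OF I(2) g(2)]
      geodesic_segment_in[OF I(3) g(3)] n i v(1) u(1) by auto
  have a1: "d (v i1) g \<le> \<delta> + (real e * \<delta> + J / 2)"
    using triangle[of g p "v i1"] M' n g commute[of g "v i1"] by auto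
  have a2: "d g (v i2) \<le> \<delta> + 1 + (real e * \<delta> + J / 2)"
    using triangle[of g q "v i2"] M' n g by auto
  have R: "R = 2 * (real e * \<delta>) + J + 2 * \<delta> + 1" unfolding R_def by (simp add: algebra_simps)
  have "0 \<le> real e * \<delta>" using \<delta> by simp
  then have "d (v i1) (v i2) \<le> R" "d (v i1) (u j) \<le> R"
    using triangle[of "v i1" g "v i2"] triangle[of "v i1" g "u j"] M' a1 a2 n(7) \<delta> J unfolding R
    by linarith+
  then show ?thesis using n by blast
qed

end

section \<open>From thin hexagons at every scale to hyperbolicity\<close>

text \<open>The bound \<open>B\<close> on the perimeter gives a starting point: triangles of perimeter at most \<open>B\<close> are
  trivially \<open>B\<close>-thin.\<close>

definition thin_triangles :: "'a set \<Rightarrow> ('a \<Rightarrow> 'a \<Rightarrow> real) \<Rightarrow> real \<Rightarrow> real \<Rightarrow> bool" where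
  "thin_triangles X d B h \<longleftrightarrow> (\<forall>x y z I J K p.
     geodesic_segment X d x y I \<and> geodesic_segment X d y z J \<and> geodesic_segment X d z x K \<and>
     d x y + d y z + d z x \<le> B \<and> p \<in> I \<longrightarrow> (\<exists>q\<in>J \<union> K. d p q \<le> h))"

text \<open>Sides may be degenerate, so polygons with fewer sides are included. The factor 30 leaves room for
  the hexagons of perimeter at most \<open>28.2 h\<close> that are cut out of a triangle below; \<open>9 / 10\<close> could be
  any factor smaller than 1.\<close>

definition thin_hexagons :: "'a set \<Rightarrow> ('a \<Rightarrow> 'a \<Rightarrow> real) \<Rightarrow> real \<Rightarrow> bool" where
  "thin_hexagons X d h \<longleftrightarrow> (\<forall>a0 a1 a2 a3 a4 a5 I0 I1 I2 I3 I4 I5 p.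
     geodesic_segment X d a0 a1 I0 \<and> geodesic_segment X d a1 a2 I1 \<and>
     geodesic_segment X d a2 a3 I2 \<and> geodesic_segment X d a3 a4 I3 \<and>
     geodesic_segment X d a4 a5 I4 \<and> geodesic_segment X d a5 a0 I5 \<and>
     d a0 a1 + d a1 a2 + d a2 a3 + d a3 a4 + d a4 a5 + d a5 a0 \<le> 30 * h \<and> p \<in> I0 \<longrightarrow>
     (\<exists>q\<in>I1 \<union> I2 \<union> I3 \<union> I4 \<union> I5. d p q \<le> 9 / 10 * h))"

context Metric_space
begin

lemma geodesic_subsegment:
  assumes "geodesic_segment M d x y I" "p \<in> I" "q \<in> I"
  obtains I' where "geodesic_segment M d p q I'" "I' \<subseteq> I"
proof -
  from assms(1) obtain c where c: "geodesic M d x y c" "I = c ` {0..d x y}"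
    by (auto simp: geodesic_segment_def)
  have main: "\<exists>I'. geodesic_segment M d (c s) (c t) I' \<and> I' \<subseteq> I"
    if "0 \<le> s" "s \<le> t" "t \<le> d x y" for s t
    using geodesic_part[OF c(1) that] that c(2) by (intro exI[of _ "c ` {s..t}"]) auto
  from assms(2,3) c obtain s t where st: "s \<in> {0..d x y}" "p = c s" "t \<in> {0..d x y}" "q = c t"
    by auto
  have "\<exists>I'. geodesic_segment M d p q I' \<and> I' \<subseteq> I"
  proof (cases "s \<le> t")
    case True then show ?thesis using main[of s t] st by simp
  next
    case False
    then obtain I' where "geodesic_segment M d q p I'" "I' \<subseteq> I" using main[of t s] st by auto
    then show ?thesis using geodesic_segment_sym by (intro exI[of _ I']) simp
  qed
  then show ?thesis using that by (elim exE conjE)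
qed

text \<open>A corner of the hexagon around \<open>p\<close>: the geodesic from \<open>w\<close> to the set \<open>A\<close> of points on the other two
  sides of the triangle has length at most \<open>h\<close> and starts at distance \<open>2 h\<close> from \<open>p\<close>, so it stays at
  distance at least \<open>h\<close> from \<open>p\<close>. If \<open>w\<close> is a vertex of the triangle, the corner degenerates to a
  point of \<open>A\<close>.\<close>

lemma hexagon_corner:
  assumes gX: "geodesic_metric_space M d" and w: "w \<in> M" "p \<in> M" "A \<subseteq> M"
    and far: "d p w = 2 * h \<or> w \<in> A" and near: "\<exists>q\<in>A. d w q \<le> h" and h: "0 < h"
  shows "\<exists>w' S. w' \<in> A \<and> d w w' \<le> h \<and> geodesic_segment M d w w' S \<and>
      (\<forall>q\<in>S. q \<in> A \<or> h \<le> d p q)"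
proof (cases "w \<in> A")
  case True
  have "d w w = 0" using w by simp
  with True show ?thesis using geodesic_segment_refl[OF w(1)] h
    by (intro exI[of _ w] exI[of _ "{w}"]) auto
next
  case False
  obtain w' where w': "w' \<in> A" "d w w' \<le> h" using near by blast
  then have w'M: "w' \<in> M" using w by blast
  obtain S where S: "geodesic_segment M d w w' S" using geodesic_segment_exists[OF gX w(1) w'M] by blast
  have "h \<le> d p q" if q: "q \<in> S" for q
  proof -
    have qM: "q \<in> M" using geodesic_segment_in[OF S q] .
    have "d w q + d q w' = d w w'" by (rule geodesic_segment_split[OF S q])
    then have "d w q \<le> h" using w' nonneg[of q w'] by linarith
    moreover have "d p w \<le> d p q + d q w" using triangle[of p q w] qM w by blast
    ultimately show ?thesis using False far commute[of q w] by linarith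
  qed
  with w' S show ?thesis by blast
qed

text \<open>The common vertex \<open>z\<close> of the two sides may be arbitrarily far away, so the hexagon is closed at a
  point \<open>u\<close> at distance \<open>7.1 h\<close> from \<open>x\<close>. As \<open>d x y \<le> 6 h\<close>, no point of a geodesic from \<open>x\<close> to \<open>y\<close> is
  within \<open>h\<close> of \<open>u\<close>; hence thinness of the triangle \<open>x y z\<close> provides a neighbour of \<open>u\<close> on the opposite
  side. If \<open>z\<close> is nearer than \<open>7.1 h\<close>, it closes the hexagon itself.\<close>

lemma hexagon_cap:
  assumes gX: "geodesic_metric_space M d" and h: "0 < h"
    and A1: "geodesic_segment M d x z A1" and A2: "geodesic_segment M d y z A2"
    and xy: "d x y \<le> 6 * h"
    and thin: "\<And>I p. geodesic_segment M d x y I \<Longrightarrow> p \<in> A1 \<Longrightarrow> \<exists>q\<in>I \<union> A2. d p q \<le> h"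
  shows "\<exists>u u' U1 U2 U. geodesic_segment M d x u U1 \<and> U1 \<subseteq> A1 \<and>
     geodesic_segment M d y u' U2 \<and> U2 \<subseteq> A2 \<and> geodesic_segment M d u u' U \<and>
     d x u \<le> 71 / 10 * h \<and> d y u' \<le> 141 / 10 * h \<and> d u u' \<le> h \<and>
     (\<forall>q\<in>U. q \<in> A1 \<or> 61 / 10 * h \<le> d x q)"
proof -
  have M: "x \<in> M" "y \<in> M" "z \<in> M"
    using geodesic_segment_subset[OF A1] geodesic_segment_subset[OF A2] by auto
  show ?thesis
  proof (cases "d x z \<le> 71 / 10 * h")
    case True
    have "d y z \<le> d y x + d x z" using triangle M by blast
    then have "d y z \<le> 141 / 10 * h" using True xy h commute[of x y] by linarith
    moreover have "z \<in> A1" using geodesic_segment_subset(3)[OF A1] .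
    moreover have "d z z = 0" using M by simp
    ultimately show ?thesis using True A1 A2 geodesic_segment_refl[OF M(3)] h
      by (intro exI[of _ z] exI[of _ A1] exI[of _ A2] exI[of _ "{z}"]) auto
  next
    case False
    obtain u where u: "u \<in> A1" "d x u = 71 / 10 * h"
      by (rule geodesic_segment_point_at[OF A1, of "71/10*h"]) (use h False in auto)
    have uM: "u \<in> M" using geodesic_segment_in[OF A1 u(1)] .
    obtain I where I: "geodesic_segment M d x y I"
      using geodesic_segment_exists[OF gX M(1,2)] by blast
    obtain u' where u': "u' \<in> I \<union> A2" "d u u' \<le> h" using thin[OF I u(1)] by blast
    have "u' \<notin> I"
    proof
      assume u'I: "u' \<in> I"
      have "d x u' + d u' y = d x y" by (rule geodesic_segment_split[OF I u'I])
      then have "d x u' \<le> 6 * h" using xy nonneg[of u' y] by linarith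
      moreover have "d x u \<le> d x u' + d u' u" 
        using triangle[of x u' u] M uM geodesic_segment_in[OF I u'I] by blast
      ultimately show False using u u' h commute[of u u'] by linarith
    qed
    then have u'A: "u' \<in> A2" using u' by blast
    have u'M: "u' \<in> M" using geodesic_segment_in[OF A2 u'A] .
    obtain U where U: "geodesic_segment M d u u' U" using geodesic_segment_exists[OF gX uM u'M] by blast
    obtain U1 where U1: "geodesic_segment M d x u U1" "U1 \<subseteq> A1"
      by (rule geodesic_segment_split[OF A1 u(1)])
    obtain U2 where U2: "geodesic_segment M d y u' U2" "U2 \<subseteq> A2"
      by (rule geodesic_segment_split[OF A2 u'A])
    have "d y u' \<le> d y x + (d x u + d u u')"
      using triangle[of y x u'] triangle[of x u u'] M uM u'M by linarith
    then have "d y u' \<le> 141 / 10 * h" using xy u u' commute[of x y] by linarith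
    moreover have "61 / 10 * h \<le> d x q" if q: "q \<in> U" for q
    proof -
      have "d u q + d q u' = d u u'" by (rule geodesic_segment_split[OF U q])
      then have "d u q \<le> h" using u' nonneg[of q u'] by linarith
      moreover have "d x u \<le> d x q + d q u"
        using triangle[of x q u] M uM geodesic_segment_in[OF U q] by blast
      ultimately show ?thesis using u commute[of u q] by linarith
    qed
    ultimately show ?thesis using U U1 U2 u u'
      by (intro exI[of _ u] exI[of _ u'] exI[of _ U1] exI[of _ U2] exI[of _ U]) auto
  qed
qed

text \<open>The hexagon is \<open>x' y' y'' u' u x''\<close>. The points \<open>x'\<close>, \<open>y'\<close> of \<open>I\<close> are at distance \<open>2 h\<close> from \<open>p\<close> on
  either side of it (or are ends of \<open>I\<close>), \<open>x''\<close>, \<open>y''\<close> are their neighbours on the other two sides,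
  and \<open>u\<close>, \<open>u'\<close> close the figure towards the opposite vertex. The sides \<open>y''u'\<close> and \<open>ux''\<close> lie on
  the triangle, and the sides \<open>x'x''\<close>, \<open>y'y''\<close>, \<open>uu'\<close> are too far from \<open>p\<close> to matter, so a
  point of the hexagon close to \<open>p\<close> lies on the triangle.\<close>

lemma thin_triangles_improve:
  assumes gX: "geodesic_metric_space M d" and h: "0 < h"
    and hex: "thin_hexagons M d h" and thin: "thin_triangles M d B h"
  shows "thin_triangles M d B (9 / 10 * h)"
  unfolding thin_triangles_def
proof (intro allI impI, elim conjE)
  fix x y z I J K p
  assume I: "geodesic_segment M d x y I" and J: "geodesic_segment M d y z J"
    and K: "geodesic_segment M d z x K" and B: "d x y + d y z + d z x \<le> B" and p: "p \<in> I"
  define A where "A = J \<union> K"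
  have M: "x \<in> M" "y \<in> M" "z \<in> M" "p \<in> M" "A \<subseteq> M"
    using geodesic_segment_subset[OF J] geodesic_segment_subset[OF K] geodesic_segment_in[OF I p]
    by (auto simp: A_def)
  have xyA: "x \<in> A" "y \<in> A"
    using geodesic_segment_subset[OF J] geodesic_segment_subset[OF K] by (auto simp: A_def)
  from I obtain c where c: "geodesic M d x y c" "I = c ` {0..d x y}"
    by (auto simp: geodesic_segment_def)
  define D where "D = d x y"
  from p c obtain t where t: "0 \<le> t" "t \<le> D" "p = c t" by (auto simp: D_def)
  define t1 where "t1 = max 0 (t - 2 * h)"
  define t2 where "t2 = min D (t + 2 * h)"
  have tt: "0 \<le> t1" "t1 \<le> t" "t \<le> t2" "t2 \<le> D" "t1 \<le> t2" "t2 - t1 \<le> 4 * h"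
    using t h by (auto simp: t1_def t2_def)
  have dist: "d (c a) (c b) = \<bar>a - b\<bar>" if "0 \<le> a" "a \<le> D" "0 \<le> b" "b \<le> D" for a b
    using c(1) that unfolding geodesic_def D_def by auto
  have ends: "c 0 = x" "c D = y" using c(1) by (auto simp: geodesic_def D_def)
  define x' where "x' = c t1"
  define y' where "y' = c t2"
  have I0: "geodesic_segment M d x' y' (c ` {t1..t2})"
    unfolding x'_def y'_def by (rule geodesic_part[OF c(1)]) (use tt in \<open>auto simp: D_def\<close>)
  have pI0: "p \<in> c ` {t1..t2}" using t tt by auto
  have x'y': "d x' y' \<le> 4 * h" unfolding x'_def y'_def using dist[of t1 t2] tt by auto
  have M': "x' \<in> M" "y' \<in> M" using geodesic_segment_subset[OF I0] by auto
  have near: "\<exists>q\<in>A. d w q \<le> h" if "w \<in> I" for w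
    using thin[unfolded thin_triangles_def, rule_format, of x y I z J K w] I J K B that
    by (auto simp: A_def)
  have in_I: "x' \<in> I" "y' \<in> I" using c(2) tt t by (auto simp: x'_def y'_def D_def)
  have x'far: "d p x' = 2 * h \<or> x' \<in> A"
  proof (cases "t \<le> 2 * h")
    case True then have "x' = x" using ends by (simp add: x'_def t1_def)
    then show ?thesis using xyA by simp
  next
    case False
    then have "d p x' = 2 * h" unfolding x'_def using t tt dist[of t t1] by (simp add: t1_def)
    then show ?thesis by simp
  qed
  have y'far: "d p y' = 2 * h \<or> y' \<in> A"
  proof (cases "D \<le> t + 2 * h")
    case True then have "y' = y" using ends by (simp add: y'_def t2_def)
    then show ?thesis using xyA by simp
  next
    case False
    then have "d p y' = 2 * h" unfolding y'_def using t tt dist[of t t2] h by (simp add: t2_def)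
    then show ?thesis by simp
  qed
  obtain x'' Sx where x'': "x'' \<in> A" "d x' x'' \<le> h" "geodesic_segment M d x' x'' Sx"
      "\<forall>q\<in>Sx. q \<in> A \<or> h \<le> d p q"
    using hexagon_corner[OF gX M'(1) M(4,5) x'far near[OF in_I(1)] h] by blast
  obtain y'' Sy where y'': "y'' \<in> A" "d y' y'' \<le> h" "geodesic_segment M d y' y'' Sy"
      "\<forall>q\<in>Sy. q \<in> A \<or> h \<le> d p q"
    using hexagon_corner[OF gX M'(2) M(4,5) y'far near[OF in_I(2)] h] by blast
  have M'': "x'' \<in> M" "y'' \<in> M" using x'' y'' M by auto
  have d6: "d x'' y'' \<le> 6 * h"
    using triangle[of x'' x' y''] triangle[of x' y' y''] M' M'' x'y' x''(2) y''(2) commute[of x' x'']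
    by linarith
  have px'': "d p x'' \<le> 3 * h"
  proof -
    have "d p x' \<le> 2 * h" unfolding x'_def using t tt dist[of t t1] h by (auto simp: t1_def)
    then show ?thesis using triangle[of p x' x''] M M' M'' x''(2) by linarith
  qed
  have cap: "\<exists>u u' U1 U2 U. geodesic_segment M d x'' u U1 \<and> U1 \<subseteq> A \<and>
      geodesic_segment M d y'' u' U2 \<and> U2 \<subseteq> A \<and> geodesic_segment M d u u' U \<and>
      d x'' u \<le> 71 / 10 * h \<and> d y'' u' \<le> 141 / 10 * h \<and> d u u' \<le> h \<and>
      (\<forall>q\<in>U. q \<in> A \<or> h \<le> d p q)"
  proof -
    \<comment> \<open>If both neighbours are on one side of the triangle, a quadrilateral is enough.\<close>
    have same: ?thesis if F: "geodesic_segment M d a b F" "x'' \<in> F" "y'' \<in> F" "F \<subseteq> A" for a b F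
    proof -
      obtain U1 where "geodesic_segment M d x'' y'' U1" "U1 \<subseteq> F"
        by (rule geodesic_subsegment[OF F(1-3)])
      moreover have "d y'' y'' = 0" using M'' by simp
      ultimately show ?thesis
        using geodesic_segment_refl[OF M''(2)] h d6 F(4) y''(1)
        by (intro exI[of _ y''] exI[of _ U1] exI[of _ "{y''}"]) auto
    qed
    have diff: ?thesis if F: "geodesic_segment M d a z F" "x'' \<in> F" "F \<subseteq> A"
        and G: "geodesic_segment M d b z G" "y'' \<in> G" "G \<subseteq> A"
        and per: "d a b + d b z + d a z \<le> B" and ab: "a \<in> M" "b \<in> M" for a b F G
    proof -
      obtain A1 where A1: "geodesic_segment M d x'' z A1" "A1 \<subseteq> F" "d a x'' + d x'' z = d a z"
        by (rule geodesic_segment_split[OF F(1,2)])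
      obtain A2 where A2: "geodesic_segment M d y'' z A2" "A2 \<subseteq> G" "d b y'' + d y'' z = d b z"
        by (rule geodesic_segment_split[OF G(1,2)])
      \<comment> \<open>The triangle cut off at \<open>z\<close> has no larger perimeter, so it is \<open>h\<close>-thin as well.\<close>
      have "d x'' y'' \<le> d a x'' + d a b + d b y''"
        using triangle[of x'' a y''] triangle[of a b y''] ab M'' commute[of a x''] by linarith
      then have per': "d x'' z + d z y'' + d y'' x'' \<le> B"
        using A1 A2 per commute[of y'' z] commute[of x'' y''] by linarith
      have th: "\<exists>q\<in>S \<union> A2. d w q \<le> h"
        if S: "geodesic_segment M d x'' y'' S" and w: "w \<in> A1" for S w
      proof -
        have "\<exists>q\<in>A2 \<union> S. d w q \<le> h"
          using thin[unfolded thin_triangles_def, rule_format, of x'' z A1 y'' A2 S w]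
            A1(1) geodesic_segment_sym[OF A2(1)] geodesic_segment_sym[OF S] per' w by blast
        then show ?thesis by blast
      qed
      obtain u u' U1 U2 U where U: "geodesic_segment M d x'' u U1" "U1 \<subseteq> A1"
         "geodesic_segment M d y'' u' U2" "U2 \<subseteq> A2" "geodesic_segment M d u u' U"
         "d x'' u \<le> 71 / 10 * h" "d y'' u' \<le> 141 / 10 * h" "d u u' \<le> h"
         "\<forall>q\<in>U. q \<in> A1 \<or> 61 / 10 * h \<le> d x'' q"
        using hexagon_cap[OF gX h A1(1) A2(1) d6 th] by blast
      have "q \<in> A \<or> h \<le> d p q" if q: "q \<in> U" for q
      proof (cases "q \<in> A1")
        case True then show ?thesis using A1 F by blast
      next
        case False
        then have "61 / 10 * h \<le> d x'' q" using U(9) q by blast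
        moreover have "d x'' q \<le> d x'' p + d p q"
          using triangle[of x'' p q] M M'' geodesic_segment_in[OF U(5) q] by blast
        ultimately show ?thesis using px'' h commute[of p x''] by linarith
      qed
      then show ?thesis using U A1(2) A2(2) F(3) G(3)
        by (intro exI[of _ u] exI[of _ u'] exI[of _ U1] exI[of _ U2] exI[of _ U]) blast
    qed
    note Kr = geodesic_segment_sym[OF K]
    have sub: "J \<subseteq> A" "K \<subseteq> A" by (auto simp: A_def)
    have per1: "d y x + d x z + d y z \<le> B" and per2: "d x y + d y z + d x z \<le> B"
      using B commute[of x y] commute[of x z] by linarith+
    consider "x'' \<in> J" "y'' \<in> J" | "x'' \<in> K" "y'' \<in> K" | "x'' \<in> J" "y'' \<in> K" | "x'' \<in> K" "y'' \<in> J"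
      using x''(1) y''(1) by (auto simp: A_def)
    then show ?thesis
    proof cases
      case 1 then show ?thesis using same[OF J] sub by blast
    next
      case 2 then show ?thesis using same[OF K] sub by blast
    next
      case 3 then show ?thesis using diff[OF J _ _ Kr _ _ per1] sub M by blast
    next
      case 4 then show ?thesis using diff[OF Kr _ _ J _ _ per2] sub M by blast
    qed
  qed
  then obtain u u' U1 U2 U where U: "geodesic_segment M d x'' u U1" "U1 \<subseteq> A"
      "geodesic_segment M d y'' u' U2" "U2 \<subseteq> A" "geodesic_segment M d u u' U"
      "d x'' u \<le> 71 / 10 * h" "d y'' u' \<le> 141 / 10 * h" "d u u' \<le> h"
      "\<forall>q\<in>U. q \<in> A \<or> h \<le> d p q" by blast
  have "d x' y' + d y' y'' + d y'' u' + d u' u + d u x'' + d x'' x' \<le> 30 * h"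
    using x'y' x''(2) y''(2) U(6-8) h commute[of u' u] commute[of u x''] commute[of x'' x']
    by linarith
  then have "\<exists>q\<in>Sy \<union> U2 \<union> U \<union> U1 \<union> Sx. d p q \<le> 9 / 10 * h"
    using hex[unfolded thin_hexagons_def, rule_format,
        of x' y' "c ` {t1..t2}" y'' Sy u' U2 u U x'' U1 Sx p]
      I0 y''(3) U(3) geodesic_segment_sym[OF U(5)] geodesic_segment_sym[OF U(1)]
      geodesic_segment_sym[OF x''(3)] pI0 by blast
  then obtain q where q: "q \<in> Sy \<union> U2 \<union> U \<union> U1 \<union> Sx" "d p q \<le> 9 / 10 * h" by blast
  have "q \<in> A \<or> h \<le> d p q" using q(1) x''(4) y''(4) U(2,4,9) by blast
  then have "q \<in> A" using q(2) h by auto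
  then show "\<exists>q\<in>J \<union> K. d p q \<le> 9 / 10 * h" using q(2) unfolding A_def by blast
qed

text \<open>Each application of \<open>thin_triangles_improve\<close> multiplies the thinness by \<open>9 / 10\<close>, as long as it
  is at least \<open>T\<close>; finitely many applications lead from the trivial bound by the perimeter to \<open>T\<close>.\<close>

theorem hyperbolic_if_thin_hexagons:
  assumes gX: "geodesic_metric_space M d" and T: "0 < T"
    and hex: "\<And>h. T \<le> h \<Longrightarrow> thin_hexagons M d h"
  shows "hyperbolic_with T M d"
proof -
  have thin: "thin_triangles M d B (max T ((9 / 10) ^ k * B))" for B k
  proof (induction k)
    case 0
    show ?case unfolding thin_triangles_def
    proof (intro allI impI, elim conjE)
      fix x y z I J K p
      assume I: "geodesic_segment M d x y I" and K: "geodesic_segment M d z x K"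
        and B: "d x y + d y z + d z x \<le> B" and p: "p \<in> I"
      have "d x p + d p y = d x y" by (rule geodesic_segment_split[OF I p])
      then have "d p x \<le> B"
        using B nonneg[of p y] nonneg[of y z] nonneg[of z x] commute[of p x] by linarith
      moreover have "x \<in> K" by (rule geodesic_segment_subset(3)[OF K])
      ultimately show "\<exists>q\<in>J \<union> K. d p q \<le> max T ((9 / 10) ^ 0 * B)"
        by (intro bexI[of _ x]) auto
    qed
  next
    case (Suc k)
    let ?h = "max T ((9 / 10) ^ k * B)"
    have "thin_triangles M d B (9 / 10 * ?h)"
      by (rule thin_triangles_improve[OF gX _ hex Suc]) (use T in auto)
    moreover have "9 / 10 * ?h \<le> max T ((9 / 10) ^ Suc k * B)" using T by (auto simp: max_def)
    ultimately show ?case unfolding thin_triangles_def by (meson order_trans)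
  qed
  have thinT: "thin_triangles M d B T" for B
  proof -
    have "(\<lambda>k. (9 / 10) ^ k * B) \<longlonglongrightarrow> 0 * B" by (intro tendsto_intros LIMSEQ_power_zero) auto
    then have "eventually (\<lambda>k. (9 / 10) ^ k * B < T) sequentially"
      using T by (auto dest: order_tendstoD(2))
    then obtain k where "(9 / 10) ^ k * B < T" by (auto simp: eventually_sequentially)
    then show ?thesis using thin[of B k] by (simp add: max_def split: if_splits)
  qed
  have side: "I \<subseteq> neighbourhood M d T (J \<union> K)"
    if I: "geodesic_segment M d x y I" and J: "geodesic_segment M d y z J"
      and K: "geodesic_segment M d z x K" for x y z I J K
  proof
    fix p assume p: "p \<in> I"
    have "\<exists>q\<in>J \<union> K. d p q \<le> T"
      using thinT[of "d x y + d y z + d z x", unfolded thin_triangles_def, rule_format, of x y I z J K p]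
        I J K p by simp
    then show "p \<in> neighbourhood M d T (J \<union> K)"
      using geodesic_segment_in[OF I p] by (simp add: neighbourhood_def)
  qed
  show ?thesis unfolding hyperbolic_with_def
  proof (intro conjI ballI allI impI gX)
    fix x y z I J K
    assume "geodesic_segment M d x y I \<and> geodesic_segment M d y z J \<and> geodesic_segment M d z x K"
    then show "I \<subseteq> neighbourhood M d T (J \<union> K)" "J \<subseteq> neighbourhood M d T (K \<union> I)"
      "K \<subseteq> neighbourhood M d T (I \<union> J)"
      using side[of x y I z J K] side[of y z J x K I] side[of z x K y I J] by auto
  qed (use T in simp)
qed

end

section \<open>The realization of a graph is a geodesic space\<close>

lemma edge_point_swap: "edge_point v u t = edge_point u v (1 - t)"
  by (auto simp: edge_point_def)

abbreviation vertex :: "'v \<Rightarrow> 'v \<Rightarrow> real" where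
  "vertex v \<equiv> edge_point v v 0"

lemma edge_point_0: "edge_point u v 0 = vertex u" and edge_point_1: "edge_point u v 1 = vertex v"
  by (auto simp: edge_point_def)

lemma edge_point_eq_cases:
  assumes "edge_point u v s = edge_point b w y" "u \<noteq> v" "b \<noteq> w"
  shows "b = u \<and> w = v \<and> y = s \<or> b = v \<and> w = u \<and> y = 1 - s \<or>
    y = 0 \<and> (s = 0 \<and> b = u \<or> s = 1 \<and> b = v) \<or> y = 1 \<and> (s = 0 \<and> w = u \<or> s = 1 \<and> w = v)"
  using fun_cong[OF assms(1), of u] fun_cong[OF assms(1), of v]
    fun_cong[OF assms(1), of b] fun_cong[OF assms(1), of w] assms(2,3)
  by (auto simp: edge_point_def split: if_splits)

lemma edge_point_eq_vertex:
  assumes "edge_point u v s = vertex b" "u \<noteq> v"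
  shows "s = 0 \<and> b = u \<or> s = 1 \<and> b = v"
  using fun_cong[OF assms(1), of u] fun_cong[OF assms(1), of v]
    fun_cong[OF assms(1), of b] assms(2)
  by (auto simp: edge_point_def split: if_splits)

lemma pl_path_nonneg: "pl_path V E p l q \<Longrightarrow> 0 \<le> l"
  by (induction rule: pl_path.induct) auto

lemma edge_point_in_realization:
  "u \<in> V \<Longrightarrow> v \<in> V \<Longrightarrow> E u v \<Longrightarrow> 0 \<le> t \<Longrightarrow> t \<le> 1 \<Longrightarrow> edge_point u v t \<in> graph_realization V E"
  unfolding graph_realization_def by blast

lemma vertex_in_realization: "v \<in> V \<Longrightarrow> vertex v \<in> graph_realization V E"
  unfolding graph_realization_def by blast

lemma pl_path_ends:
  "pl_path V E p l q \<Longrightarrow> p \<in> graph_realization V E \<and> q \<in> graph_realization V E"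
  by (induction rule: pl_path.induct) (auto simp: edge_point_in_realization)

lemma pl_path_edge:
  assumes "u \<in> V" "v \<in> V" "E u v" "0 \<le> s" "s \<le> 1" "0 \<le> t" "t \<le> 1"
  shows "pl_path V E (edge_point u v s) \<bar>s - t\<bar> (edge_point u v t)"
  using pl_path.step[of V E "edge_point u v s" 0 u v s t] assms
  by (simp add: pl_path.const edge_point_in_realization)

lemma pl_path_trans:
  assumes "pl_path V E q l' z" "pl_path V E p l q"
  shows "pl_path V E p (l + l') z"
  using assms
proof (induction rule: pl_path.induct)
  case (step q l' u v s t)
  from pl_path.step[OF step.IH[OF step.prems] step.hyps(2-8)]
  show ?case by (simp add: algebra_simps)
qed simp

lemma pl_path_sym: "pl_path V E p l q \<Longrightarrow> pl_path V E q l p"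
proof (induction rule: pl_path.induct)
  case (step p l u v s t)
  have "pl_path V E (edge_point u v t) \<bar>t - s\<bar> (edge_point u v s)"
    using step.hyps by (intro pl_path_edge) auto
  from pl_path_trans[OF step.IH this] show ?case by (simp add: abs_minus_commute algebra_simps)
qed (rule pl_path.const)

text \<open>Barycentric coordinates change with speed at most 1, which is why the path metric separates points.\<close>

lemma pl_path_coordinate: "pl_path V E p l q \<Longrightarrow> (\<And>u. \<not> E u u) \<Longrightarrow> \<bar>p w - q w\<bar> \<le> l"
proof (induction rule: pl_path.induct)
  case (step p l u v s t)
  then have "\<bar>edge_point u v s w - edge_point u v t w\<bar> \<le> \<bar>s - t\<bar>"
    by (auto simp: edge_point_def)
  then show ?case using step.IH[OF step.prems] by linarith
qed simp

text \<open>The parametrization by length; a path whose length is the distance of its ends becomes a geodesic.\<close>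

lemma pl_path_curve:
  assumes "pl_path V E p l q"
  shows "\<exists>c. c 0 = p \<and> c l = q \<and> (\<forall>s t. 0 \<le> s \<and> s \<le> t \<and> t \<le> l \<longrightarrow> pl_path V E (c s) (t - s) (c t))"
  using assms
proof (induction rule: pl_path.induct)
  case (const p)
  have "pl_path V E p (t - s) p" if "0 \<le> s" "s \<le> t" "t \<le> 0" for s t :: real
  proof -
    have "t - s = 0" using that by simp
    then show ?thesis using pl_path.const[OF const] by simp
  qed
  then show ?case by (intro exI[of _ "\<lambda>_. p"]) simp
next
  case (step p l u v s t)
  then obtain c where c: "c 0 = p" "c l = edge_point u v s"
    "\<And>a b. 0 \<le> a \<Longrightarrow> a \<le> b \<Longrightarrow> b \<le> l \<Longrightarrow> pl_path V E (c a) (b - a) (c b)" by blast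
  define e where "e x = edge_point u v (s + sgn (t - s) * (x - l))" for x
  have l: "0 \<le> l" using pl_path_nonneg[OF step.hyps(1)] .
  have e: "pl_path V E (e a) (b - a) (e b)" if "l \<le> a" "a \<le> b" "b \<le> l + \<bar>s - t\<bar>" for a b
  proof -
    let ?f = "\<lambda>x. s + sgn (t - s) * (x - l)"
    have "0 \<le> ?f x \<and> ?f x \<le> 1" if "l \<le> x" "x \<le> l + \<bar>s - t\<bar>" for x
      using that step.hyps by (auto simp: sgn_if split: if_splits)
    moreover have "\<bar>?f a - ?f b\<bar> = b - a" using that by (auto simp: sgn_if split: if_splits)
    ultimately show ?thesis
      using pl_path_edge[of u V v E "?f a" "?f b"] step.hyps that by (simp add: e_def)
  qed
  have el: "e l = c l" by (simp add: e_def c)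
  define c' where "c' x = (if x \<le> l then c x else e x)" for x
  have "c' 0 = p" using c l by (simp add: c'_def)
  moreover have "c' (l + \<bar>s - t\<bar>) = edge_point u v t"
    using c by (auto simp: c'_def e_def sgn_if)
  moreover have "pl_path V E (c' a) (b - a) (c' b)" if ab: "0 \<le> a" "a \<le> b" "b \<le> l + \<bar>s - t\<bar>" for a b
  proof -
    consider "b \<le> l" | "a \<le> l" "l < b" | "l < a" by linarith
    then show ?thesis
    proof cases
      case 1 then show ?thesis using c(3) ab by (simp add: c'_def)
    next
      case 2
      have "pl_path V E (c a) (l - a + (b - l)) (e b)"
        by (rule pl_path_trans[of _ _ "c l"]) (use e[of l b] c(3)[of a l] 2 ab el in auto)
      then show ?thesis using 2 by (simp add: c'_def)
    next
      case 3 then show ?thesis using e ab by (simp add: c'_def)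
    qed
  qed
  ultimately show ?case by blast
qed

text \<open>\<open>D\<close> is the combinatorial distance. The paths in \<open>D_path\<close> may pause at a vertex, as happens for words
  containing the neutral element.\<close>

locale connected_graph =
  fixes V :: "'v set" and E :: "'v \<Rightarrow> 'v \<Rightarrow> bool" and D :: "'v \<Rightarrow> 'v \<Rightarrow> nat"
  assumes E_sym: "u \<in> V \<Longrightarrow> v \<in> V \<Longrightarrow> E u v \<Longrightarrow> E v u" and E_irrefl: "\<not> E u u"
    and D_refl: "u \<in> V \<Longrightarrow> D u u = 0"
    and D_triangle: "u \<in> V \<Longrightarrow> v \<in> V \<Longrightarrow> w \<in> V \<Longrightarrow> D u w \<le> D u v + D v w"
    and D_edge: "u \<in> V \<Longrightarrow> v \<in> V \<Longrightarrow> E u v \<Longrightarrow> D u v \<le> 1"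
    and D_path: "u \<in> V \<Longrightarrow> v \<in> V \<Longrightarrow> \<exists>f. f 0 = u \<and> f (D u v) = v \<and>
          (\<forall>i<D u v. f i \<in> V \<and> f (Suc i) \<in> V \<and> (f i = f (Suc i) \<or> E (f i) (f (Suc i))))"
begin

abbreviation R where "R \<equiv> graph_realization V E"
abbreviation dist where "dist \<equiv> path_metric V E"

text \<open>\<open>hop p a x\<close>: the point \<open>p\<close> lies on an edge at \<open>a\<close>, and \<open>x\<close> is the length of the part of this edge
  between \<open>p\<close> and \<open>a\<close>.\<close>

definition hop :: "('v \<Rightarrow> real) \<Rightarrow> 'v \<Rightarrow> real \<Rightarrow> bool" where
  "hop p a x \<longleftrightarrow> a \<in> V \<and>
     (p = vertex a \<and> x = 0 \<or> (\<exists>v\<in>V. E a v \<and> 0 \<le> x \<and> x \<le> 1 \<and> p = edge_point a v x))"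

lemma hop_start: "u \<in> V \<Longrightarrow> v \<in> V \<Longrightarrow> E u v \<Longrightarrow> 0 \<le> t \<Longrightarrow> t \<le> 1 \<Longrightarrow> hop (edge_point u v t) u t"
  by (auto simp: hop_def)

lemma hop_end:
  assumes "u \<in> V" "v \<in> V" "E u v" "0 \<le> t" "t \<le> 1" shows "hop (edge_point u v t) v (1 - t)"
  using hop_start[of v u "1 - t"] E_sym[OF assms(1-3)] assms edge_point_swap[of u v t] by simp

lemma hop_path: "hop p a x \<Longrightarrow> pl_path V E p x (vertex a)"
  unfolding hop_def
proof (elim conjE disjE bexE)
  fix v assume "a \<in> V" "v \<in> V" "E a v" "0 \<le> x" "x \<le> 1" "p = edge_point a v x"
  then show ?thesis using pl_path_edge[of a V v E x 0] by (simp add: edge_point_0[of a v])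
qed (auto intro!: pl_path.const vertex_in_realization)

lemma hop_coordinate: "hop p a x \<Longrightarrow> x = 1 - p a"
  using E_irrefl by (auto simp: hop_def edge_point_def)

text \<open>When a point moves inside an edge, a vertex from which it is reached can be replaced by an
  end of that edge at no extra length; this is the inductive step of \<open>pl_path_reduce\<close>.\<close>

lemma hop_move:
  assumes e: "u \<in> V" "v \<in> V" "E u v" "0 \<le> s" "s \<le> 1" "0 \<le> t" "t \<le> 1"
    and hop: "hop (edge_point u v s) b y"
  shows "\<exists>b' y'. hop (edge_point u v t) b' y' \<and> real (D b b') + y' \<le> y + \<bar>s - t\<bar>"
proof -
  have uv: "u \<noteq> v" using e E_irrefl by metis
  have y0: "0 \<le> y" and b: "b \<in> V" using hop by (auto simp: hop_def)
  have to_u: ?thesis if "real (D b u) + t \<le> y + \<bar>s - t\<bar>"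
    using that hop_start[OF e(1-3,6,7)] by blast
  have to_v: ?thesis if "real (D b v) + (1 - t) \<le> y + \<bar>s - t\<bar>"
    using that hop_end[OF e(1-3,6,7)] by blast
  have near: "real (D b w) \<le> 1" if "E b w" "w \<in> V" for w using D_edge[of b w] that b by simp
  from hop consider "edge_point u v s = vertex b" "y = 0"
    | w where "w \<in> V" "E b w" "y \<le> 1" "edge_point u v s = edge_point b w y"
    unfolding hop_def by blast
  then show ?thesis
  proof cases
    case 1
    then show ?thesis using edge_point_eq_vertex[OF 1(1) uv] to_u to_v D_refl e by auto
  next
    case 2
    have "b \<noteq> w" using 2 E_irrefl by metis
    then consider "b = u" "y = s" | "b = v" "y = 1 - s" | "y = 0" "s = 0" "b = u"
      | "y = 0" "s = 1" "b = v" | "y = 1" "s = 0" "w = u" | "y = 1" "s = 1" "w = v"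
      using edge_point_eq_cases[OF 2(4) uv] by blast
    then show ?thesis
      by cases (use to_u to_v D_refl[of u] D_refl[of v] near[OF 2(2,1)] e in auto)
  qed
qed

text \<open>Backtracking and detours can be removed from a path without making it longer: it then stays within one
  edge, or it goes to a vertex, along edges to another vertex, and on to its end point.\<close>

lemma pl_path_reduce:
  assumes "pl_path V E p l q"
  shows "(\<exists>u v s t. u \<in> V \<and> v \<in> V \<and> E u v \<and> 0 \<le> s \<and> s \<le> 1 \<and> 0 \<le> t \<and> t \<le> 1 \<and>
      p = edge_point u v s \<and> q = edge_point u v t \<and> \<bar>s - t\<bar> \<le> l) \<or>
    (\<exists>a b x y. hop p a x \<and> hop q b y \<and> x + real (D a b) + y \<le> l)"
  (is "?edge p q l \<or> ?hops p q l")
  using assms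
proof (induction rule: pl_path.induct)
  case (const p)
  then consider v where "v \<in> V" "p = vertex v"
    | u v t where "u \<in> V" "v \<in> V" "E u v" "0 \<le> t" "t \<le> 1" "p = edge_point u v t"
    unfolding graph_realization_def by blast
  then show ?case
  proof cases
    case 1
    then have "hop p v 0" by (simp add: hop_def)
    then have "?hops p p 0" using D_refl[OF 1(1)]
      by (intro exI[of _ v] exI[of _ "0::real"]) simp
    then show ?thesis ..
  next
    case 2
    then have "?edge p p 0" by (intro exI[of _ u] exI[of _ v] exI[of _ t]) simp
    then show ?thesis ..
  qed
next
  case (step p l u v s t)
  note e = step.hyps(2-8)
  let ?r = "edge_point u v s" and ?q = "edge_point u v t"
  have from_hops: "?hops p ?q (l' + \<bar>s - t\<bar>)" if "?hops p ?r l'" for l'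
  proof -
    from that obtain a b x y where h: "hop p a x" "hop ?r b y" "x + real (D a b) + y \<le> l'" by blast
    obtain b' y' where b': "hop ?q b' y'" "real (D b b') + y' \<le> y + \<bar>s - t\<bar>"
      using hop_move[OF e h(2)] by blast
    have "D a b' \<le> D a b + D b b'"
      using D_triangle[of a b b'] h(1,2) b'(1) by (auto simp: hop_def)
    then have "real (D a b') \<le> real (D a b) + real (D b b')" by (metis of_nat_add of_nat_le_iff)
    then have "x + real (D a b') + y' \<le> l' + \<bar>s - t\<bar>" using h(3) b'(2) by linarith
    then show ?thesis using h(1) b'(1) by blast
  qed
  from step.IH show ?case
  proof
    assume "?hops p ?r l" then show ?thesis using from_hops by blast
  next
    assume "?edge p ?r l"
    then obtain u1 v1 s1 t1 where k: "u1 \<in> V" "v1 \<in> V" "E u1 v1" "0 \<le> s1" "s1 \<le> 1" "0 \<le> t1" "t1 \<le> 1"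
      "p = edge_point u1 v1 s1" "?r = edge_point u1 v1 t1" "\<bar>s1 - t1\<bar> \<le> l"
      by (elim exE conjE) (rule that)
    have ne: "u \<noteq> v" "u1 \<noteq> v1" using e(3) k(3) E_irrefl by metis+
    consider "t1 = 0" | "t1 = 1" | "u = u1" "v = v1" "s = t1" | "u = v1" "v = u1" "s = 1 - t1"
      using edge_point_eq_cases[OF k(9)[symmetric] ne(2,1)] by blast
    then show ?thesis
    proof cases
      case 1
      then have "?hops p ?r l" using hop_start[OF k(1-5)] k(1,8,9,10) D_refl[OF k(1)]
        by (intro exI[of _ u1] exI[of _ s1] exI[of _ "0::real"])
          (auto simp: hop_def edge_point_0[of u1 v1] k(9))
      then show ?thesis using from_hops by blast
    next
      case 2
      then have "?hops p ?r l" using hop_end[OF k(1-5)] k(2,8,9,10) k(5) D_refl[OF k(2)]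
        by (intro exI[of _ v1] exI[of _ "1 - s1"] exI[of _ "0::real"])
          (auto simp: hop_def edge_point_1 k(9))
      then show ?thesis using from_hops by blast
    next
      case 3
      then have "\<bar>s1 - t\<bar> \<le> l + \<bar>s - t\<bar>" using k(10) by linarith
      then have "?edge p ?q (l + \<bar>s - t\<bar>)" using 3 k(1-8) e
        by (intro exI[of _ u1] exI[of _ v1] exI[of _ s1] exI[of _ t]) simp
      then show ?thesis ..
    next
      case 4
      then have "\<bar>s1 - (1 - t)\<bar> \<le> l + \<bar>s - t\<bar>" using k(10) by linarith
      then have "?edge p ?q (l + \<bar>s - t\<bar>)" using 4 k(1-8) e
        by (intro exI[of _ u1] exI[of _ v1] exI[of _ s1] exI[of _ "1 - t"])
          (simp add: edge_point_swap[of v1 u1])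
      then show ?thesis ..
    qed
  qed
qed

lemma hop_exists: "p \<in> R \<Longrightarrow> \<exists>a x. hop p a x \<and> x \<le> 1 / 2"
proof -
  assume "p \<in> R"
  then consider v where "v \<in> V" "p = vertex v"
    | u v t where "u \<in> V" "v \<in> V" "E u v" "0 \<le> t" "t \<le> 1" "p = edge_point u v t"
    unfolding graph_realization_def by blast
  then show ?thesis
  proof cases
    case 1 then show ?thesis by (intro exI[of _ v] exI[of _ "0::real"]) (simp add: hop_def)
  next
    case 2
    show ?thesis
    proof (cases "t \<le> 1 / 2")
      case True then show ?thesis using hop_start 2 by blast
    next
      case False
      then have "1 - t \<le> 1 / 2" by simp
      then show ?thesis using hop_end[OF 2(1-5)] 2(6) by blast
    qed
  qed
qed

lemma vertex_path:
  assumes "u \<in> V" "v \<in> V"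
  shows "\<exists>n\<le>D u v. pl_path V E (vertex u) (real n) (vertex v)"
proof -
  obtain f where f: "f 0 = u" "f (D u v) = v"
    "\<And>i. i < D u v \<Longrightarrow> f i \<in> V \<and> f (Suc i) \<in> V \<and> (f i = f (Suc i) \<or> E (f i) (f (Suc i)))"
    using D_path[OF assms] by blast
  have "\<exists>n\<le>k. pl_path V E (vertex u) (real n) (vertex (f k))" if "k \<le> D u v" for k
    using that
  proof (induction k)
    case 0
    then show ?case using f(1) assms by (auto intro!: pl_path.const vertex_in_realization)
  next
    case (Suc k)
    then obtain n where n: "n \<le> k" "pl_path V E (vertex u) (real n) (vertex (f k))" by auto
    have k: "f k \<in> V" "f (Suc k) \<in> V" "f k = f (Suc k) \<or> E (f k) (f (Suc k))"
      using f(3)[of k] Suc.prems by auto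
    show ?case
    proof (cases "f k = f (Suc k)")
      case True then show ?thesis using n by (intro exI[of _ n]) simp
    next
      case False
      then have "pl_path V E (vertex (f k)) \<bar>0 - 1\<bar> (vertex (f (Suc k)))"
        using pl_path_edge[of "f k" V "f (Suc k)" E 0 1] k
        by (simp add: edge_point_0[of "f k" "f (Suc k)"] edge_point_1)
      from pl_path_trans[OF this n(2)] show ?thesis
        using n(1) by (intro exI[of _ "Suc n"]) (simp add: algebra_simps)
    qed
  qed
  from this[of "D u v"] f(2) show ?thesis by simp
qed

lemma pl_path_exists:
  assumes "p \<in> R" "q \<in> R" shows "\<exists>l. pl_path V E p l q"
proof -
  obtain a x b y where h: "hop p a x" "hop q b y" using hop_exists assms by metis
  obtain n where n: "pl_path V E (vertex a) (real n) (vertex b)"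
    using vertex_path[of a b] h by (auto simp: hop_def)
  show ?thesis using pl_path_trans[OF pl_path_sym[OF hop_path[OF h(2)]] pl_path_trans[OF n hop_path[OF h(1)]]]
    by blast
qed

lemma finite_range_realization:
  assumes "p \<in> R" shows "finite (range p)"
proof -
  have fin: "finite (range (edge_point u v t))" for u v :: 'v and t
    by (rule finite_subset[of _ "{0, 1, t, 1 - t}"]) (auto simp: edge_point_def)
  show ?thesis using assms unfolding graph_realization_def by (auto simp: fin)
qed

text \<open>The lengths of reduced paths are a natural number plus two terms determined by the finitely many
  coordinates of the end points, or a difference of two coordinates. Below a given bound there are
  only finitely many such lengths, so the infimum is a minimum.\<close>

lemma path_metric_attained:
  assumes R: "p \<in> R" "q \<in> R" shows "pl_path V E p (dist p q) q"
proof -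
  define P where "P = {l. pl_path V E p l q}"
  obtain l0 where l0: "l0 \<in> P" using pl_path_exists[OF R] by (auto simp: P_def)
  define C1 where "C1 = (\<lambda>(\<alpha>, \<beta>). \<bar>\<alpha> - \<beta>\<bar>) ` (range p \<times> range q)"
  define C2 where "C2 = (\<lambda>(\<alpha>, \<beta>, n). (1 - \<alpha>) + real n + (1 - \<beta>)) ` (range p \<times> range q \<times> {..nat \<lceil>l0\<rceil>})"
  have fin: "finite (C1 \<union> C2)"
    using finite_range_realization R by (auto simp: C1_def C2_def)
  have red: "\<exists>l'\<in>P \<inter> (C1 \<union> C2). l' \<le> l" if l: "l \<in> P" "l \<le> l0" for l
  proof -
    from pl_path_reduce[of p l q] l consider
      u v s t where "u \<in> V" "v \<in> V" "E u v" "0 \<le> s" "s \<le> 1" "0 \<le> t" "t \<le> 1"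
      "p = edge_point u v s" "q = edge_point u v t" "\<bar>s - t\<bar> \<le> l"
      | a b x y where "hop p a x" "hop q b y" "x + real (D a b) + y \<le> l"
      unfolding P_def by blast
    then show ?thesis
    proof cases
      case 1
      then have "u \<noteq> v" using E_irrefl by metis
      then have "\<bar>s - t\<bar> = \<bar>p u - q u\<bar>" using 1 by (simp add: edge_point_def)
      then have "\<bar>s - t\<bar> \<in> C1" unfolding C1_def by (intro image_eqI[of _ _ "(p u, q u)"]) auto
      moreover have "\<bar>s - t\<bar> \<in> P" unfolding P_def using pl_path_edge[of u V v E s t] 1 by simp
      ultimately show ?thesis using 1(10) by blast
    next
      case 2
      obtain n where n: "n \<le> D a b" "pl_path V E (vertex a) (real n) (vertex b)"
        using vertex_path[of a b] 2 by (auto simp: hop_def)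
      let ?l = "x + real n + y"
      have "?l \<in> P" unfolding P_def
        using pl_path_trans[OF pl_path_sym[OF hop_path[OF 2(2)]] pl_path_trans[OF n(2) hop_path[OF 2(1)]]]
        by simp
      moreover have le: "?l \<le> l" using n(1) 2(3) of_nat_le_iff[of n "D a b", where 'a=real] by linarith
      moreover have "?l \<in> C2"
      proof -
        have "0 \<le> x" "0 \<le> y" using 2 by (auto simp: hop_def)
        then have "real n \<le> l0" using le l by linarith
        then have "n \<le> nat \<lceil>l0\<rceil>" by linarith
        moreover have "x = 1 - p a" "y = 1 - q b" using hop_coordinate 2 by blast+
        ultimately show ?thesis unfolding C2_def by (intro image_eqI[of _ _ "(p a, q b, n)"]) auto
      qed
      ultimately show ?thesis by blast
    qed
  qed
  let ?F = "P \<inter> (C1 \<union> C2)"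
  have F: "finite ?F" "?F \<noteq> {}" using fin red[OF l0] by auto
  have inP: "Min ?F \<in> P" using Min_in[OF F] by blast
  have lb: "Min ?F \<le> l" if l: "l \<in> P" for l
  proof -
    have "min l l0 \<in> P" using l l0 by (simp add: min_def)
    then obtain l' where "l' \<in> ?F" "l' \<le> min l l0" using red by fastforce
    then show ?thesis using Min_le[OF F(1), of l'] by linarith
  qed
  have "Inf P = Min ?F" using cInf_eq_minimum[OF inP lb] .
  then show ?thesis using inP l0 unfolding path_metric_def P_def by auto
qed

lemma path_metric_le: "pl_path V E p l q \<Longrightarrow> dist p q \<le> l"
  unfolding path_metric_def
  by (auto intro!: cInf_lower bdd_belowI[of _ 0] simp: pl_path_nonneg)

lemma path_metric_sym: "dist p q = dist q p"
proof -
  have "{l. pl_path V E p l q} = {l. pl_path V E q l p}" using pl_path_sym by blast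
  then show ?thesis unfolding path_metric_def using pl_path_sym by metis
qed

lemma path_metric_nonneg: "0 \<le> dist p q"
  unfolding path_metric_def by (auto intro!: cInf_greatest simp: pl_path_nonneg)

lemma Metric_space_realization: "Metric_space R dist"
proof
  show "0 \<le> dist p q" for p q by (rule path_metric_nonneg)
  show "dist p q = dist q p" for p q by (rule path_metric_sym)
  show "(dist p q = 0) = (p = q)" if R: "p \<in> R" "q \<in> R" for p q
  proof
    assume "dist p q = 0"
    then have "\<bar>p w - q w\<bar> \<le> 0" for w
      using pl_path_coordinate[OF path_metric_attained[OF R] E_irrefl, of w] by simp
    then show "p = q" by auto
  next
    assume "p = q"
    then show "dist p q = 0"
      using path_metric_le[OF pl_path.const[OF R(1)]] path_metric_nonneg[of p q] by simp
  qed
  show "dist p z \<le> dist p q + dist q z" if "p \<in> R" "q \<in> R" "z \<in> R" for p q z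
    using that by (intro path_metric_le pl_path_trans[OF path_metric_attained path_metric_attained])
qed

lemma geodesic_metric_space_realization: "geodesic_metric_space R dist"
  unfolding geodesic_metric_space_def
proof (intro conjI ballI Metric_space_realization)
  fix p q assume R: "p \<in> R" "q \<in> R"
  interpret Metric_space R dist by (rule Metric_space_realization)
  let ?l = "dist p q"
  obtain c where c: "c 0 = p" "c ?l = q"
    "\<And>s t. 0 \<le> s \<Longrightarrow> s \<le> t \<Longrightarrow> t \<le> ?l \<Longrightarrow> pl_path V E (c s) (t - s) (c t)"
    using pl_path_curve[OF path_metric_attained[OF R]] by blast
  have inR: "c s \<in> R" if "0 \<le> s" "s \<le> ?l" for s using pl_path_ends[OF c(3)[of s s]] that by blast
  have le: "dist (c s) (c t) \<le> t - s" if "0 \<le> s" "s \<le> t" "t \<le> ?l" for s t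
    using path_metric_le[OF c(3)] that by blast
  have eq: "dist (c s) (c t) = t - s" if st: "0 \<le> s" "s \<le> t" "t \<le> ?l" for s t
  proof -
    have "?l \<le> dist p (c s) + (dist (c s) (c t) + dist (c t) q)"
      using triangle[of p "c s" q] triangle[of "c s" "c t" q] inR[of s] inR[of t] st R by linarith
    moreover have "dist p (c s) \<le> s - 0" "dist (c t) q \<le> ?l - t"
      using le[of 0 s] le[of t ?l] st c by auto
    ultimately show ?thesis using le[OF st] by linarith
  qed
  have "dist (c s) (c t) = \<bar>s - t\<bar>" if "s \<in> {0..?l}" "t \<in> {0..?l}" for s t
    using eq[of s t] eq[of t s] that path_metric_sym[of "c s" "c t"] by (cases "s \<le> t") auto
  then show "\<exists>c. geodesic R dist p q c"
    using c inR by (intro exI[of _ c]) (auto simp: geodesic_def)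
qed

lemma path_metric_vertex:
  assumes "u \<in> V" "v \<in> V" shows "dist (vertex u) (vertex v) = real (D u v)"
proof (rule antisym)
  obtain n where "n \<le> D u v" "pl_path V E (vertex u) (real n) (vertex v)"
    using vertex_path[OF assms] by blast
  then show "dist (vertex u) (vertex v) \<le> real (D u v)" using path_metric_le by force
next
  \<comment> \<open>A vertex lies on its incident edges too, at distance 1 from their other ends.\<close>
  have near: "real (D a b) \<le> x" "real (D b a) \<le> x" if h: "hop (vertex b) a x" and b: "b \<in> V" for a b x
  proof -
    have a: "a \<in> V" "0 \<le> x" using h by (auto simp: hop_def)
    have "real (D a b) \<le> x \<and> real (D b a) \<le> x"
    proof (cases "a = b")
      case True then show ?thesis using a D_refl by simp
    next
      case False
      then have x: "x = 1" using hop_coordinate[OF h] by (simp add: edge_point_def)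
      then obtain w where w: "w \<in> V" "E a w" "edge_point a w 1 = vertex b"
        using h by (auto simp: hop_def)
      then have "w = b" using edge_point_eq_vertex[OF w(3)] E_irrefl by (metis zero_neq_one)
      then show ?thesis using D_edge[of a b] D_edge[of b a] E_sym[of a b] w x a b by auto
    qed
    then show "real (D a b) \<le> x" "real (D b a) \<le> x" by auto
  qed
  have "vertex u \<in> R" "vertex v \<in> R" using assms by (simp_all add: vertex_in_realization)
  from pl_path_reduce[OF path_metric_attained[OF this]]
  show "real (D u v) \<le> dist (vertex u) (vertex v)"
  proof (elim disjE exE conjE)
    fix a b s t assume e: "a \<in> V" "b \<in> V" "E a b" "0 \<le> s" "s \<le> 1" "0 \<le> t" "t \<le> 1"
      "vertex u = edge_point a b s" "vertex v = edge_point a b t"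
      "\<bar>s - t\<bar> \<le> dist (vertex u) (vertex v)"
    have ne: "a \<noteq> b" using e(3) E_irrefl by metis
    have "D a b \<le> 1" "D b a \<le> 1"
      using D_edge[OF e(1-3)] D_edge[OF e(2,1) E_sym[OF e(1-3)]] .
    then have "real (D u v) \<le> \<bar>s - t\<bar>"
      using edge_point_eq_vertex[OF e(8)[symmetric] ne] edge_point_eq_vertex[OF e(9)[symmetric] ne]
        D_refl[OF e(1)] D_refl[OF e(2)] by (elim disjE conjE) simp_all
    then show ?thesis using e(10) by linarith
  next
    fix a b x y assume h: "hop (vertex u) a x" "hop (vertex v) b y"
      "x + real (D a b) + y \<le> dist (vertex u) (vertex v)"
    have ab: "a \<in> V" "b \<in> V" using h by (auto simp: hop_def)
    have "D u v \<le> D u a + (D a b + D b v)"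
      using D_triangle[of u a v] D_triangle[of a b v] ab assms by linarith
    then have "real (D u v) \<le> real (D u a) + (real (D a b) + real (D b v))"
      by (metis of_nat_add of_nat_le_iff)
    then show ?thesis using near[OF h(1) assms(1)] near[OF h(2) assms(2)] h(3) by linarith
  qed
qed

lemma near_vertex:
  assumes "p \<in> R" shows "\<exists>v\<in>V. dist p (vertex v) \<le> 1 / 2"
proof -
  obtain a x where h: "hop p a x" "x \<le> 1 / 2" using hop_exists[OF assms] by blast
  then have "dist p (vertex a) \<le> 1 / 2" using path_metric_le[OF hop_path] by force
  moreover have "a \<in> V" using h by (simp add: hop_def)
  ultimately show ?thesis by blast
qed

end

section \<open>Word metrics and Cayley graphs\<close>

locale fg_group = group G for G :: "('g, 'm) monoid_scheme" (structure) +
  fixes S :: "'g set"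
  assumes gens: "finite_symmetric_generating_set G S"
begin

abbreviation word :: "'g list \<Rightarrow> 'g" where
  "word ws \<equiv> foldr (\<otimes>) ws \<one>"

abbreviation len :: "'g \<Rightarrow> nat" where
  "len \<equiv> word_length G S"

definition word_dist :: "'g \<Rightarrow> 'g \<Rightarrow> nat" where
  "word_dist g h = len (inv g \<otimes> h)"

lemma S_closed: "S \<subseteq> carrier G" and S_finite: "finite S" and S_inv: "s \<in> S \<Longrightarrow> inv s \<in> S"
  and S_generates: "generate G S = carrier G"
  using gens by (auto simp: finite_symmetric_generating_set_def)

lemma word_closed: "set ws \<subseteq> S \<Longrightarrow> word ws \<in> carrier G"
  using S_closed by (induction ws) auto

lemma word_append: "set xs \<subseteq> S \<Longrightarrow> set ys \<subseteq> S \<Longrightarrow> word (xs @ ys) = word xs \<otimes> word ys"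
  using S_closed by (induction xs) (auto simp: word_closed m_assoc subset_iff)

lemma word_snoc: "set xs \<subseteq> S \<Longrightarrow> s \<in> S \<Longrightarrow> word (xs @ [s]) = word xs \<otimes> s"
  using word_append[of xs "[s]"] S_closed by auto

lemma word_inverse:
  "set ws \<subseteq> S \<Longrightarrow> \<exists>ws'. set ws' \<subseteq> S \<and> length ws' = length ws \<and> word ws' = inv (word ws)"
proof (induction ws)
  case (Cons s ws)
  then obtain ws' where ws': "set ws' \<subseteq> S" "length ws' = length ws" "word ws' = inv (word ws)" by auto
  have "s \<in> carrier G" "word ws \<in> carrier G" using Cons.prems S_closed word_closed[of ws] by auto
  then have "word (ws' @ [inv s]) = inv (word (s # ws))"
    using ws' Cons.prems S_inv[of s] word_snoc[of ws' "inv s"]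
    by (simp add: inv_mult_group del: foldr_append)
  then show ?case using ws' Cons.prems S_inv[of s] by (intro exI[of _ "ws' @ [inv s]"]) (auto simp del: foldr_append)
qed simp

lemma word_exists:
  assumes "g \<in> carrier G" shows "\<exists>ws. set ws \<subseteq> S \<and> word ws = g"
proof -
  have "g \<in> generate G S" using assms S_generates by simp
  then show ?thesis
  proof (induction rule: generate.induct)
    case one
    show ?case by (intro exI[of _ "[]"]) simp
  next
    case (incl h)
    then show ?case using S_closed by (intro exI[of _ "[h]"]) auto
  next
    case (inv h)
    then show ?case using S_closed S_inv[of h] by (intro exI[of _ "[inv h]"]) auto
  next
    case (eng h1 h2)
    then obtain u v where "set u \<subseteq> S" "word u = h1" "set v \<subseteq> S" "word v = h2" by auto
    then show ?case using word_append[of u v] by (intro exI[of _ "u @ v"]) auto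
  qed
qed

lemma geodesic_word:
  assumes "g \<in> carrier G"
  obtains ws where "length ws = len g" "set ws \<subseteq> S" "word ws = g"
proof -
  obtain ws where "set ws \<subseteq> S" "word ws = g" using word_exists[OF assms] by blast
  then have "\<exists>n ws. length ws = n \<and> set ws \<subseteq> S \<and> word ws = g" by blast
  then have "\<exists>ws. length ws = len g \<and> set ws \<subseteq> S \<and> word ws = g"
    unfolding word_length_def by (rule LeastI_ex)
  then show ?thesis using that by blast
qed

lemma len_word_le: "set ws \<subseteq> S \<Longrightarrow> len (word ws) \<le> length ws"
  unfolding word_length_def by (rule Least_le) blast

lemma len_one: "len \<one> = 0"
  using len_word_le[of "[]"] by simp

lemma len_mult_le:
  assumes "g \<in> carrier G" "h \<in> carrier G" shows "len (g \<otimes> h) \<le> len g + len h"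
proof -
  obtain u where u: "length u = len g" "set u \<subseteq> S" "word u = g" by (rule geodesic_word[OF assms(1)])
  obtain v where v: "length v = len h" "set v \<subseteq> S" "word v = h" by (rule geodesic_word[OF assms(2)])
  show ?thesis using len_word_le[of "u @ v"] u v word_append[of u v] by simp
qed

lemma len_inv:
  assumes "g \<in> carrier G" shows "len (inv g) = len g"
proof -
  have le: "len (inv h) \<le> len h" if h: "h \<in> carrier G" for h
  proof -
    obtain u where u: "length u = len h" "set u \<subseteq> S" "word u = h" by (rule geodesic_word[OF h])
    obtain v where v: "set v \<subseteq> S" "length v = length u" "word v = inv (word u)"
      using word_inverse[OF u(2)] by blast
    show ?thesis using len_word_le[OF v(1)] u v by simp
  qed
  show ?thesis using le[OF assms] le[of "inv g"] assms by simp
qed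

lemma len_gen: "s \<in> S \<Longrightarrow> len s \<le> 1"
  using len_word_le[of "[s]"] S_closed by auto

lemma finite_ball: "finite {g \<in> carrier G. real (len g) \<le> R}"
proof (rule finite_subset)
  show "{g \<in> carrier G. real (len g) \<le> R} \<subseteq> word ` {ws. set ws \<subseteq> S \<and> length ws \<le> nat \<lfloor>R\<rfloor>}"
  proof
    fix g assume "g \<in> {g \<in> carrier G. real (len g) \<le> R}"
    then have g: "g \<in> carrier G" "real (len g) \<le> R" by auto
    obtain ws where "length ws = len g" "set ws \<subseteq> S" "word ws = g" by (rule geodesic_word[OF g(1)])
    then show "g \<in> word ` {ws. set ws \<subseteq> S \<and> length ws \<le> nat \<lfloor>R\<rfloor>}"
      using g(2) by (auto simp: le_nat_floor intro!: image_eqI[of _ _ ws])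
  qed
  show "finite (word ` {ws. set ws \<subseteq> S \<and> length ws \<le> nat \<lfloor>R\<rfloor>})"
    by (intro finite_imageI finite_lists_length_le S_finite)
qed

lemma word_dist_triangle:
  assumes "a \<in> carrier G" "b \<in> carrier G" "c \<in> carrier G" shows "word_dist a c \<le> word_dist a b + word_dist b c"
proof -
  have "inv a \<otimes> c = (inv a \<otimes> b) \<otimes> (inv b \<otimes> c)"
    using assms m_assoc[of b "inv b" c] by (simp add: m_assoc)
  then show ?thesis unfolding word_dist_def using len_mult_le[of "inv a \<otimes> b" "inv b \<otimes> c"] assms by simp
qed

text \<open>Trivial steps are allowed in walks, so that the number of steps can be prescribed.\<close>

definition walk :: "(nat \<Rightarrow> 'g) \<Rightarrow> nat \<Rightarrow> bool" where
  "walk f n \<longleftrightarrow> (\<forall>i\<le>n. f i \<in> carrier G) \<and> (\<forall>i<n. \<exists>s\<in>insert \<one> S. f (Suc i) = f i \<otimes> s)"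

lemma walk_exists:
  assumes "g \<in> carrier G" "h \<in> carrier G" "word_dist g h \<le> n"
  shows "\<exists>f. f 0 = g \<and> f n = h \<and> walk f n \<and> (\<forall>i. word_dist g (f i) \<le> n)"
proof -
  obtain ws where ws: "length ws = word_dist g h" "set ws \<subseteq> S" "word ws = inv g \<otimes> h"
    using geodesic_word[of "inv g \<otimes> h"] assms unfolding word_dist_def by blast
  define f where "f i = g \<otimes> word (take i ws)" for i
  have sub: "set (take i ws) \<subseteq> S" for i using ws set_take_subset by fast
  have c: "word (take i ws) \<in> carrier G" for i using word_closed[OF sub] .
  have "f 0 = g" "f n = h" using assms ws by (auto simp: f_def inv_solve_left' m_assoc[symmetric])
  moreover have "\<exists>s\<in>insert \<one> S. f (Suc i) = f i \<otimes> s" for i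
  proof (cases "i < length ws")
    case True
    have "ws ! i \<in> S" using ws(2) nth_mem[OF True] by blast
    then have "word (take (Suc i) ws) = word (take i ws) \<otimes> ws ! i"
      using word_snoc[OF sub, of "ws ! i" i] True by (auto simp: take_Suc_conv_app_nth simp del: foldr_append)
    moreover have "ws ! i \<in> S" using ws(2) nth_mem[OF True] by blast
    ultimately show ?thesis using S_closed c[of i] assms(1) 
      by (intro bexI[of _ "ws ! i"]) (auto simp: f_def m_assoc)
  next
    case False
    then show ?thesis using c[of i] assms(1) by (intro bexI[of _ \<one>]) (auto simp: f_def)
  qed
  moreover have "f i \<in> carrier G" for i using c assms by (simp add: f_def)
  moreover have "word_dist g (f i) \<le> n" for i
  proof -
    have "inv g \<otimes> f i = word (take i ws)" using assms c by (simp add: f_def m_assoc[symmetric])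
    then have "word_dist g (f i) \<le> length (take i ws)" unfolding word_dist_def using len_word_le[OF sub] by simp
    also have "\<dots> \<le> n" using ws(1) assms(3) by simp
    finally show ?thesis .
  qed
  ultimately show ?thesis unfolding walk_def by blast
qed

lemma walk_append:
  assumes "walk f m" "walk g n" "f m = g 0"
  shows "walk (\<lambda>i. if i \<le> m then f i else g (i - m)) (m + n)"
  unfolding walk_def
proof (intro conjI allI impI)
  fix i
  let ?h = "\<lambda>i. if i \<le> m then f i else g (i - m)"
  show "?h i \<in> carrier G" if "i \<le> m + n" using that assms(1,2) by (auto simp: walk_def)
  assume i: "i < m + n"
  show "\<exists>s\<in>insert \<one> S. ?h (Suc i) = ?h i \<otimes> s"
  proof (cases "i < m")
    case True then show ?thesis using assms(1) by (auto simp: walk_def)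
  next
    case False
    then have "?h i = g (i - m)" "?h (Suc i) = g (Suc (i - m))" "i - m < n"
      using assms(3) i by (auto simp: Suc_diff_le)
    then show ?thesis using assms(2) by (auto simp: walk_def)
  qed
qed

end

sublocale fg_group \<subseteq> cay: connected_graph "carrier G" "cayley_edge G S" word_dist
proof
  fix u v w
  show "\<not> cayley_edge G S u u" by (simp add: cayley_edge_def)
  show "cayley_edge G S v u" if "u \<in> carrier G" and "v \<in> carrier G" and uv: "cayley_edge G S u v"
  proof -
    obtain s where s: "s \<in> S" "v = u \<otimes> s" "u \<noteq> v"
      using uv unfolding cayley_edge_def by blast
    then have "u = v \<otimes> inv s" using that S_closed by (auto simp: m_assoc)
    then show ?thesis using s S_inv by (auto simp: cayley_edge_def)
  qed
  show "word_dist u u = 0" if "u \<in> carrier G" using that by (simp add: word_dist_def len_one)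
  show "word_dist u w \<le> word_dist u v + word_dist v w" if "u \<in> carrier G" "v \<in> carrier G" "w \<in> carrier G"
    using word_dist_triangle that by blast
  show "word_dist u v \<le> 1" if "u \<in> carrier G" "v \<in> carrier G" and uv: "cayley_edge G S u v"
  proof -
    obtain s where s: "s \<in> S" "v = u \<otimes> s" using uv unfolding cayley_edge_def by blast
    then have "inv u \<otimes> v = s" using that S_closed by (auto simp: m_assoc[symmetric])
    then show ?thesis unfolding word_dist_def using len_gen s by simp
  qed
  show "\<exists>f. f 0 = u \<and> f (word_dist u v) = v \<and> (\<forall>i<word_dist u v. f i \<in> carrier G \<and> f (Suc i) \<in> carrier G \<and>
      (f i = f (Suc i) \<or> cayley_edge G S (f i) (f (Suc i))))"
    if uv: "u \<in> carrier G" "v \<in> carrier G"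
  proof -
    obtain f where f: "f 0 = u" "f (word_dist u v) = v" "walk f (word_dist u v)"
      using walk_exists[OF uv order_refl] by blast
    have "f i \<in> carrier G \<and> f (Suc i) \<in> carrier G \<and> (f i = f (Suc i) \<or> cayley_edge G S (f i) (f (Suc i)))"
      if i: "i < word_dist u v" for i
    proof -
      have c: "f i \<in> carrier G" "f (Suc i) \<in> carrier G" using f(3) i by (auto simp: walk_def)
      obtain s where "s \<in> insert \<one> S" "f (Suc i) = f i \<otimes> s" using f(3) i by (auto simp: walk_def)
      then show ?thesis using c by (auto simp: cayley_edge_def)
    qed
    then show ?thesis using f by blast
  qed
qed

sublocale fg_group \<subseteq> cay_metric: Metric_space "graph_realization (carrier G) (cayley_edge G S)"
    "path_metric (carrier G) (cayley_edge G S)"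
  by (rule cay.Metric_space_realization)

context fg_group
begin

text \<open>The geodesic is sampled every 10 units. The vertices next to consecutive samples are at distance at
  most 11 and are joined by walks of exactly 11 steps, pauses included. The coarse sampling keeps
  the number of steps below 1.1 times the length, up to a constant, which is a loss that the constants of
  the final argument allow; unit steps would double the length.\<close>

lemma geodesic_discretization:
  assumes c: "geodesic cay.R cay.dist x y c" and a: "a \<in> carrier G" "cay.dist x (vertex a) \<le> 1 / 2"
    and b: "b \<in> carrier G" "cay.dist y (vertex b) \<le> 1 / 2"
  defines "l \<equiv> cay.dist x y"
  shows "\<exists>w K \<tau>. w 0 = a \<and> w K = b \<and> walk w K \<and> real K \<le> 11 / 10 * l + 22 \<and>
    (\<forall>i\<le>K. 0 \<le> \<tau> i \<and> \<tau> i \<le> l \<and> cay.dist (vertex (w i)) (c (\<tau> i)) \<le> 12) \<and>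
    (\<forall>i j. i \<le> j \<and> j \<le> K \<longrightarrow> \<tau> i \<le> \<tau> j) \<and>
    (\<forall>t. 0 \<le> t \<and> t \<le> l \<longrightarrow> (\<exists>i\<le>K. cay.dist (c t) (vertex (w i)) \<le> 12))"
proof -
  have l0: "0 \<le> l" by (simp add: l_def)
  have cR: "c t \<in> cay.R" if "0 \<le> t" "t \<le> l" for t using c that by (auto simp: geodesic_def l_def)
  have cd: "cay.dist (c s) (c t) = \<bar>s - t\<bar>" if "0 \<le> s" "s \<le> l" "0 \<le> t" "t \<le> l" for s t
    using c that unfolding geodesic_def l_def by auto
  have ends: "c 0 = x" "c l = y" using c by (auto simp: geodesic_def l_def)
  have V: "vertex g \<in> cay.R" if "g \<in> carrier G" for g using vertex_in_realization[OF that] .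
  \<comment> \<open>At least one block, so that the two ends can be prescribed even if the geodesic is a point.\<close>
  define B where "B = nat \<lceil>l / 10\<rceil> + 1"
  define T where "T j = min (10 * real j) l" for j :: nat
  have T: "0 \<le> T j" "T j \<le> l" for j using l0 by (auto simp: T_def)
  have TB: "T j = l" if "B \<le> j" for j
  proof -
    have "nat \<lceil>l / 10\<rceil> \<le> j" using that unfolding B_def by linarith
    then have "real (nat \<lceil>l / 10\<rceil>) \<le> real j" by (rule of_nat_mono)
    then have "l / 10 \<le> real j" using real_nat_ceiling_ge[of "l / 10"] by linarith
    then show ?thesis by (simp add: T_def)
  qed
  have "\<exists>u. u \<in> carrier G \<and> cay.dist (c (T j)) (vertex u) \<le> 1 / 2 \<and>
      (j = 0 \<longrightarrow> u = a) \<and> (B \<le> j \<longrightarrow> u = b)" for j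
  proof -
    consider "j = 0" | "B \<le> j" | "0 < j" "j < B" by linarith
    then show ?thesis
    proof cases
      case 1 then show ?thesis using a ends l0 by (intro exI[of _ a]) (auto simp: T_def B_def)
    next
      case 2 then show ?thesis using b ends TB by (intro exI[of _ b]) (auto simp: B_def)
    next
      case 3 then show ?thesis using cay.near_vertex[OF cR[OF T]] by force
    qed
  qed
  then obtain u where u: "\<And>j. u j \<in> carrier G" "\<And>j. cay.dist (c (T j)) (vertex (u j)) \<le> 1 / 2"
      "u 0 = a" "\<And>j. B \<le> j \<Longrightarrow> u j = b" by metis
  have u11: "word_dist (u j) (u (Suc j)) \<le> 11" for j
  proof -
    have "cay.dist (c (T j)) (c (T (Suc j))) \<le> 10" using cd[OF T T, of j "Suc j"] l0 by (auto simp: T_def)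
    then have "cay.dist (vertex (u j)) (vertex (u (Suc j))) \<le> 11"
      using cay_metric.triangle[of "vertex (u j)" "c (T j)" "vertex (u (Suc j))"]
        cay_metric.triangle[of "c (T j)" "c (T (Suc j))" "vertex (u (Suc j))"]
        V[OF u(1)] cR[OF T] u(2)[of j] u(2)[of "Suc j"]
        cay_metric.commute[of "vertex (u j)" "c (T j)"] by auto
    then show ?thesis using cay.path_metric_vertex[OF u(1) u(1)] by simp
  qed
  have "\<exists>f. f 0 = u j \<and> f 11 = u (Suc j) \<and> walk f 11 \<and> (\<forall>i. word_dist (u j) (f i) \<le> 11)" for j
    using walk_exists[OF u(1) u(1) u11] .
  then obtain f where f: "\<And>j. f j 0 = u j" "\<And>j. f j 11 = u (Suc j)" "\<And>j. walk (f j) 11"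
      "\<And>j i. word_dist (u j) (f j i) \<le> 11" by metis
  define w where "w k = f (k div 11) (k mod 11)" for k
  define \<tau> where "\<tau> k = T (k div 11)" for k
  define K where "K = 11 * B"
  have wc: "w k \<in> carrier G" for k
  proof -
    have "k mod 11 \<le> 11" by (simp add: less_imp_le)
    then show ?thesis using f(3) unfolding walk_def w_def by blast
  qed
  have step: "\<exists>s\<in>insert \<one> S. w (Suc k) = w k \<otimes> s" for k
  proof -
    have lt: "k mod 11 < 11" by simp
    have "w (Suc k) = f (k div 11) (Suc (k mod 11))"
    proof (cases "k mod 11 = 10")
      case True
      then have "Suc k mod 11 = 0" "Suc k div 11 = Suc (k div 11)" by presburger+
      then show ?thesis using True f(1)[of "Suc (k div 11)"] f(2)[of "k div 11"]
        by (simp add: w_def)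
    next
      case False
      then have "Suc k mod 11 = Suc (k mod 11)" "Suc k div 11 = k div 11" by presburger+
      then show ?thesis by (simp add: w_def)
    qed
    moreover have "\<exists>s\<in>insert \<one> S. f (k div 11) (Suc (k mod 11)) = f (k div 11) (k mod 11) \<otimes> s"
      using f(3)[of "k div 11"] lt unfolding walk_def by blast
    ultimately show ?thesis by (simp only: w_def)
  qed
  have "w 0 = a" using f(1)[of 0] u(3) by (simp add: w_def)
  moreover have "w K = b" using f(1)[of B] u(4)[of B] by (simp add: w_def K_def)
  moreover have "walk w K" using wc step by (simp add: walk_def)
  moreover have "real K \<le> 11 / 10 * l + 22"
  proof -
    have "real (nat \<lceil>l / 10\<rceil>) \<le> l / 10 + 1" using l0 by linarith
    then show ?thesis by (simp add: K_def B_def)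
  qed
  moreover have "0 \<le> \<tau> i \<and> \<tau> i \<le> l \<and> cay.dist (vertex (w i)) (c (\<tau> i)) \<le> 12" for i
  proof -
    let ?j = "i div 11"
    have "cay.dist (vertex (u ?j)) (vertex (w i)) \<le> 11"
      using cay.path_metric_vertex[OF u(1) wc] f(4)[of ?j "i mod 11"] by (simp add: w_def)
    then have "cay.dist (vertex (w i)) (c (T ?j)) \<le> 12"
      using cay_metric.triangle[of "c (T ?j)" "vertex (u ?j)" "vertex (w i)"] V[OF u(1)] V[OF wc]
        cR[OF T] u(2)[of ?j] cay_metric.commute[of "vertex (w i)" "c (T ?j)"] by auto
    then show ?thesis using T by (simp add: \<tau>_def)
  qed
  moreover have "\<tau> i \<le> \<tau> j" if "i \<le> j" for i j
  proof -
    have "real (i div 11) \<le> real (j div 11)" using div_le_mono[OF that] by simp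
    then show ?thesis by (simp add: \<tau>_def T_def min_def)
  qed
  moreover have "\<exists>i\<le>K. cay.dist (c t) (vertex (w i)) \<le> 12" if t: "0 \<le> t" "t \<le> l" for t
  proof -
    define j where "j = nat \<lfloor>t / 10\<rfloor>"
    have j: "10 * real j \<le> t" "t \<le> 10 * real j + 10" using t unfolding j_def by linarith+
    then have Tj: "T j = 10 * real j" using t by (simp add: T_def)
    have "\<lfloor>t / 10\<rfloor> \<le> \<lceil>l / 10\<rceil>" using t by (simp add: floor_le_iff) linarith
    then have "11 * j \<le> K" by (simp add: K_def B_def j_def nat_le_iff)
    moreover have "w (11 * j) = u j" using f(1)[of j] by (simp add: w_def)
    moreover have "cay.dist (c t) (vertex (u j)) \<le> 12"
    proof -
      have "cay.dist (c t) (c (T j)) \<le> 10" using cd[OF t T[of j]] Tj j by auto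
      then show ?thesis using cay_metric.triangle[of "c t" "c (T j)" "vertex (u j)"] V[OF u(1)]
        cR[OF T] cR[OF t] u(2)[of j] by auto
    qed
    ultimately show ?thesis by (intro exI[of _ "11 * j"]) simp
  qed
  ultimately show ?thesis by blast
qed

text \<open>A walk of bounded length that follows the set \<open>A\<close>; unlike a discretized geodesic, shadows can be
  concatenated.\<close>

definition shadow :: "'g \<Rightarrow> 'g \<Rightarrow> ('g \<Rightarrow> real) set \<Rightarrow> real \<Rightarrow> bool" where
  "shadow a b A L \<longleftrightarrow> (\<exists>w K. w 0 = a \<and> w K = b \<and> walk w K \<and> real K \<le> L \<and>
     (\<forall>i\<le>K. \<exists>q\<in>A. cay.dist (vertex (w i)) q \<le> 12))"

lemma shadow_segment:
  assumes I: "geodesic_segment cay.R cay.dist x y I"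
    and a: "a \<in> carrier G" "cay.dist x (vertex a) \<le> 1 / 2"
    and b: "b \<in> carrier G" "cay.dist y (vertex b) \<le> 1 / 2"
  shows "shadow a b I (11 / 10 * cay.dist x y + 22)"
proof -
  obtain c where c: "geodesic cay.R cay.dist x y c" "I = c ` {0..cay.dist x y}"
    using I by (auto simp: geodesic_segment_def)
  obtain w K \<tau> where w: "w 0 = a" "w K = b" "walk w K" "real K \<le> 11 / 10 * cay.dist x y + 22"
    "\<forall>i\<le>K. 0 \<le> \<tau> i \<and> \<tau> i \<le> cay.dist x y \<and> cay.dist (vertex (w i)) (c (\<tau> i)) \<le> 12"
    using geodesic_discretization[OF c(1) a b] by blast
  have "\<exists>q\<in>I. cay.dist (vertex (w i)) q \<le> 12" if "i \<le> K" for i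
    using w(5) that c(2) by (intro bexI[of _ "c (\<tau> i)"]) auto
  then show ?thesis unfolding shadow_def using w by blast
qed

lemma shadow_append:
  assumes "shadow a b A L" "shadow b c A' L'" shows "shadow a c (A \<union> A') (L + L')"
proof -
  obtain w K where w: "w 0 = a" "w K = b" "walk w K" "real K \<le> L"
     "\<And>i. i \<le> K \<Longrightarrow> \<exists>q\<in>A. cay.dist (vertex (w i)) q \<le> 12"
    using assms(1) unfolding shadow_def by blast
  obtain w' K' where w': "w' 0 = b" "w' K' = c" "walk w' K'" "real K' \<le> L'"
     "\<And>i. i \<le> K' \<Longrightarrow> \<exists>q\<in>A'. cay.dist (vertex (w' i)) q \<le> 12"
    using assms(2) unfolding shadow_def by blast
  let ?h = "\<lambda>i. if i \<le> K then w i else w' (i - K)"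
  have "walk ?h (K + K')" by (rule walk_append) (use w w' in auto)
  moreover have "\<exists>q\<in>A \<union> A'. cay.dist (vertex (?h i)) q \<le> 12" if "i \<le> K + K'" for i
  proof (cases "i \<le> K")
    case True then show ?thesis using w(5)[of i] by auto
  next
    case False
    then have "i - K \<le> K'" using that by simp
    then show ?thesis using w'(5) False by fastforce
  qed
  ultimately show ?thesis unfolding shadow_def using w(1,2,4) w'(1,2,4)
    by (intro exI[of _ ?h] exI[of _ "K + K'"]) auto
qed

end

section \<open>Cocycles over measure-preserving actions\<close>

locale mp_action = group G for G :: "('g, 'm) monoid_scheme" (structure) +
  fixes M :: "'w measure" and act :: "'g \<Rightarrow> 'w \<Rightarrow> 'w"
  assumes action: "free_mp_action G M act"
begin

lemma act_closed: "g \<in> carrier G \<Longrightarrow> x \<in> space M \<Longrightarrow> act g x \<in> space M"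
  using action group_action.element_image unfolding free_mp_action_def by fast

lemma act_mult:
  "g \<in> carrier G \<Longrightarrow> h \<in> carrier G \<Longrightarrow> x \<in> space M \<Longrightarrow> act (g \<otimes> h) x = act g (act h x)"
  using action group_action.composition_rule unfolding free_mp_action_def by fast

lemma act_one: "x \<in> space M \<Longrightarrow> act \<one> x = x"
  using action group_action.id_eq_one[of G "space M" act] unfolding free_mp_action_def
  by (metis restrict_apply')

lemma act_inv: "g \<in> carrier G \<Longrightarrow> x \<in> space M \<Longrightarrow> act (inv g) (act g x) = x"
  using act_mult[of "inv g" g x] act_one by simp

lemma act_inv': "g \<in> carrier G \<Longrightarrow> x \<in> space M \<Longrightarrow> act g (act (inv g) x) = x"
  using act_mult[of g "inv g" x] act_one by simp

lemma act_measurable: "g \<in> carrier G \<Longrightarrow> act g \<in> measurable M M"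
  using action by (simp add: free_mp_action_def)

lemma sets_act_vimage: "g \<in> carrier G \<Longrightarrow> B \<in> sets M \<Longrightarrow> act g -` B \<inter> space M \<in> sets M"
  using act_measurable by (rule measurable_sets)

lemma emeasure_act_vimage:
  assumes "g \<in> carrier G" "B \<in> sets M" shows "emeasure M (act g -` B \<inter> space M) = emeasure M B"
proof -
  have "distr M M (act g) = M" using action assms by (simp add: free_mp_action_def)
  then show ?thesis using emeasure_distr[OF act_measurable[OF assms(1)] assms(2)] by simp
qed

lemma act_image_eq_vimage:
  assumes "g \<in> carrier G" "B \<subseteq> space M" shows "act g ` B = act (inv g) -` B \<inter> space M"
proof
  show "act g ` B \<subseteq> act (inv g) -` B \<inter> space M"
    using assms act_inv act_closed by auto
  show "act (inv g) -` B \<inter> space M \<subseteq> act g ` B"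
  proof
    fix x assume "x \<in> act (inv g) -` B \<inter> space M"
    then show "x \<in> act g ` B" using act_inv'[of g x] assms(1)
      by (intro image_eqI[of _ _ "act (inv g) x"]) auto
  qed
qed

end

locale cocycle_action = A: mp_action G M actG + D: mp_action H M actH
  for G :: "('g, 'm) monoid_scheme" and H :: "('h, 'n) monoid_scheme"
    and M :: "'w measure" and actG :: "'g \<Rightarrow> 'w \<Rightarrow> 'w" and actH :: "'h \<Rightarrow> 'w \<Rightarrow> 'w" +
  fixes X :: "'w set"
  assumes commuting: "g \<in> carrier G \<Longrightarrow> h \<in> carrier H \<Longrightarrow> x \<in> space M \<Longrightarrow>
      actG g (actH h x) = actH h (actG g x)"
    and domain: "fundamental_domain H M actH X"
    and countable_H: "countable (carrier H)"
begin

abbreviation coc :: "'g \<Rightarrow> 'w \<Rightarrow> 'h" where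
  "coc \<equiv> cocycle actG H actH X"

text \<open>The action of \<open>G\<close> on the quotient of \<open>M\<close> by \<open>H\<close>, transported to the fundamental domain \<open>X\<close>.\<close>

definition induced :: "'g \<Rightarrow> 'w \<Rightarrow> 'w" where
  "induced g x = actH (coc g x) (actG g x)"

lemma X_sets: "X \<in> sets M"
  using domain by (simp add: fundamental_domain_def)

lemma X_space: "x \<in> X \<Longrightarrow> x \<in> space M"
  using sets.sets_into_space[OF X_sets] by blast

lemma domain_bij: "bij_betw (\<lambda>(h, x). actH h x) (carrier H \<times> X) (space M)"
  using domain by (simp add: fundamental_domain_def)

lemma return_exists:
  assumes "y \<in> space M" shows "\<exists>h\<in>carrier H. actH h y \<in> X"
proof -
  have "y \<in> (\<lambda>(h, x). actH h x) ` (carrier H \<times> X)"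
    using domain_bij assms by (simp add: bij_betw_def)
  then obtain h x where "h \<in> carrier H" "x \<in> X" "y = actH h x" by auto
  then show ?thesis using D.act_inv[of h x] X_space by (intro bexI[of _ "inv\<^bsub>H\<^esub> h"]) auto
qed

lemma return_unique:
  assumes y: "y \<in> space M" and h: "h1 \<in> carrier H" "actH h1 y \<in> X" "h2 \<in> carrier H" "actH h2 y \<in> X"
  shows "h1 = h2"
proof -
  have eq: "(\<lambda>(h, x). actH h x) (inv\<^bsub>H\<^esub> h1, actH h1 y) = (\<lambda>(h, x). actH h x) (inv\<^bsub>H\<^esub> h2, actH h2 y)"
    using D.act_inv y h by simp
  then have "inv\<^bsub>H\<^esub> h1 = inv\<^bsub>H\<^esub> h2"
    using inj_onD[OF bij_betw_imp_inj_on[OF domain_bij] eq] h by auto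
  then show ?thesis using h D.inv_inv by metis
qed

lemma coc_eqI:
  "g \<in> carrier G \<Longrightarrow> x \<in> space M \<Longrightarrow> h \<in> carrier H \<Longrightarrow> actH h (actG g x) \<in> X \<Longrightarrow> coc g x = h"
  unfolding cocycle_def using return_unique A.act_closed by (intro the_equality) blast+

lemma coc_closed: "g \<in> carrier G \<Longrightarrow> x \<in> space M \<Longrightarrow> coc g x \<in> carrier H"
  and induced_in: "g \<in> carrier G \<Longrightarrow> x \<in> space M \<Longrightarrow> induced g x \<in> X"
  using return_exists[OF A.act_closed[of g x]] coc_eqI unfolding induced_def by metis+

lemma coc_one: "x \<in> X \<Longrightarrow> coc \<one>\<^bsub>G\<^esub> x = \<one>\<^bsub>H\<^esub>"
  using A.act_one D.act_one X_space by (intro coc_eqI) auto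

lemma coc_mult:
  assumes "g \<in> carrier G" "h \<in> carrier G" "x \<in> space M"
  shows "coc (g \<otimes>\<^bsub>G\<^esub> h) x = coc g (induced h x) \<otimes>\<^bsub>H\<^esub> coc h x"
proof (rule coc_eqI)
  let ?y = "induced h x"
  have y: "?y \<in> space M" using induced_in assms X_space by blast
  have c: "coc g ?y \<in> carrier H" "coc h x \<in> carrier H" using coc_closed assms y by blast+
  then show "coc g ?y \<otimes>\<^bsub>H\<^esub> coc h x \<in> carrier H" by simp
  have "actH (coc g ?y \<otimes>\<^bsub>H\<^esub> coc h x) (actG (g \<otimes>\<^bsub>G\<^esub> h) x) =
      actH (coc g ?y) (actH (coc h x) (actG g (actG h x)))"
    using c assms A.act_closed A.act_mult D.act_mult by simp
  also have "\<dots> = induced g ?y"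
    unfolding induced_def using commuting c assms A.act_closed by simp
  finally show "actH (coc g ?y \<otimes>\<^bsub>H\<^esub> coc h x) (actG (g \<otimes>\<^bsub>G\<^esub> h) x) \<in> X"
    using induced_in assms y by simp
qed (use assms in auto)

lemma coc_level_sets:
  assumes "g \<in> carrier G" "h \<in> carrier H" "B \<in> sets M"
  shows "{x \<in> X. actH h (actG g x) \<in> B} \<in> sets M"
proof -
  have "{x \<in> X. actH h (actG g x) \<in> B} = X \<inter> (actG g -` (actH h -` B \<inter> space M) \<inter> space M)"
    using X_space A.act_closed assms(1) by auto
  then show ?thesis
    using sets.Int[OF X_sets A.sets_act_vimage[OF assms(1) D.sets_act_vimage[OF assms(2,3)]]]
    by (simp only:)
qed

lemma coc_sets:
  assumes g: "g \<in> carrier G" shows "{x \<in> X. P (coc g x)} \<in> sets M"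
proof -
  have "{x \<in> X. P (coc g x)} = (\<Union>h\<in>{h \<in> carrier H. P h}. {x \<in> X. actH h (actG g x) \<in> X})"
  proof (rule Set.set_eqI, rule iffI)
    fix x assume "x \<in> {x \<in> X. P (coc g x)}"
    then show "x \<in> (\<Union>h\<in>{h \<in> carrier H. P h}. {x \<in> X. actH h (actG g x) \<in> X})"
      using coc_closed[OF g X_space] induced_in[OF g X_space] unfolding induced_def by blast
  next
    fix x assume "x \<in> (\<Union>h\<in>{h \<in> carrier H. P h}. {x \<in> X. actH h (actG g x) \<in> X})"
    then obtain h where "h \<in> carrier H" "P h" "x \<in> X" "actH h (actG g x) \<in> X" by blast
    then show "x \<in> {x \<in> X. P (coc g x)}" using coc_eqI[OF g X_space] by simp
  qed
  also have "\<dots> \<in> sets M"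
    using countable_H coc_level_sets[OF g _ X_sets]
    by (intro sets.countable_UN') (auto intro: countable_subset)
  finally show ?thesis .
qed

lemma induced_vimage:
  assumes g: "g \<in> carrier G" and B: "B \<in> sets M" "B \<subseteq> X"
  shows "{x \<in> X. induced g x \<in> B} = (\<Union>h\<in>carrier H. {x \<in> X. actH h (actG g x) \<in> B})"
proof (rule Set.set_eqI, rule iffI)
  fix x assume "x \<in> {x \<in> X. induced g x \<in> B}"
  then show "x \<in> (\<Union>h\<in>carrier H. {x \<in> X. actH h (actG g x) \<in> B})"
    using coc_closed[OF g X_space] unfolding induced_def by blast
next
  fix x assume "x \<in> (\<Union>h\<in>carrier H. {x \<in> X. actH h (actG g x) \<in> B})"
  then obtain h where h: "h \<in> carrier H" "x \<in> X" "actH h (actG g x) \<in> B" by blast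
  then have "coc g x = h" using B by (intro coc_eqI[OF g X_space]) auto
  then show "x \<in> {x \<in> X. induced g x \<in> B}" using h by (simp add: induced_def)
qed

lemma induced_vimage_sets:
  assumes "g \<in> carrier G" "B \<in> sets M" "B \<subseteq> X" shows "{x \<in> X. induced g x \<in> B} \<in> sets M"
  unfolding induced_vimage[OF assms]
  using countable_H coc_level_sets[OF assms(1) _ assms(2)] by (intro sets.countable_UN') auto

text \<open>On the part of \<open>X\<close> where the cocycle has the value \<open>h\<close>, the induced map is the measure-preserving
  map \<open>x \<mapsto> h g x\<close>. The images of these parts are disjoint, because the value \<open>h\<close> can be read off the image:
  its inverse is the element of \<open>H\<close> returning the point to \<open>X\<close> after the action of the inverse of \<open>g\<close>.\<close>

lemma emeasure_induced_vimage:
  assumes g: "g \<in> carrier G" and B: "B \<in> sets M" "B \<subseteq> X"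
  shows "emeasure M {x \<in> X. induced g x \<in> B} \<le> emeasure M B"
proof -
  note inv = A.inv_closed[OF g]
  define A1 where "A1 h = {x \<in> X. actH h (actG g x) \<in> B}" for h
  define A2 where "A2 h = {y \<in> B. actH (inv\<^bsub>H\<^esub> h) (actG (inv\<^bsub>G\<^esub> g) y) \<in> X}" for h
  have BX: "y \<in> X" "y \<in> space M" if "y \<in> B" for y using B X_space that by auto
  have A1: "A1 h \<in> sets M" if "h \<in> carrier H" for h
    unfolding A1_def using coc_level_sets g that B by blast
  have A2: "A2 h \<in> sets M" if "h \<in> carrier H" for h
  proof -
    have "A2 h = B \<inter> {x \<in> X. actH (inv\<^bsub>H\<^esub> h) (actG (inv\<^bsub>G\<^esub> g) x) \<in> X}"
      using B unfolding A2_def by auto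
    then show ?thesis using coc_level_sets[OF inv D.inv_closed[OF that] X_sets] B by simp
  qed
  have eq: "emeasure M (A1 h) = emeasure M (A2 h)" if h: "h \<in> carrier H" for h
  proof -
    have "actG g -` (actH h -` A2 h \<inter> space M) \<inter> space M = A1 h"
    proof (rule Set.set_eqI, rule iffI)
      fix x assume "x \<in> actG g -` (actH h -` A2 h \<inter> space M) \<inter> space M"
      then have x: "x \<in> space M" "actH h (actG g x) \<in> B"
        "actH (inv\<^bsub>H\<^esub> h) (actG (inv\<^bsub>G\<^esub> g) (actH h (actG g x))) \<in> X" by (auto simp: A2_def)
      moreover have "actH (inv\<^bsub>H\<^esub> h) (actG (inv\<^bsub>G\<^esub> g) (actH h (actG g x))) = x"
        using commuting[OF inv h] A.act_closed g h x A.act_inv D.act_inv inv by simp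
      ultimately show "x \<in> A1 h" by (simp add: A1_def)
    next
      fix x assume "x \<in> A1 h"
      then have x: "x \<in> X" "x \<in> space M" "actH h (actG g x) \<in> B" using X_space by (auto simp: A1_def)
      moreover have "actH (inv\<^bsub>H\<^esub> h) (actG (inv\<^bsub>G\<^esub> g) (actH h (actG g x))) = x"
        using commuting[OF inv h] A.act_closed g h x A.act_inv D.act_inv inv by simp
      ultimately show "x \<in> actG g -` (actH h -` A2 h \<inter> space M) \<inter> space M"
        using A.act_closed[OF g] by (simp add: A2_def)
    qed
    then show ?thesis
      using A.emeasure_act_vimage[OF g D.sets_act_vimage[OF h A2[OF h]]]
        D.emeasure_act_vimage[OF h A2[OF h]] by simp
  qed
  have disj1: "disjoint_family_on A1 (carrier H)"
    unfolding disjoint_family_on_def A1_def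
    using return_unique[OF A.act_closed[OF g]] BX X_space by blast
  have disj2: "disjoint_family_on A2 (carrier H)"
    unfolding disjoint_family_on_def
  proof (intro ballI impI)
    fix h1 h2 assume h: "h1 \<in> carrier H" "h2 \<in> carrier H" "h1 \<noteq> h2"
    then have "inv\<^bsub>H\<^esub> h1 \<noteq> inv\<^bsub>H\<^esub> h2" using D.inv_inv by metis
    then show "A2 h1 \<inter> A2 h2 = {}"
      using return_unique[OF A.act_closed[OF inv]] BX h D.inv_closed unfolding A2_def by blast
  qed
  have "emeasure M {x \<in> X. induced g x \<in> B} = emeasure M (\<Union>h\<in>carrier H. A1 h)"
    unfolding A1_def induced_vimage[OF g B] ..
  also have "\<dots> = (\<integral>\<^sup>+h. emeasure M (A1 h) \<partial>count_space (carrier H))"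
    using A1 countable_H disj1 by (intro emeasure_UN_countable) auto
  also have "\<dots> = (\<integral>\<^sup>+h. emeasure M (A2 h) \<partial>count_space (carrier H))"
    by (intro nn_integral_cong) (simp add: eq)
  also have "\<dots> = emeasure M (\<Union>h\<in>carrier H. A2 h)"
    using A2 countable_H disj2 by (intro emeasure_UN_countable[symmetric]) auto
  also have "\<dots> \<le> emeasure M B"
    using B by (intro emeasure_mono) (auto simp: A2_def)
  finally show ?thesis .
qed

text \<open>Markov's inequality. The event is measurable for every predicate \<open>P\<close>, since the cocycle takes
  countably many values.\<close>

lemma emeasure_coc_markov:
  fixes \<phi> :: "real \<Rightarrow> real" and len :: "'h \<Rightarrow> real"
  assumes g: "g \<in> carrier G" and c: "0 < c" and K: "0 \<le> K"
    and P: "\<And>h. P h \<Longrightarrow> c \<le> \<phi> (len h)"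
    and int: "(\<integral>\<^sup>+x\<in>X. ennreal (\<phi> (len (coc g x))) \<partial>M) \<le> ennreal K"
  shows "emeasure M {x \<in> X. P (coc g x)} \<le> ennreal (K / c)"
proof -
  let ?A = "{x \<in> X. P (coc g x)}"
  have "ennreal c * emeasure M ?A = (\<integral>\<^sup>+x. ennreal c * indicator ?A x \<partial>M)"
    using coc_sets[OF g] by (simp add: nn_integral_cmult_indicator)
  also have "\<dots> \<le> (\<integral>\<^sup>+x\<in>X. ennreal (\<phi> (len (coc g x))) \<partial>M)"
    by (intro nn_integral_mono) (auto simp: indicator_def P intro!: ennreal_leI)
  also have "\<dots> \<le> ennreal c * ennreal (K / c)"
    using int c K by (simp flip: ennreal_mult)
  finally show ?thesis
    using c by (subst (asm) ennreal_mult_le_mult_iff) auto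
qed

end

section \<open>Random maps between the groups\<close>

locale quantitative_cocycle =
  cocycle_action G H M actG actH X + GS: fg_group G S + HT: fg_group H T
  for G :: "('g, 'm) monoid_scheme" and S :: "'g set" and H :: "('h, 'n) monoid_scheme"
    and T :: "'h set" and M :: "'w measure" and actG :: "'g \<Rightarrow> 'w \<Rightarrow> 'w"
    and actH :: "'h \<Rightarrow> 'w \<Rightarrow> 'w" and X :: "'w set"
begin

text \<open>By the cocycle identity, the value at a word is a product with one factor for each letter, a value at a
  generator and at a translate of \<open>y\<close>. Translation does not increase the measure of events, so
  each letter adds at most \<open>q\<close> to the probability that some factor is longer than \<open>t\<close>.\<close>

lemma emeasure_coc_word:
  assumes t: "0 \<le> t" and q: "0 \<le> q"
    and gen: "\<And>s. s \<in> S \<Longrightarrow> emeasure M {y \<in> X. t < real (HT.len (coc s y))} \<le> ennreal q"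
    and ws: "set ws \<subseteq> S"
  shows "emeasure M {y \<in> X. t * real (length ws) < real (HT.len (coc (GS.word ws) y))}
    \<le> ennreal (real (length ws) * q)"
  using ws
proof (induction ws)
  case Nil
  have "{y \<in> X. t * real (length ([] :: 'g list)) < real (HT.len (coc (GS.word []) y))} = {}"
    using coc_one HT.len_one by auto
  then show ?case by (simp only: emeasure_empty zero_le)
next
  case (Cons s ws)
  let ?g = "GS.word ws"
  have s: "s \<in> S" "s \<in> carrier G" and g: "?g \<in> carrier G"
    using Cons.prems GS.S_closed GS.word_closed[of ws] by auto
  let ?B = "{y \<in> X. t < real (HT.len (coc s y))}"
  let ?W = "{y \<in> X. t * real (length ws) < real (HT.len (coc ?g y))}"
  let ?I = "{y \<in> X. induced ?g y \<in> ?B}"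
  have B: "?B \<in> sets M" by (rule coc_sets[OF s(2)])
  have W: "?W \<in> sets M" by (rule coc_sets[OF g])
  have I: "?I \<in> sets M" by (rule induced_vimage_sets[OF g B]) auto
  have "{y \<in> X. t * real (length (s # ws)) < real (HT.len (coc (GS.word (s # ws)) y))} \<subseteq> ?W \<union> ?I"
  proof (rule subsetI, rule ccontr)
    fix y assume y: "y \<in> {y \<in> X. t * real (length (s # ws)) < real (HT.len (coc (GS.word (s # ws)) y))}"
      and "y \<notin> ?W \<union> ?I"
    then have yX: "y \<in> X" and no: "real (HT.len (coc ?g y)) \<le> t * real (length ws)"
      "real (HT.len (coc s (induced ?g y))) \<le> t"
      using induced_in[OF g X_space, of y] by auto
    have z: "induced ?g y \<in> space M" using induced_in[OF g X_space[OF yX]] X_space by blast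
    have "HT.len (coc (GS.word (s # ws)) y) \<le> HT.len (coc s (induced ?g y)) + HT.len (coc ?g y)"
      using coc_mult[OF s(2) g X_space[OF yX]]
        HT.len_mult_le[OF coc_closed[OF s(2) z] coc_closed[OF g X_space[OF yX]]] by simp
    then have "real (HT.len (coc (GS.word (s # ws)) y))
        \<le> real (HT.len (coc s (induced ?g y))) + real (HT.len (coc ?g y))"
      by (metis of_nat_add of_nat_le_iff)
    also have "\<dots> \<le> t * real (length (s # ws))" using no by (simp add: algebra_simps)
    finally show False using y by simp
  qed
  then have "emeasure M {y \<in> X. t * real (length (s # ws)) < real (HT.len (coc (GS.word (s # ws)) y))}
      \<le> emeasure M (?W \<union> ?I)" using W I by (intro emeasure_mono) auto
  also have "\<dots> \<le> emeasure M ?W + emeasure M ?I" using W I by (rule emeasure_subadditive)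
  also have "\<dots> \<le> ennreal (real (length ws) * q) + ennreal q"
  proof (rule add_mono)
    show "emeasure M ?W \<le> ennreal (real (length ws) * q)" using Cons by simp
    have "emeasure M ?I \<le> emeasure M ?B" by (rule emeasure_induced_vimage[OF g B]) auto
    then show "emeasure M ?I \<le> ennreal q" using gen[OF s(1)] by (rule order_trans)
  qed
  also have "\<dots> = ennreal (real (length (s # ws)) * q)"
    using q by (simp add: algebra_simps flip: ennreal_plus)
  finally show ?case .
qed

text \<open>The points at which some group element of length at most \<open>\<rho>\<close> is stretched by more than a factor \<open>t\<close>.\<close>

definition stretched :: "real \<Rightarrow> real \<Rightarrow> 'w set" where
  "stretched t \<rho> = (\<Union>g\<in>{g \<in> carrier G. real (GS.len g) \<le> \<rho>}.
     {y \<in> X. t * real (GS.len g) < real (HT.len (coc g y))})"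

lemma stretched_sets: "stretched t \<rho> \<in> sets M"
  unfolding stretched_def using GS.finite_ball coc_sets by (intro sets.finite_UN) auto

lemma emeasure_stretched:
  assumes t: "0 \<le> t" and q: "0 \<le> q" and \<rho>: "0 \<le> \<rho>"
    and gen: "\<And>s. s \<in> S \<Longrightarrow> emeasure M {y \<in> X. t < real (HT.len (coc s y))} \<le> ennreal q"
  shows "emeasure M (stretched t \<rho>) \<le> ennreal (real (Vol G S \<rho>) * (\<rho> * q))"
proof -
  let ?A = "{g \<in> carrier G. real (GS.len g) \<le> \<rho>}"
  let ?B = "\<lambda>g. {y \<in> X. t * real (GS.len g) < real (HT.len (coc g y))}"
  have "emeasure M (stretched t \<rho>) \<le> (\<Sum>g\<in>?A. emeasure M (?B g))"
    unfolding stretched_def using GS.finite_ball coc_sets by (intro emeasure_subadditive_finite) auto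
  also have "\<dots> \<le> (\<Sum>g\<in>?A. ennreal (\<rho> * q))"
  proof (rule sum_mono)
    fix g assume g: "g \<in> ?A"
    then obtain ws where ws: "length ws = GS.len g" "set ws \<subseteq> S" "GS.word ws = g"
      using GS.geodesic_word[of g] by blast
    have "emeasure M (?B g) \<le> ennreal (real (length ws) * q)"
      using emeasure_coc_word[OF t q gen ws(2)] ws by simp
    also have "\<dots> \<le> ennreal (\<rho> * q)" using ws(1) g q by (intro ennreal_leI mult_right_mono) auto
    finally show "emeasure M (?B g) \<le> ennreal (\<rho> * q)" .
  qed
  also have "\<dots> = ennreal (real (Vol G S \<rho>) * (\<rho> * q))"
    unfolding Vol_def using \<rho> q by (simp add: ennreal_mult ennreal_of_nat_eq_real_of_nat)
  finally show ?thesis .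
qed

end

locale quantitative_coupling =
  a: quantitative_cocycle G S H T M actG actH XH + b: quantitative_cocycle H T G S M actH actG XG
  for G :: "('g, 'm) monoid_scheme" and S :: "'g set" and H :: "('h, 'n) monoid_scheme"
    and T :: "'h set" and M :: "'w measure" and actG :: "'g \<Rightarrow> 'w \<Rightarrow> 'w"
    and actH :: "'h \<Rightarrow> 'w \<Rightarrow> 'w" and XH :: "'w set" and XG :: "'w set"
begin

text \<open>The two inverses turn the left multiplication of the cocycle identity into the right multiplication
  that describes edges of Cayley graphs.\<close>

definition orbit_map :: "'w \<Rightarrow> 'h \<Rightarrow> 'g" where
  "orbit_map x l = inv\<^bsub>G\<^esub> (b.coc (inv\<^bsub>H\<^esub> l) x)"

lemma orbit_map_closed: "x \<in> XG \<Longrightarrow> l \<in> carrier H \<Longrightarrow> orbit_map x l \<in> carrier G"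
  using b.coc_closed[OF a.D.inv_closed b.X_space] by (simp add: orbit_map_def)

text \<open>The displacement is a cocycle value at a generator and at a point moved by the induced action, so its
  distribution does not depend on \<open>l\<close>.\<close>

lemma orbit_map_step:
  assumes x: "x \<in> XG" and l: "l \<in> carrier H" and s: "s \<in> carrier H"
  shows "a.GS.word_dist (orbit_map x l) (orbit_map x (l \<otimes>\<^bsub>H\<^esub> s)) =
    a.GS.len (b.coc (inv\<^bsub>H\<^esub> s) (b.induced (inv\<^bsub>H\<^esub> l) x))"
proof -
  note xs = b.X_space[OF x]
  have ls: "inv\<^bsub>H\<^esub> l \<in> carrier H" "inv\<^bsub>H\<^esub> s \<in> carrier H" using l s by auto
  define g where "g = b.coc (inv\<^bsub>H\<^esub> l) x"
  define k where "k = b.coc (inv\<^bsub>H\<^esub> s) (b.induced (inv\<^bsub>H\<^esub> l) x)"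
  have gk: "g \<in> carrier G" "k \<in> carrier G"
    unfolding g_def k_def using b.coc_closed ls xs b.X_space[OF b.induced_in[OF ls(1) xs]] by auto
  have "b.coc (inv\<^bsub>H\<^esub> (l \<otimes>\<^bsub>H\<^esub> s)) x = k \<otimes>\<^bsub>G\<^esub> g"
    using b.coc_mult[OF ls(2,1) xs] l s by (simp add: a.D.inv_mult_group g_def k_def)
  then have "a.GS.word_dist (orbit_map x l) (orbit_map x (l \<otimes>\<^bsub>H\<^esub> s)) = a.GS.len (g \<otimes>\<^bsub>G\<^esub> (inv\<^bsub>G\<^esub> g \<otimes>\<^bsub>G\<^esub> inv\<^bsub>G\<^esub> k))"
    using gk unfolding orbit_map_def a.GS.word_dist_def by (simp add: g_def[symmetric] a.A.inv_mult_group)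
  also have "g \<otimes>\<^bsub>G\<^esub> (inv\<^bsub>G\<^esub> g \<otimes>\<^bsub>G\<^esub> inv\<^bsub>G\<^esub> k) = inv\<^bsub>G\<^esub> k"
    using gk a.A.m_assoc[of g "inv\<^bsub>G\<^esub> g" "inv\<^bsub>G\<^esub> k"] by simp
  finally show ?thesis using a.GS.len_inv[OF gk(2)] by (simp add: k_def)
qed

text \<open>The points \<open>b.induced (inv l) x\<close> and \<open>b.induced (inv l') x\<close> differ by the commuting actions of an element
  of \<open>G\<close>, the displacement of the images, and of \<open>inv l \<otimes> l'\<close>. Moving both into \<open>XH\<close> by \<open>k\<close> and \<open>k'\<close>
  identifies the second element with a value of the other cocycle. In the application \<open>k\<close> and \<open>k'\<close>
  range over the finite set given by coboundedness.\<close>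

lemma orbit_map_expansion:
  assumes x: "x \<in> XG" and l: "l \<in> carrier H" "l' \<in> carrier H"
    and k: "k \<in> carrier H" "y \<in> XH" "b.induced (inv\<^bsub>H\<^esub> l) x = actH k y"
    and k': "k' \<in> carrier H" "y' \<in> XH" "b.induced (inv\<^bsub>H\<^esub> l') x = actH k' y'"
  shows "a.coc (inv\<^bsub>G\<^esub> (orbit_map x l) \<otimes>\<^bsub>G\<^esub> orbit_map x l') y' =
     inv\<^bsub>H\<^esub> k \<otimes>\<^bsub>H\<^esub> ((inv\<^bsub>H\<^esub> l \<otimes>\<^bsub>H\<^esub> l') \<otimes>\<^bsub>H\<^esub> k')"
proof -
  note xs = b.X_space[OF x]
  have ys: "y \<in> space M" "y' \<in> space M" using k k' a.X_space by auto
  have li: "inv\<^bsub>H\<^esub> l \<in> carrier H" "inv\<^bsub>H\<^esub> l' \<in> carrier H" using l by auto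
  define g where "g = b.coc (inv\<^bsub>H\<^esub> l) x"
  define g' where "g' = b.coc (inv\<^bsub>H\<^esub> l') x"
  have g: "g \<in> carrier G" "g' \<in> carrier G"
    unfolding g_def g'_def using b.coc_closed li xs by auto
  define \<gamma> where "\<gamma> = g \<otimes>\<^bsub>G\<^esub> inv\<^bsub>G\<^esub> g'"
  have \<gamma>: "\<gamma> \<in> carrier G" "inv\<^bsub>G\<^esub> (orbit_map x l) \<otimes>\<^bsub>G\<^esub> orbit_map x l' = \<gamma>"
    using g by (auto simp: \<gamma>_def orbit_map_def g_def g'_def)
  define m where "m = inv\<^bsub>H\<^esub> l \<otimes>\<^bsub>H\<^esub> l'"
  have m: "m \<in> carrier H" using l by (simp add: m_def)
  have lx: "actH (inv\<^bsub>H\<^esub> l) x \<in> space M" "actH (inv\<^bsub>H\<^esub> l') x \<in> space M"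
    using a.D.act_closed li xs by auto
  have ind: "actH k y = actG g (actH (inv\<^bsub>H\<^esub> l) x)" "actH k' y' = actG g' (actH (inv\<^bsub>H\<^esub> l') x)"
    using k(3) k'(3) by (auto simp: b.induced_def g_def g'_def)
  have "actG \<gamma> (actH k' y') = actG g (actH (inv\<^bsub>H\<^esub> l') x)"
    unfolding ind \<gamma>_def using g lx a.A.act_mult a.A.act_closed a.A.act_inv by simp
  moreover have "actH m (actG g (actH (inv\<^bsub>H\<^esub> l') x)) = actG g (actH m (actH (inv\<^bsub>H\<^esub> l') x))"
    using a.commuting[OF g(1) m lx(2)] by simp
  moreover have "actH m (actH (inv\<^bsub>H\<^esub> l') x) = actH (inv\<^bsub>H\<^esub> l) x"
    unfolding m_def using a.D.act_mult[OF li(1) l(2) lx(2)] a.D.act_inv'[OF l(2) xs] by simp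
  ultimately have "actH m (actG \<gamma> (actH k' y')) = actH k y" using ind by simp
  then have key: "actH m (actH k' (actG \<gamma> y')) = actH k y" using a.commuting[OF \<gamma>(1) k'(1) ys(2)] by simp
  have \<gamma>y: "actG \<gamma> y' \<in> space M" using a.A.act_closed \<gamma> ys by blast
  have "actH (inv\<^bsub>H\<^esub> k \<otimes>\<^bsub>H\<^esub> (m \<otimes>\<^bsub>H\<^esub> k')) (actG \<gamma> y') = actH (inv\<^bsub>H\<^esub> k) (actH m (actH k' (actG \<gamma> y')))"
    using a.D.act_mult k k' m \<gamma>y a.D.act_closed by simp
  also have "\<dots> = y" unfolding key using a.D.act_inv[OF k(1) ys(1)] .
  finally have "a.coc \<gamma> y' = inv\<^bsub>H\<^esub> k \<otimes>\<^bsub>H\<^esub> (m \<otimes>\<^bsub>H\<^esub> k')"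
    using k k' m by (intro a.coc_eqI[OF \<gamma>(1) ys(2)]) auto
  then show ?thesis using \<gamma>(2) by (simp add: m_def)
qed

text \<open>A union bound: \<open>p\<close> for each step of the walk to be mapped to a long jump, and for each vertex of the
  walk and each of the finitely many translates of \<open>XH\<close> covering \<open>XG\<close>, the measure of the stretched set.
  If these do not exhaust \<open>XG\<close>, the orbit map of a remaining point has both properties.\<close>

lemma coarse_embedding_exists:
  assumes walk: "a.HT.walk w N"
    and J: "0 \<le> J" and p: "0 \<le> p"
      "\<And>s. s \<in> T \<Longrightarrow> emeasure M {x \<in> XG. J < real (a.GS.len (b.coc s x))} \<le> ennreal p"
    and t: "0 \<le> t" and q: "0 \<le> q"
      "\<And>s. s \<in> S \<Longrightarrow> emeasure M {y \<in> XH. t < real (a.HT.len (a.coc s y))} \<le> ennreal q"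
    and F: "finite F" "F \<subseteq> carrier H" "XG \<subseteq> (\<Union>h\<in>F. actH h ` XH)" "\<And>k. k \<in> F \<Longrightarrow> real (a.HT.len k) \<le> C"
    and \<rho>: "0 \<le> \<rho>"
    and small: "ennreal (real N * p + real (Suc N) * (real (card F) * (real (Vol G S \<rho>) * (\<rho> * q))))
        < emeasure M XG"
  shows "\<exists>f. (\<forall>l\<in>carrier H. f l \<in> carrier G) \<and>
    (\<forall>i<N. real (a.GS.word_dist (f (w i)) (f (w (Suc i)))) \<le> J) \<and>
    (\<forall>i\<le>N. \<forall>j\<le>N. real (a.GS.word_dist (f (w i)) (f (w j))) \<le> \<rho> \<longrightarrow>
       real (a.HT.word_dist (w i) (w j)) \<le> t * real (a.GS.word_dist (f (w i)) (f (w j))) + 2 * C)"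
proof -
  have wc: "w i \<in> carrier H" if "i \<le> N" for i using walk that by (simp add: a.HT.walk_def)
  have "\<exists>s. i < N \<longrightarrow> s \<in> insert \<one>\<^bsub>H\<^esub> T \<and> w (Suc i) = w i \<otimes>\<^bsub>H\<^esub> s" for i
    using walk unfolding a.HT.walk_def by blast
  then obtain s where s: "\<And>i. i < N \<Longrightarrow> s i \<in> insert \<one>\<^bsub>H\<^esub> T"
      "\<And>i. i < N \<Longrightarrow> w (Suc i) = w i \<otimes>\<^bsub>H\<^esub> s i" by metis
  have sc: "s i \<in> carrier H" if "i < N" for i using s(1)[OF that] a.HT.S_closed by auto
  \<comment> \<open>\<open>E1 i\<close>: the step at time \<open>i\<close> is mapped to a long jump.
    \<open>E2 i\<close>: the point at time \<open>i\<close> is in a translate of the stretched set.\<close>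
  define B1 where "B1 i = {x \<in> XG. J < real (a.GS.len (b.coc (inv\<^bsub>H\<^esub> (s i)) x))}" for i
  define B2 where "B2 = (\<Union>k\<in>F. XG \<inter> actH k ` a.stretched t \<rho>)"
  define E1 where "E1 i = {x \<in> XG. b.induced (inv\<^bsub>H\<^esub> (w i)) x \<in> B1 i}" for i
  define E2 where "E2 i = {x \<in> XG. b.induced (inv\<^bsub>H\<^esub> (w i)) x \<in> B2}" for i
  let ?V = "real (Vol G S \<rho>) * (\<rho> * q)"
  have V: "0 \<le> ?V" using \<rho> q by simp
  have B1: "B1 i \<in> sets M" "emeasure M (B1 i) \<le> ennreal p" "B1 i \<subseteq> XG" if i: "i < N" for i
  proof -
    show "B1 i \<in> sets M" unfolding B1_def by (rule b.coc_sets) (use sc[OF i] in simp)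
    show "emeasure M (B1 i) \<le> ennreal p"
    proof (cases "s i = \<one>\<^bsub>H\<^esub>")
      case True
      then have "B1 i = {}" unfolding B1_def using b.coc_one a.GS.len_one J by auto
      then show ?thesis by simp
    next
      case False
      then show ?thesis unfolding B1_def using s(1)[OF i] a.HT.S_inv[of "s i"] p(2) by blast
    qed
  qed (auto simp: B1_def)
  have st: "a.stretched t \<rho> \<subseteq> space M" using sets.sets_into_space[OF a.stretched_sets] .
  have im: "XG \<inter> actH k ` a.stretched t \<rho> \<in> sets M"
      "emeasure M (XG \<inter> actH k ` a.stretched t \<rho>) \<le> ennreal ?V" if k: "k \<in> carrier H" for k
  proof -
    have eq: "actH k ` a.stretched t \<rho> = actH (inv\<^bsub>H\<^esub> k) -` a.stretched t \<rho> \<inter> space M"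
      by (rule a.D.act_image_eq_vimage[OF k st])
    have k': "inv\<^bsub>H\<^esub> k \<in> carrier H" using k by simp
    have sets: "actH k ` a.stretched t \<rho> \<in> sets M"
      unfolding eq by (rule a.D.sets_act_vimage[OF k' a.stretched_sets])
    then show "XG \<inter> actH k ` a.stretched t \<rho> \<in> sets M" using b.X_sets by simp
    have "emeasure M (XG \<inter> actH k ` a.stretched t \<rho>) \<le> emeasure M (actH k ` a.stretched t \<rho>)"
      using sets by (intro emeasure_mono) auto
    also have "\<dots> = emeasure M (a.stretched t \<rho>)"
      unfolding eq by (rule a.D.emeasure_act_vimage[OF k' a.stretched_sets])
    also have "\<dots> \<le> ennreal ?V" by (rule a.emeasure_stretched[OF t q(1) \<rho> q(2)])
    finally show "emeasure M (XG \<inter> actH k ` a.stretched t \<rho>) \<le> ennreal ?V" .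
  qed
  have B2: "B2 \<in> sets M" "B2 \<subseteq> XG"
    unfolding B2_def using F(2) im(1) by (intro sets.finite_UN[OF F(1)]) auto
  have "emeasure M B2 \<le> (\<Sum>k\<in>F. emeasure M (XG \<inter> actH k ` a.stretched t \<rho>))"
    unfolding B2_def using F im by (intro emeasure_subadditive_finite) auto
  also have "\<dots> \<le> (\<Sum>k\<in>F. ennreal ?V)" using F im by (intro sum_mono) auto
  also have "\<dots> = ennreal (real (card F) * ?V)"
    using V by (simp add: ennreal_mult ennreal_of_nat_eq_real_of_nat)
  finally have B2m: "emeasure M B2 \<le> ennreal (real (card F) * ?V)" .
  have E1: "E1 i \<in> sets M" "emeasure M (E1 i) \<le> ennreal p" if i: "i < N" for i
    unfolding E1_def using b.induced_vimage_sets[OF a.D.inv_closed[OF wc] B1(1,3)]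
      order_trans[OF b.emeasure_induced_vimage[OF a.D.inv_closed[OF wc] B1(1,3)] B1(2)] i by auto
  have E2: "E2 i \<in> sets M" "emeasure M (E2 i) \<le> ennreal (real (card F) * ?V)" if i: "i \<le> N" for i
    unfolding E2_def using b.induced_vimage_sets[OF a.D.inv_closed[OF wc] B2]
      order_trans[OF b.emeasure_induced_vimage[OF a.D.inv_closed[OF wc] B2] B2m] i by auto
  let ?U1 = "\<Union>i\<in>{..<N}. E1 i" and ?U2 = "\<Union>i\<in>{..N}. E2 i"
  have U: "?U1 \<in> sets M" "?U2 \<in> sets M" using E1 E2 by (auto intro!: sets.finite_UN)
  have U1: "emeasure M ?U1 \<le> ennreal (real N * p)"
  proof -
    have "emeasure M ?U1 \<le> (\<Sum>i\<in>{..<N}. emeasure M (E1 i))"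
      using E1 by (intro emeasure_subadditive_finite) auto
    also have "\<dots> \<le> (\<Sum>i\<in>{..<N}. ennreal p)" using E1 by (intro sum_mono) auto
    finally show ?thesis using p by (simp add: ennreal_mult ennreal_of_nat_eq_real_of_nat)
  qed
  have U2: "emeasure M ?U2 \<le> ennreal (real (Suc N) * (real (card F) * ?V))"
  proof -
    have "emeasure M ?U2 \<le> (\<Sum>i\<in>{..N}. emeasure M (E2 i))"
      using E2 by (intro emeasure_subadditive_finite) auto
    also have "\<dots> \<le> (\<Sum>i\<in>{..N}. ennreal (real (card F) * ?V))" using E2 by (intro sum_mono) auto
    also have "\<dots> = of_nat (Suc N) * ennreal (real (card F) * ?V)" by simp
    also have "\<dots> = ennreal (real (Suc N) * (real (card F) * ?V))"
      using V by (subst ennreal_mult) (auto simp only: ennreal_of_nat_eq_real_of_nat of_nat_0_le_iff mult_nonneg_nonneg)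
    finally show ?thesis .
  qed
  have "emeasure M (?U1 \<union> ?U2) \<le> emeasure M ?U1 + emeasure M ?U2" using U by (rule emeasure_subadditive)
  also have "\<dots> \<le> ennreal (real N * p) + ennreal (real (Suc N) * (real (card F) * ?V))"
    by (rule add_mono[OF U1 U2])
  also have "\<dots> = ennreal (real N * p + real (Suc N) * (real (card F) * ?V))"
    using p V by (subst ennreal_plus) (auto simp del: of_nat_Suc)
  finally have "emeasure M (?U1 \<union> ?U2) < emeasure M XG" using small by (rule le_less_trans)
  then have "\<not> XG \<subseteq> ?U1 \<union> ?U2" using emeasure_mono[of XG "?U1 \<union> ?U2" M] U by auto
  then obtain x where x: "x \<in> XG" "x \<notin> ?U1" "x \<notin> ?U2" by blast
  note xs = b.X_space[OF x(1)]
  let ?f = "orbit_map x"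
  have "real (a.GS.word_dist (?f (w i)) (?f (w (Suc i)))) \<le> J" if i: "i < N" for i
  proof -
    have "x \<notin> E1 i" using x(2) i by blast
    then have "b.induced (inv\<^bsub>H\<^esub> (w i)) x \<notin> B1 i" using x(1) unfolding E1_def by simp
    moreover have "b.induced (inv\<^bsub>H\<^esub> (w i)) x \<in> XG" using b.induced_in xs wc i by simp
    ultimately show ?thesis using orbit_map_step[OF x(1) wc sc[OF i], of i] i s(2)[OF i]
      unfolding B1_def by simp
  qed
  moreover have "real (a.HT.word_dist (w i) (w j)) \<le> t * real (a.GS.word_dist (?f (w i)) (?f (w j))) + 2 * C"
    if i: "i \<le> N" and j: "j \<le> N" and le: "real (a.GS.word_dist (?f (w i)) (?f (w j))) \<le> \<rho>" for i j
  proof -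
    have shift: "\<exists>k y. k \<in> F \<and> y \<in> XH \<and> b.induced (inv\<^bsub>H\<^esub> (w i)) x = actH k y \<and> y \<notin> a.stretched t \<rho>"
      if i: "i \<le> N" for i
    proof -
      have "x \<notin> E2 i" using x(3) i by blast
      then have n: "b.induced (inv\<^bsub>H\<^esub> (w i)) x \<notin> B2" using x(1) by (simp add: E2_def)
      have XG: "b.induced (inv\<^bsub>H\<^esub> (w i)) x \<in> XG" using b.induced_in xs wc i by simp
      then obtain k y where "k \<in> F" "y \<in> XH" "b.induced (inv\<^bsub>H\<^esub> (w i)) x = actH k y" using F(3) by blast
      then show ?thesis using n XG unfolding B2_def by blast
    qed
    obtain k y where k: "k \<in> F" "y \<in> XH" "b.induced (inv\<^bsub>H\<^esub> (w i)) x = actH k y"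
      using shift[OF i] by blast
    obtain k' y' where k': "k' \<in> F" "y' \<in> XH" "b.induced (inv\<^bsub>H\<^esub> (w j)) x = actH k' y'"
        "y' \<notin> a.stretched t \<rho>" using shift[OF j] by blast
    have kc: "k \<in> carrier H" "k' \<in> carrier H" using k k' F by auto
    let ?\<gamma> = "inv\<^bsub>G\<^esub> (?f (w i)) \<otimes>\<^bsub>G\<^esub> ?f (w j)" and ?m = "inv\<^bsub>H\<^esub> (w i) \<otimes>\<^bsub>H\<^esub> w j"
    have c: "?\<gamma> \<in> carrier G" "?m \<in> carrier H" using orbit_map_closed[OF x(1)] wc i j by auto
    have coc: "a.coc ?\<gamma> y' = inv\<^bsub>H\<^esub> k \<otimes>\<^bsub>H\<^esub> (?m \<otimes>\<^bsub>H\<^esub> k')"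
      by (rule orbit_map_expansion[OF x(1) wc[OF i] wc[OF j] kc(1) k(2,3) kc(2) k'(2,3)])
    have "real (a.HT.len (a.coc ?\<gamma> y')) \<le> t * real (a.GS.len ?\<gamma>)"
      using k'(2,4) c(1) le unfolding a.stretched_def a.GS.word_dist_def by force
    moreover have "?m = k \<otimes>\<^bsub>H\<^esub> (a.coc ?\<gamma> y' \<otimes>\<^bsub>H\<^esub> inv\<^bsub>H\<^esub> k')"
      unfolding coc using kc c a.D.m_assoc[of k "inv\<^bsub>H\<^esub> k" ?m] by (simp add: a.D.m_assoc)
    moreover have "a.coc ?\<gamma> y' \<in> carrier H" unfolding coc using kc c by simp
    ultimately have "real (a.HT.len ?m) \<le> real (a.HT.len k) + (t * real (a.GS.len ?\<gamma>) + real (a.HT.len k'))"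
      using a.HT.len_mult_le[of k "a.coc ?\<gamma> y' \<otimes>\<^bsub>H\<^esub> inv\<^bsub>H\<^esub> k'"]
        a.HT.len_mult_le[of "a.coc ?\<gamma> y'" "inv\<^bsub>H\<^esub> k'"] a.HT.len_inv[OF kc(2)] kc by simp
    then show ?thesis using F(4)[OF k(1)] F(4)[OF k'(1)] unfolding a.HT.word_dist_def a.GS.word_dist_def by linarith
  qed
  ultimately show ?thesis using orbit_map_closed[OF x(1)] by (intro exI[of _ ?f]) blast
qed

end

section \<open>Choosing the scales\<close>

lemma gen_inverse_nonneg:
  assumes "rate_function \<psi>" shows "0 \<le> gen_inverse \<psi> y"
proof -
  have "\<exists>s\<ge>0. y \<le> \<psi> s"
  proof (rule ccontr)
    assume "\<not> (\<exists>s\<ge>0. y \<le> \<psi> s)"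
    then have "bdd_above (\<psi> ` {0..})" by (intro bdd_aboveI[of _ y]) force
    then show False using assms by (simp add: rate_function_def)
  qed
  then show ?thesis unfolding gen_inverse_def by (intro cInf_greatest) auto
qed

lemma gen_inverse_less:
  assumes \<psi>: "rate_function \<psi>" and s: "gen_inverse \<psi> y < s" shows "y \<le> \<psi> s"
proof -
  have ne: "{s. 0 \<le> s \<and> y \<le> \<psi> s} \<noteq> {}"
  proof
    assume "{s. 0 \<le> s \<and> y \<le> \<psi> s} = {}"
    then have "bdd_above (\<psi> ` {0..})" by (intro bdd_aboveI[of _ y]) force
    then show False using \<psi> by (simp add: rate_function_def)
  qed
  then obtain u where u: "0 \<le> u" "y \<le> \<psi> u" "u < s"
    using s cInf_lessD[OF ne] unfolding gen_inverse_def by blast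
  have "\<psi> u \<le> \<psi> s" using \<psi> u unfolding rate_function_def by (auto intro: mono_onD)
  then show ?thesis using u by simp
qed

context quantitative_coupling
begin

text \<open>The map \<open>f\<close> may depend on the walk, which is fixed before a point of the coupling is chosen.\<close>

definition coarsely_embeds :: "real \<Rightarrow> real \<Rightarrow> real \<Rightarrow> real \<Rightarrow> bool" where
  "coarsely_embeds m J \<rho> D \<longleftrightarrow> (\<forall>w N. a.HT.walk w N \<and> real N \<le> m \<longrightarrow>
     (\<exists>f. (\<forall>l\<in>carrier H. f l \<in> carrier G) \<and>
       (\<forall>i<N. real (a.GS.word_dist (f (w i)) (f (w (Suc i)))) \<le> J) \<and>
       (\<forall>i\<le>N. \<forall>j\<le>N. real (a.GS.word_dist (f (w i)) (f (w j))) \<le> \<rho> \<longrightarrow> real (a.HT.word_dist (w i) (w j)) \<le> D)))"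

text \<open>The factor \<open>5 / 2\<close> may be anything below 3: each step is bad with probability at most \<open>1 / (3 n)\<close>, so
  with \<open>5 n / 2\<close> steps a probability of \<open>1 / 6\<close> remains, against a stretched set whose total
  contribution tends to 0.\<close>

lemma eventually_coarsely_embeds:
  fixes \<phi> \<psi> r :: "real \<Rightarrow> real" and L :: real
  assumes L: "1 \<le> L" and \<phi>: "rate_function \<phi>" and \<psi>: "rate_function \<psi>" and r: "rate_function r"
    and pos: "eventually (\<lambda>n::nat. \<phi> (real n / r (real n)) > 0) sequentially"
    and lim: "(\<lambda>n::nat. (real n)\<^sup>2 * r (real n) * real (Vol G S (r (real n)))
            / \<phi> (real n / r (real n))) \<longlonglongrightarrow> 0"
    and cob: "cobounded H actH XG XH" and norm: "emeasure M XG = 1"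
    and int_\<phi>: "\<And>s. s \<in> S \<Longrightarrow>
           (\<integral>\<^sup>+x\<in>XH. ennreal (\<phi> (real (a.HT.len (a.coc s x)))) \<partial>M) < \<infinity>"
    and int_\<psi>: "\<And>t. t \<in> T \<Longrightarrow>
           (\<integral>\<^sup>+x\<in>XG. ennreal (\<psi> (real (a.GS.len (b.coc t x)))) \<partial>M) \<le> ennreal L"
  shows "\<exists>C\<ge>0. eventually (\<lambda>n::nat. coarsely_embeds (5 / 2 * real n) (gen_inverse \<psi> (3 * L * real n))
            (r (real n) / 30) (real n / 30 + C)) sequentially"
proof -
  obtain F where F: "finite F" "F \<subseteq> carrier H" "XG \<subseteq> (\<Union>h\<in>F. actH h ` XH)"
    using cob unfolding cobounded_def by blast
  define C where "C = (\<Sum>k\<in>F. real (a.HT.len k))"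
  have C: "real (a.HT.len k) \<le> C" if "k \<in> F" for k
    unfolding C_def using F that by (auto intro!: member_le_sum)
  have C0: "0 \<le> C" unfolding C_def by (intro sum_nonneg) simp
  define I where "I s = enn2real (\<integral>\<^sup>+x\<in>XH. ennreal (\<phi> (real (a.HT.len (a.coc s x)))) \<partial>M)" for s
  define K where "K = (\<Sum>s\<in>S. I s)"
  have K0: "0 \<le> K" unfolding K_def I_def by (intro sum_nonneg) simp
  have K: "(\<integral>\<^sup>+x\<in>XH. ennreal (\<phi> (real (a.HT.len (a.coc s x)))) \<partial>M) \<le> ennreal K" if s: "s \<in> S" for s
  proof -
    have "(\<integral>\<^sup>+x\<in>XH. ennreal (\<phi> (real (a.HT.len (a.coc s x)))) \<partial>M) = ennreal (I s)"
      unfolding I_def using int_\<phi>[OF s] by (simp add: ennreal_enn2real_if)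
    also have "\<dots> \<le> ennreal K"
      unfolding K_def using a.GS.S_finite s by (intro ennreal_leI member_le_sum) (auto simp: I_def)
    finally show ?thesis .
  qed
  let ?X = "\<lambda>n::nat. (real n)\<^sup>2 * r (real n) * real (Vol G S (r (real n))) / \<phi> (real n / r (real n))"
  have "(\<lambda>n. ?X n * (4 * real (card F) * K)) \<longlonglongrightarrow> 0 * (4 * real (card F) * K)"
    by (intro tendsto_intros lim)
  then have "eventually (\<lambda>n. ?X n * (4 * real (card F) * K) < 1 / 6) sequentially"
    by (intro order_tendstoD(2)) auto
  with pos have "eventually (\<lambda>n::nat. coarsely_embeds (5 / 2 * real n) (gen_inverse \<psi> (3 * L * real n))
            (r (real n) / 30) (real n / 30 + 2 * C)) sequentially"
    using eventually_ge_at_top[of 1]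
  proof eventually_elim
    case (elim n)
    define t where "t = real n / r (real n)"
    define \<rho> where "\<rho> = r (real n) / 30"
    define J where "J = gen_inverse \<psi> (3 * L * real n)"
    define p where "p = 1 / (3 * real n)"
    define q where "q = K / \<phi> t"
    have n: "1 \<le> real n" and \<phi>t: "0 < \<phi> t" using elim by (auto simp: t_def)
    have rn: "0 \<le> r (real n)" using r unfolding rate_function_def by (auto simp: image_subset_iff)
    have nn: "0 \<le> t" "0 \<le> \<rho>" "0 \<le> J" "0 \<le> p" "0 \<le> q"
      using rn \<phi>t K0 gen_inverse_nonneg[OF \<psi>] by (auto simp: t_def \<rho>_def J_def p_def q_def)
    have p: "emeasure M {x \<in> XG. J < real (a.GS.len (b.coc s x))} \<le> ennreal p" if s: "s \<in> T" for s
    proof -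
      have "emeasure M {x \<in> XG. J < real (a.GS.len (b.coc s x))} \<le> ennreal (L / (3 * L * real n))"
        by (rule b.emeasure_coc_markov[where \<phi> = \<psi> and len = "\<lambda>g. real (a.GS.len g)"])
          (use s a.HT.S_closed L n int_\<psi> gen_inverse_less[OF \<psi>] in \<open>auto simp: J_def\<close>)
      then show ?thesis using L by (simp add: p_def)
    qed
    have q: "emeasure M {y \<in> XH. t < real (a.HT.len (a.coc s y))} \<le> ennreal q" if s: "s \<in> S" for s
    proof -
      have "\<phi> t \<le> \<phi> u" if "t < u" for u
        using \<phi> that nn(1) unfolding rate_function_def by (auto intro: mono_onD)
      then show ?thesis unfolding q_def
        by (intro a.emeasure_coc_markov[where \<phi> = \<phi> and len = "\<lambda>h. real (a.HT.len h)"])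
          (use s a.GS.S_closed \<phi>t K0 K in auto)
    qed
    show ?case unfolding coarsely_embeds_def
    proof (intro allI impI, elim conjE)
      fix w N assume w: "a.HT.walk w N" and N: "real N \<le> 5 / 2 * real n"
      have Np: "real N * p \<le> 5 / 6" using N n by (simp add: p_def field_simps)
      have "real (Suc N) \<le> 4 * real n" using N n by simp
      also have "\<dots> \<le> 4 * (real n)\<^sup>2" using n by (simp add: power2_eq_square)
      finally have N4: "real (Suc N) \<le> 4 * (real n)\<^sup>2" .
      have "{g \<in> carrier G. real (a.GS.len g) \<le> \<rho>} \<subseteq> {g \<in> carrier G. real (a.GS.len g) \<le> r (real n)}"
        using rn by (auto simp: \<rho>_def)
      then have V: "real (Vol G S \<rho>) \<le> real (Vol G S (r (real n)))"
        unfolding Vol_def using card_mono[OF a.GS.finite_ball] by simp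
      have "real (Suc N) * (real (card F) * (real (Vol G S \<rho>) * (\<rho> * q)))
          \<le> 4 * (real n)\<^sup>2 * (real (card F) * (real (Vol G S (r (real n))) * (r (real n) * q)))"
        using N4 V nn rn by (intro mult_mono mult_nonneg_nonneg order_refl) (auto simp: \<rho>_def)
      also have "\<dots> = ?X n * (4 * real (card F) * K)" by (simp add: q_def t_def)
      also have "\<dots> < 1 / 6" by (rule elim(2))
      finally have lt: "real N * p + real (Suc N) * (real (card F) * (real (Vol G S \<rho>) * (\<rho> * q))) < 1"
        using Np by linarith
      have small: "ennreal (real N * p + real (Suc N) * (real (card F) * (real (Vol G S \<rho>) * (\<rho> * q)))) < emeasure M XG"
        unfolding norm using lt by (simp only: ennreal_less_one_iff)
      obtain f where f: "\<forall>l\<in>carrier H. f l \<in> carrier G"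
        "\<forall>i<N. real (a.GS.word_dist (f (w i)) (f (w (Suc i)))) \<le> J"
        "\<forall>i\<le>N. \<forall>j\<le>N. real (a.GS.word_dist (f (w i)) (f (w j))) \<le> \<rho> \<longrightarrow>
           real (a.HT.word_dist (w i) (w j)) \<le> t * real (a.GS.word_dist (f (w i)) (f (w j))) + 2 * C"
        using coarse_embedding_exists[OF w nn(3,4) p nn(1,5) q F C nn(2) small] by blast
      have scale: "t * x \<le> real n / 30" if "x \<le> \<rho>" for x
      proof -
        have "t * x \<le> t * \<rho>" using that nn(1) by (rule mult_left_mono)
        also have "\<dots> \<le> real n / 30" using rn by (simp add: t_def \<rho>_def)
        finally show ?thesis .
      qed
      have "real (a.HT.word_dist (w i) (w j)) \<le> real n / 30 + 2 * C"
        if "i \<le> N" "j \<le> N" "real (a.GS.word_dist (f (w i)) (f (w j))) \<le> r (real n) / 30" for i j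
      proof -
        have "real (a.HT.word_dist (w i) (w j)) \<le> t * real (a.GS.word_dist (f (w i)) (f (w j))) + 2 * C"
          using f(3)[rule_format, of i j] that by (simp add: \<rho>_def)
        then show ?thesis using scale[of "real (a.GS.word_dist (f (w i)) (f (w j)))"] that
          by (simp add: \<rho>_def)
      qed
      then show "\<exists>f. (\<forall>l\<in>carrier H. f l \<in> carrier G) \<and>
          (\<forall>i<N. real (a.GS.word_dist (f (w i)) (f (w (Suc i)))) \<le> gen_inverse \<psi> (3 * L * real n)) \<and>
          (\<forall>i\<le>N. \<forall>j\<le>N. real (a.GS.word_dist (f (w i)) (f (w j))) \<le> r (real n) / 30 \<longrightarrow>
             real (a.HT.word_dist (w i) (w j)) \<le> real n / 30 + 2 * C)"
        using f(1,2) unfolding J_def by (intro exI[of _ f]) simp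
    qed
  qed
  then show ?thesis using C0 by (intro exI[of _ "2 * C"]) simp
qed

section \<open>Loops, hexagons and the theorem\<close>

text \<open>The loop consists of \<open>v\<close> followed by \<open>u\<close>; its image in the Cayley graph of \<open>G\<close> is a bigon of chains once
  \<open>u\<close> is reversed. The hypothesis \<open>scale\<close> leaves \<open>2.4 (\<delta> + 1) log n\<close> for the logarithmic error
  \<open>(2 e + 2) \<delta> + 1\<close>, where \<open>e\<close> is at most \<open>log n + 3\<close>; the surplus \<open>0.4 \<delta> log n\<close> absorbs \<open>8 \<delta>\<close> as soon
  as \<open>log n \<ge> 20\<close>.\<close>

lemma loop_coincidence:
  assumes hyp: "hyperbolic_group_with \<delta> G S" and J: "0 \<le> J"
    and emb: "coarsely_embeds (5 / 2 * n) J \<rho> D"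
    and n: "2 ^ 20 \<le> n" and scale: "4 * (\<delta> + 1) * log 2 n + 3 * J \<le> 5 / 3 * \<rho>"
    and v: "a.HT.walk v K" and u: "a.HT.walk u K'" and ends: "v K = u 0" "u K' = v 0"
    and len: "real K + real K' \<le> 5 / 2 * n" and i: "i \<le> K"
  shows "\<exists>i1 i2 j. i1 \<le> i \<and> i \<le> i2 \<and> i2 \<le> K \<and> j \<le> K' \<and>
    real (a.HT.word_dist (v i1) (v i2)) \<le> D \<and> real (a.HT.word_dist (v i1) (u j)) \<le> D"
proof -
  have hyp': "hyperbolic_with \<delta> a.GS.cay.R a.GS.cay.dist"
    using hyp by (simp add: hyperbolic_group_with_def)
  then have \<delta>: "0 \<le> \<delta>" by (simp add: hyperbolic_with_def)
  define w where "w i = (if i \<le> K then v i else u (i - K))" for i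
  have wv: "w i = v i" if "i \<le> K" for i using that by (simp add: w_def)
  have wu: "w (K + j) = u j" for j using ends by (simp add: w_def)
  have w: "a.HT.walk w (K + K')" unfolding w_def by (rule a.HT.walk_append[OF v u ends(1)])
  have "\<exists>f. (\<forall>l\<in>carrier H. f l \<in> carrier G) \<and>
       (\<forall>i<K + K'. real (a.GS.word_dist (f (w i)) (f (w (Suc i)))) \<le> J) \<and>
       (\<forall>i\<le>K + K'. \<forall>j\<le>K + K'. real (a.GS.word_dist (f (w i)) (f (w j))) \<le> \<rho> \<longrightarrow>
          real (a.HT.word_dist (w i) (w j)) \<le> D)"
    using emb[unfolded coarsely_embeds_def, rule_format, of w "K + K'"] w len by simp
  then obtain f where f: "\<And>l. l \<in> carrier H \<Longrightarrow> f l \<in> carrier G"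
    "\<And>i. i < K + K' \<Longrightarrow> real (a.GS.word_dist (f (w i)) (f (w (Suc i)))) \<le> J"
    "\<And>i j. i \<le> K + K' \<Longrightarrow> j \<le> K + K' \<Longrightarrow> real (a.GS.word_dist (f (w i)) (f (w j))) \<le> \<rho> \<Longrightarrow>
       real (a.HT.word_dist (w i) (w j)) \<le> D"
    by blast
  have wc: "f (w i) \<in> carrier G" if "i \<le> K + K'" for i
    using w that f(1) by (simp add: a.HT.walk_def)
  define e where "e = nat \<lceil>log 2 n\<rceil> + 2"
  have n0: "0 < n" using n by (meson less_le_trans zero_less_numeral zero_less_power)
  have log20: "20 \<le> log 2 n" using n n0 by (simp add: le_log_iff)
  have e: "real e \<le> log 2 n + 3" "log 2 n + 2 \<le> real e" using log20 unfolding e_def by linarith+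
  have "4 * n = 2 powr (log 2 n + 2)" using n0 by (simp add: powr_add)
  also have "\<dots> \<le> 2 powr real e" using e by simp
  also have "\<dots> = real (2 ^ e)" by (simp add: powr_realpow)
  finally have "real K \<le> real (2 ^ e)" "real K' \<le> real (2 ^ e)" using len n0 by linarith+
  then have K2: "K \<le> 2 ^ e" "K' \<le> 2 ^ e" by (simp_all only: of_nat_le_iff)
  define R where "R = J + (2 * real e + 2) * \<delta> + 1"
  have R\<rho>: "R \<le> \<rho>"
  proof -
    have "(2 * real e + 2) * \<delta> \<le> (2 * log 2 n + 8) * \<delta>" using e \<delta> by (intro mult_right_mono) auto
    moreover have "20 * \<delta> \<le> log 2 n * \<delta>" using log20 \<delta> by (rule mult_right_mono)
    moreover have "4 * (\<delta> + 1) * log 2 n = 4 * (log 2 n * \<delta>) + 4 * log 2 n" by (simp add: algebra_simps)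
    moreover have "(2 * log 2 n + 8) * \<delta> = 2 * (log 2 n * \<delta>) + 8 * \<delta>" by (simp add: algebra_simps)
    ultimately show ?thesis using scale log20 J unfolding R_def by linarith
  qed
  define V where "V i = vertex (f (w i))" for i
  define U where "U j = vertex (f (w (K + (K' - j))))" for j
  have dist: "a.GS.cay.dist (vertex (f (w i))) (vertex (f (w j))) = real (a.GS.word_dist (f (w i)) (f (w j)))"
    if "i \<le> K + K'" "j \<le> K + K'" for i j using a.GS.cay.path_metric_vertex wc that by blast
  have "\<exists>i1 i2 j. i1 \<le> i \<and> i \<le> i2 \<and> i2 \<le> K \<and> j \<le> K' \<and>
      a.GS.cay.dist (V i1) (V i2) \<le> J + (2 * real e + 2) * \<delta> + 1 \<and>
      a.GS.cay.dist (V i1) (U j) \<le> J + (2 * real e + 2) * \<delta> + 1"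
  proof (rule a.GS.cay_metric.hyperbolic_bigon_coincidence[OF hyp' J K2])
    show "V i \<in> a.GS.cay.R" if "i \<le> K" for i
      unfolding V_def by (rule vertex_in_realization) (use wc that in simp)
    show "U i \<in> a.GS.cay.R" if "i \<le> K'" for i
      unfolding U_def by (rule vertex_in_realization) (use wc that in simp)
    show "a.GS.cay.dist (V i) (V (Suc i)) \<le> J" if "i < K" for i
      unfolding V_def using dist[of i "Suc i"] f(2)[of i] that by simp
    show "a.GS.cay.dist (U j) (U (Suc j)) \<le> J" if j: "j < K'" for j
    proof -
      define l where "l = K + (K' - Suc j)"
      have "K + (K' - j) = Suc l" "l < K + K'" using j by (auto simp: l_def)
      then show ?thesis unfolding U_def using dist[of l "Suc l"] f(2)[of l]
        a.GS.cay.path_metric_sym[of "vertex (f (w (Suc l)))"]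
        by (simp add: l_def[symmetric])
    qed
    show "U 0 = V 0" using wu[of K'] wv[of 0] ends by (simp add: U_def V_def)
    show "U K' = V K" by (simp add: U_def V_def)
  qed (rule i)
  then obtain i1 i2 j where ij: "i1 \<le> i" "i \<le> i2" "i2 \<le> K" "j \<le> K'"
      "a.GS.cay.dist (V i1) (V i2) \<le> \<rho>" "a.GS.cay.dist (V i1) (U j) \<le> \<rho>"
    using R\<rho> unfolding R_def by (meson order_trans)
  have "real (a.HT.word_dist (w i1) (w i2)) \<le> D"
    using f(3)[of i1 i2] ij dist[of i1 i2] by (simp add: V_def)
  moreover have "real (a.HT.word_dist (w i1) (w (K + (K' - j)))) \<le> D"
    using f(3)[of i1 "K + (K' - j)"] ij dist[of i1 "K + (K' - j)"] by (simp add: V_def U_def)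
  ultimately show ?thesis using ij wv[of i1] wv[of i2] wu[of "K' - j"]
    by (intro exI[of _ i1] exI[of _ i2] exI[of _ "K' - j"]) simp
qed

text \<open>The discretized hexagon has at most \<open>1.1 \<cdot> 30 h + 6 \<cdot> 22 = 33 h + 132\<close> steps, so the scale \<open>m\<close>
  can be taken about \<open>(2 / 5) \<cdot> 33 h = 13.2 h\<close>. A coincidence at distance \<open>D = m / 30 + C\<close> between times
  \<open>i1\<close> and \<open>i2\<close> on the geodesic side means that all times between them, in particular \<open>i\<close>, are within
  about \<open>D\<close> of \<open>i1\<close>, which in turn is within \<open>D\<close> of the other sides. The sum \<open>2 D\<close> is \<open>0.88 h\<close> up to a
  constant.\<close>

lemma thin_hexagons_of_scale:
  fixes r :: "real \<Rightarrow> real" and J :: "nat \<Rightarrow> real"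
  assumes hyp: "hyperbolic_group_with \<delta> G S" and C: "0 \<le> C"
    and n: "n1 \<le> h" "2 ^ 20 \<le> h" "100 * C + 3800 \<le> h"
    and J: "\<And>n::nat. 0 \<le> J n"
    and emb: "\<And>n::nat. n1 \<le> real n \<Longrightarrow> coarsely_embeds (5 / 2 * real n) (J n) (r (real n) / 30) (real n / 30 + C)"
    and scale: "\<And>n::nat. n1 \<le> real n \<Longrightarrow> 4 * (\<delta> + 1) * log 2 (real n) + 3 * J n \<le> r (real n) / 18"
  shows "thin_hexagons a.HT.cay.R a.HT.cay.dist h"
  unfolding thin_hexagons_def
proof (intro allI impI, elim conjE)
  fix a0 a1 a2 a3 a4 a5 I0 I1 I2 I3 I4 I5 p
  let ?seg = "geodesic_segment a.HT.cay.R a.HT.cay.dist" and ?d = a.HT.cay.dist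
  assume I: "?seg a0 a1 I0" "?seg a1 a2 I1" "?seg a2 a3 I2" "?seg a3 a4 I3" "?seg a4 a5 I4" "?seg a5 a0 I5"
    and per: "?d a0 a1 + ?d a1 a2 + ?d a2 a3 + ?d a3 a4 + ?d a4 a5 + ?d a5 a0 \<le> 30 * h"
    and p: "p \<in> I0"
  let ?Q = "I1 \<union> I2 \<union> I3 \<union> I4 \<union> I5"
  have h0: "0 < h" using n(2) by (meson less_le_trans zero_less_numeral zero_less_power)
  note sub = a.HT.cay_metric.geodesic_segment_subset
  have near: "\<exists>v. v \<in> carrier H \<and> ?d x (vertex v) \<le> 1 / 2" if "x \<in> a.HT.cay.R" for x
    using a.HT.cay.near_vertex[OF that] by blast
  obtain b0 where b0: "b0 \<in> carrier H" "?d a0 (vertex b0) \<le> 1 / 2" using near[OF sub(4)[OF I(1)]] by blast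
  obtain b1 where b1: "b1 \<in> carrier H" "?d a1 (vertex b1) \<le> 1 / 2" using near[OF sub(4)[OF I(2)]] by blast
  obtain b2 where b2: "b2 \<in> carrier H" "?d a2 (vertex b2) \<le> 1 / 2" using near[OF sub(4)[OF I(3)]] by blast
  obtain b3 where b3: "b3 \<in> carrier H" "?d a3 (vertex b3) \<le> 1 / 2" using near[OF sub(4)[OF I(4)]] by blast
  obtain b4 where b4: "b4 \<in> carrier H" "?d a4 (vertex b4) \<le> 1 / 2" using near[OF sub(4)[OF I(5)]] by blast
  obtain b5 where b5: "b5 \<in> carrier H" "?d a5 (vertex b5) \<le> 1 / 2" using near[OF sub(4)[OF I(6)]] by blast
  obtain c where c: "geodesic a.HT.cay.R ?d a0 a1 c" "I0 = c ` {0..?d a0 a1}"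
    using I(1) by (auto simp: geodesic_segment_def)
  obtain v K \<tau> where v: "v 0 = b0" "v K = b1" "a.HT.walk v K" "real K \<le> 11 / 10 * ?d a0 a1 + 22"
    "\<forall>i\<le>K. 0 \<le> \<tau> i \<and> \<tau> i \<le> ?d a0 a1 \<and> ?d (vertex (v i)) (c (\<tau> i)) \<le> 12"
    "\<forall>i j. i \<le> j \<and> j \<le> K \<longrightarrow> \<tau> i \<le> \<tau> j"
    "\<forall>t. 0 \<le> t \<and> t \<le> ?d a0 a1 \<longrightarrow> (\<exists>i\<le>K. ?d (c t) (vertex (v i)) \<le> 12)"
    using a.HT.geodesic_discretization[OF c(1) b0 b1] by blast
  have "a.HT.shadow b1 b0 ?Q ((11 / 10 * ?d a1 a2 + 22) + (11 / 10 * ?d a2 a3 + 22) +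
      (11 / 10 * ?d a3 a4 + 22) + (11 / 10 * ?d a4 a5 + 22) + (11 / 10 * ?d a5 a0 + 22))"
    by (intro a.HT.shadow_append[OF _ a.HT.shadow_segment[OF I(6) b5 b0]]
        a.HT.shadow_append[OF _ a.HT.shadow_segment[OF I(5) b4 b5]]
        a.HT.shadow_append[OF _ a.HT.shadow_segment[OF I(4) b3 b4]]
        a.HT.shadow_append[OF _ a.HT.shadow_segment[OF I(3) b2 b3]]
        a.HT.shadow_segment[OF I(2) b1 b2])
  then obtain u K' where u: "u 0 = b1" "u K' = b0" "a.HT.walk u K'"
    "real K' \<le> (11 / 10 * ?d a1 a2 + 22) + (11 / 10 * ?d a2 a3 + 22) +
      (11 / 10 * ?d a3 a4 + 22) + (11 / 10 * ?d a4 a5 + 22) + (11 / 10 * ?d a5 a0 + 22)"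
    "\<forall>j\<le>K'. \<exists>q\<in>?Q. ?d (vertex (u j)) q \<le> 12"
    unfolding a.HT.shadow_def by blast
  have "\<exists>m::nat. x \<le> real m \<and> real m \<le> x + 1" if "0 \<le> x" for x :: real
    using that by (intro exI[of _ "nat \<lceil>x\<rceil>"]) linarith
  from this[of "66 / 5 * h + 53"] obtain m :: nat
    where m: "66 / 5 * h + 53 \<le> real m" "real m \<le> 66 / 5 * h + 54" using h0 by auto
  have "real K + real K' \<le> 11 / 10 * (?d a0 a1 + ?d a1 a2 + ?d a2 a3 + ?d a3 a4 + ?d a4 a5 + ?d a5 a0) + 132"
    using v(4) u(4) by (simp add: algebra_simps)
  also have "\<dots> \<le> 11 / 10 * (30 * h) + 132" using per by simp
  also have "\<dots> \<le> 5 / 2 * real m" using m(1) by simp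
  finally have len: "real K + real K' \<le> 5 / 2 * real m" .
  have hm: "h \<le> real m" using m(1) h0 by linarith
  then have m1: "n1 \<le> real m" "2 ^ 20 \<le> real m" using n by linarith+
  obtain t where t: "0 \<le> t" "t \<le> ?d a0 a1" "p = c t" using p c(2) by auto
  obtain i where i: "i \<le> K" "?d p (vertex (v i)) \<le> 12" using v(7) t by blast
  define D where "D = real m / 30 + C"
  have sc: "4 * (\<delta> + 1) * log 2 (real m) + 3 * J m \<le> 5 / 3 * (r (real m) / 30)"
    using scale[OF m1(1)] by simp
  have vu: "v K = u 0" "u K' = v 0" using v u by auto
  obtain i1 i2 j where ij: "i1 \<le> i" "i \<le> i2" "i2 \<le> K" "j \<le> K'"
      "real (a.HT.word_dist (v i1) (v i2)) \<le> D" "real (a.HT.word_dist (v i1) (u j)) \<le> D"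
    using loop_coincidence[OF hyp J emb[OF m1(1)] m1(2) sc v(3) u(3) vu len i(1)] unfolding D_def by blast
  have vc: "v k \<in> carrier H" if "k \<le> K" for k using v(3) that by (simp add: a.HT.walk_def)
  have uc: "u j \<in> carrier H" using u(3) ij by (simp add: a.HT.walk_def)
  obtain q where q: "q \<in> ?Q" "?d (vertex (u j)) q \<le> 12" using u(5) ij by blast
  have R: "p \<in> a.HT.cay.R" "q \<in> a.HT.cay.R" "vertex (u j) \<in> a.HT.cay.R"
    using a.HT.cay_metric.geodesic_segment_in[OF I(1) p] q(1) vertex_in_realization[OF uc]
      sub(1)[OF I(2)] sub(1)[OF I(3)] sub(1)[OF I(4)] sub(1)[OF I(5)] sub(1)[OF I(6)] by auto
  have Rv: "vertex (v k) \<in> a.HT.cay.R" if "k \<le> K" for k using vertex_in_realization[OF vc[OF that]] .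
  have Rc: "c (\<tau> k) \<in> a.HT.cay.R" if "k \<le> K" for k using c(1) v(5) that by (auto simp: geodesic_def)
  have cd: "?d (c (\<tau> k)) (c (\<tau> l)) = \<bar>\<tau> k - \<tau> l\<bar>" if "k \<le> K" "l \<le> K" for k l
    using c(1) v(5) that unfolding geodesic_def by auto
  have le: "i1 \<le> K" "i \<le> K" "i2 \<le> K" using ij by auto
  have near_c: "?d (vertex (v k)) (c (\<tau> k)) \<le> 12" "?d (c (\<tau> k)) (vertex (v k)) \<le> 12" if "k \<le> K" for k
    using v(5) that a.HT.cay.path_metric_sym by auto
  have "?d (c (\<tau> i1)) (c (\<tau> i2)) \<le> 12 + (?d (vertex (v i1)) (vertex (v i2)) + 12)"
    using a.HT.cay_metric.triangle[OF Rc[OF le(1)] Rv[OF le(1)] Rc[OF le(3)]]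
      a.HT.cay_metric.triangle[OF Rv[OF le(1)] Rv[OF le(3)] Rc[OF le(3)]]
      near_c[OF le(1)] near_c[OF le(3)] by linarith
  then have "\<tau> i2 - \<tau> i1 \<le> D + 24"
    using cd[OF le(1,3)] ij(5) a.HT.cay.path_metric_vertex[OF vc[OF le(1)] vc[OF le(3)]] by linarith
  moreover have "\<tau> i1 \<le> \<tau> i" "\<tau> i \<le> \<tau> i2" using v(6) ij by auto
  ultimately have "?d (c (\<tau> i)) (c (\<tau> i1)) \<le> D + 24" using cd[OF le(2,1)] by linarith
  then have "?d (vertex (v i)) (vertex (v i1)) \<le> D + 48"
    using a.HT.cay_metric.triangle[OF Rv[OF le(2)] Rc[OF le(2)] Rv[OF le(1)]]
      a.HT.cay_metric.triangle[OF Rc[OF le(2)] Rc[OF le(1)] Rv[OF le(1)]]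
      near_c[OF le(1)] near_c[OF le(2)] by linarith
  moreover have "?d (vertex (v i1)) (vertex (u j)) \<le> D"
    using a.HT.cay.path_metric_vertex[OF vc[OF le(1)] uc] ij(6) by simp
  ultimately have "?d p q \<le> 2 * D + 72"
    using a.HT.cay_metric.triangle[OF R(1) Rv[OF le(2)] R(2)]
      a.HT.cay_metric.triangle[OF Rv[OF le(2)] Rv[OF le(1)] R(2)]
      a.HT.cay_metric.triangle[OF Rv[OF le(1)] R(3) R(2)] i(2) q(2) by linarith
  also have "2 * D + 72 = real m / 15 + 2 * C + 72" by (simp add: D_def)
  also have "\<dots> \<le> 9 / 10 * h" using m(2) n(3) by (simp add: field_simps)
  finally show "\<exists>q\<in>?Q. ?d p q \<le> 9 / 10 * h" using q(1) by blast
qed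

end

theorem theorem4p1:
  fixes \<Gamma> :: "('g, 'm) monoid_scheme" and \<Lambda> :: "('h, 'n) monoid_scheme"
    and S\<^sub>\<Gamma> :: "'g set" and S\<^sub>\<Lambda> :: "'h set"
    and M :: "'w measure"
    and act\<^sub>\<Gamma> :: "'g \<Rightarrow> 'w \<Rightarrow> 'w" and act\<^sub>\<Lambda> :: "'h \<Rightarrow> 'w \<Rightarrow> 'w"
    and X\<^sub>\<Gamma> X\<^sub>\<Lambda> :: "'w set"
    and \<phi> \<psi> r :: "real \<Rightarrow> real" and \<delta> L :: real
  assumes "group \<Gamma>" and "group \<Lambda>"
    and "finite_symmetric_generating_set \<Gamma> S\<^sub>\<Gamma>"
    and "finite_symmetric_generating_set \<Lambda> S\<^sub>\<Lambda>"
    and "hyperbolic_group_with \<delta> \<Gamma> S\<^sub>\<Gamma>"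
    and "L \<ge> 1"
    and "rate_function \<phi>" and "rate_function \<psi>" and "rate_function r"
    \<comment> \<open>the quotient in the next assumption is eventually well defined
       (division by 0 yields 0 in HOL)\<close>
    and "eventually (\<lambda>n::nat. \<phi> (real n / r (real n)) > 0) sequentially"
    and "(\<lambda>n::nat. (real n)\<^sup>2 * r (real n) * real (Vol \<Gamma> S\<^sub>\<Gamma> (r (real n)))
            / \<phi> (real n / r (real n))) \<longlonglongrightarrow> 0"
    and "eventually (\<lambda>n::nat. r (real n) / 18 \<ge>
            4 * (\<delta> + 1) * log 2 (real n) + 3 * gen_inverse \<psi> (3 * L * real n)) sequentially"
    and "me_coupling \<Gamma> \<Lambda> M act\<^sub>\<Gamma> act\<^sub>\<Lambda> X\<^sub>\<Gamma> X\<^sub>\<Lambda>"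
    and "cobounded \<Lambda> act\<^sub>\<Lambda> X\<^sub>\<Gamma> X\<^sub>\<Lambda>"
    and "emeasure M X\<^sub>\<Gamma> = 1"
    and "\<And>s. s \<in> S\<^sub>\<Gamma> \<Longrightarrow>
           (\<integral>\<^sup>+x\<in>X\<^sub>\<Lambda>. ennreal (\<phi> (real (word_length \<Lambda> S\<^sub>\<Lambda> (cocycle act\<^sub>\<Gamma> \<Lambda> act\<^sub>\<Lambda> X\<^sub>\<Lambda> s x)))) \<partial>M) < \<infinity>"
    and "\<And>t. t \<in> S\<^sub>\<Lambda> \<Longrightarrow>
           (\<integral>\<^sup>+x\<in>X\<^sub>\<Gamma>. ennreal (\<psi> (real (word_length \<Gamma> S\<^sub>\<Gamma> (cocycle act\<^sub>\<Lambda> \<Gamma> act\<^sub>\<Gamma> X\<^sub>\<Gamma> t x)))) \<partial>M) \<le> ennreal L"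
  shows "hyperbolic_group \<Lambda> S\<^sub>\<Lambda>"
proof -
  interpret quantitative_coupling \<Gamma> S\<^sub>\<Gamma> \<Lambda> S\<^sub>\<Lambda> M act\<^sub>\<Gamma> act\<^sub>\<Lambda> X\<^sub>\<Lambda> X\<^sub>\<Gamma>
    using assms(1-4,13) unfolding me_coupling_def
    by (intro quantitative_coupling.intro quantitative_cocycle.intro cocycle_action.intro
        cocycle_action_axioms.intro mp_action.intro mp_action_axioms.intro
        fg_group.intro fg_group_axioms.intro) auto
  define J where "J n = gen_inverse \<psi> (3 * L * real n)" for n
  have J: "0 \<le> J n" for n unfolding J_def by (rule gen_inverse_nonneg[OF assms(8)])
  obtain C where C: "0 \<le> C" and emb: "eventually (\<lambda>n::nat. coarsely_embeds (5 / 2 * real n) (J n)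
            (r (real n) / 30) (real n / 30 + C)) sequentially"
    using eventually_coarsely_embeds[OF assms(6-11,14-17)] unfolding J_def by blast
  have "eventually (\<lambda>n::nat. coarsely_embeds (5 / 2 * real n) (J n) (r (real n) / 30) (real n / 30 + C) \<and>
      4 * (\<delta> + 1) * log 2 (real n) + 3 * J n \<le> r (real n) / 18) sequentially"
    using emb assms(12) by eventually_elim (simp add: J_def)
  then obtain n1 where n1: "\<And>n::nat. n1 \<le> n \<Longrightarrow> coarsely_embeds (5 / 2 * real n) (J n) (r (real n) / 30) (real n / 30 + C)"
      "\<And>n::nat. n1 \<le> n \<Longrightarrow> 4 * (\<delta> + 1) * log 2 (real n) + 3 * J n \<le> r (real n) / 18"
    unfolding eventually_sequentially by blast
  define T where "T = max (real n1) (max (2 ^ 20) (100 * C + 3800))"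
  have T: "0 < T" unfolding T_def by (simp add: less_max_iff_disj)
  have "thin_hexagons a.HT.cay.R a.HT.cay.dist h" if "T \<le> h" for h
    by (rule thin_hexagons_of_scale[OF assms(5) C, where J = J and r = r and ?n1.0 = "real n1"])
      (use that n1 J in \<open>auto simp: T_def\<close>)
  then have "hyperbolic_with T a.HT.cay.R a.HT.cay.dist"
    by (rule a.HT.cay_metric.hyperbolic_if_thin_hexagons[OF a.HT.cay.geodesic_metric_space_realization T])
  then show ?thesis
    unfolding hyperbolic_group_def hyperbolic_group_with_def using T by (intro exI[of _ T]) auto
qed

end
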